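(* Let $\Gamma$ be a CH2O type environment, $\delta$ a CH2O function environment and $s_h$ a CH2O core C statement. If the program $s_h$ is correct in the core C big-step semantics, i.e. $\mathrm{CHcorrect}(0,s_h,[\,])$ holds (either $\mathrm{exec}\,[\,]\,s_h\,(\mathrm{OReturn}\,z)$ for some $z\in\mathbb Z$, or $\mathrm{execinf}\,[\,]\,s_h$), then $s_h$ is correct as the body of $\texttt{main}$ in the CH2O core C small-step semantics: for every execution state $S$, if $\Gamma$ is valid, $\delta$ is valid with respect to $\Gamma$ and the empty memory typing, $s_h$ has statement type $(\mathrm{true},\mathrm{Some}\ \text{signed int})$ in $\Gamma$ with empty memory typing and no local variables, and $$\Gamma,\delta,[\,]\vdash \mathbf{S}\big([\mathrm{CParams}\ \texttt{main}\ [\,]],\ (\searrow,s_h),\ \emptyset\big)\Rightarrow^{*}S,$$ then either $S$ can take a further step of $\Gamma,\delta,[\,]\vdash\cdot\Rightarrow\cdot$, or there are a memory $m$ and an integer $z$ with $S=\mathbf{S}\big([\,],\ \mathrm{Return}\ \texttt{main}\ (\mathrm{int}_{\text{signed int}}\,z),\ m\big)$.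
   Context: The setting is core C, the kernel language of Krebbers' CH2O formalization of C11 (R. Krebbers, "The C standard formalized in Coq", PhD thesis 2015, and its Coq development), for the LP64 data model. Syntax, typing, validity, memory and the ($\rho$-extended) small-step relation are those of CH2O; their parts relevant for the constructs below are recalled. Write sint for signed int; "in range" means lying in $[-2^{31},2^{31}-1]$. $l\,!!\,i$ is partial list lookup (0-based). **Syntax (de Bruijn indices for locals).** Relevant expressions: values (with a set $\Omega$ of locked addresses attached), in particular the literal $\#\,\mathrm{int}\,z$ of type sint; $\mathrm{var}\,i$ (an lvalue); $\mathrm{load}\,e$; unary $\mathrm{op}\,e$; binary $e_1\,\mathrm{op}\,e_2$; assignment $e_1::=e_2$; $\mathrm{cast}_\tau e$. Relevant statements: $\mathrm{skip}$, $s_1;;s_2$, $\mathrm{local}_\tau\,s$ (declares an uninitialised local of type $\tau$, which becomes index 0), $!e$ (expression statement; $e_1::=e_2$ used as a statement means $!(e_1::=e_2)$), $\mathrm{if}\{e\}\,s_1\,\mathrm{else}\,s_2$, $\mathrm{throw}\,n$, $\mathrm{catch}\,s$, $\mathrm{loop}\,s$, $\mathrm{ret}\,e$. Full core C also has pointers, aggregates, calls, allocation, comma and conditional expressions, goto/labels and switch/case. **Big-step semantics.** A store is a list of elements of $\mathrm{option}\,\mathbb Z$. $\mathrm{eval}\,\sigma\,e\,z$ is inductively defined: $\mathrm{eval}\,\sigma\,(\#\,\mathrm{int}\,z)\,z$ if $z$ in range; $\mathrm{eval}\,\sigma\,(\mathrm{load}(\mathrm{var}\,i))\,z$ if $\sigma\,!!\,i=\mathrm{Some}(\mathrm{Some}\,z)$;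 for logical not, if $\mathrm{eval}\,\sigma\,e\,z$ then $\mathrm{eval}\,\sigma\,(\mathrm{not}\,e)\,z'$ with $z'=1$ if $z=0$ and $0$ otherwise; for binary $+,-,/,<,\le,==$, if $\mathrm{eval}\,\sigma\,e_j\,z_j$ ($j=1,2$), the divisor is nonzero for $/$, and the result $r$ (truncated quotient for $/$; $1$/$0$ for true/false comparisons) is in range, then $\mathrm{eval}\,\sigma\,(e_1\,\mathrm{op}\,e_2)\,r$. Outcomes: $\mathrm{ONormal}\,\sigma'$, $\mathrm{OReturn}\,z$, $\mathrm{OThrow}\,n\,\sigma'$. "Abnormal" = not $\mathrm{ONormal}$; "nothrown" = not $\mathrm{OThrow}$. $\mathrm{exec}\,\sigma\,s\,O$ is inductively defined by: - $\mathrm{exec}\,\sigma\,\mathrm{skip}\,(\mathrm{ONormal}\,\sigma)$. - $\mathrm{exec}\,\sigma\,(s_1;;s_2)\,O$ if $\mathrm{exec}\,\sigma\,s_1\,(\mathrm{ONormal}\,\sigma')$ and $\mathrm{exec}\,\sigma'\,s_2\,O$; or if $O$ is abnormal and $\mathrm{exec}\,\sigma\,s_1\,O$. - If $\mathrm{exec}\,(\mathrm{None}::\sigma)\,s\,O'$ then $\mathrm{exec}\,\sigma\,(\mathrm{local}_{\mathrm{sint}}\,s)\,O$, where $(O',O)$ is one of $(\mathrm{ONormal}(mv::\sigma'),\mathrm{ONormal}\,\sigma')$, $(\mathrm{OReturn}\,z,\mathrm{OReturn}\,z)$, $(\mathrm{OThrow}\,n\,(mv::\sigma'),\mathrm{OThrow}\,n\,\sigma')$.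 - If $i<\mathrm{length}\,\sigma$ and $\mathrm{eval}\,\sigma\,e\,z$ then both $\mathrm{var}\,i::=\mathrm{cast}_{\mathrm{sint}}e$ and $!(\mathrm{cast}_{\mathrm{void}}(\mathrm{var}\,i::=e))$ execute from $\sigma$ with outcome $\mathrm{ONormal}(\sigma[i:=\mathrm{Some}\,z])$. - If $\mathrm{eval}\,\sigma\,e\,z$ and $\mathrm{exec}\,\sigma\,s'\,O$ with $s'=s_2$ if $z=0$ and $s'=s_1$ otherwise, then $\mathrm{exec}\,\sigma\,(\mathrm{if}\{e\}\,s_1\,\mathrm{else}\,s_2)\,O$. - $\mathrm{exec}\,\sigma\,(\mathrm{throw}\,n)\,(\mathrm{OThrow}\,n\,\sigma)$. - $\mathrm{exec}\,\sigma\,(\mathrm{catch}\,s)\,(\mathrm{ONormal}\,\sigma')$ if $\mathrm{exec}\,\sigma\,s\,(\mathrm{OThrow}\,0\,\sigma')$; $\mathrm{exec}\,\sigma\,(\mathrm{catch}\,s)\,(\mathrm{OThrow}\,n\,\sigma')$ if $\mathrm{exec}\,\sigma\,s\,(\mathrm{OThrow}\,(n+1)\,\sigma')$; $\mathrm{exec}\,\sigma\,(\mathrm{catch}\,s)\,O$ if $O$ is nothrown and $\mathrm{exec}\,\sigma\,s\,O$. - For abnormal $O$: $\mathrm{exec}\,\sigma\,(\mathrm{loop}\,s)\,O$ if $\mathrm{exec}\,\sigma\,s\,O$, or if $\mathrm{exec}\,\sigma\,s\,(\mathrm{ONormal}\,\sigma')$ and $\mathrm{exec}\,\sigma'\,(\mathrm{loop}\,s)\,O$.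 - $\mathrm{exec}\,\sigma\,(\mathrm{ret}(\mathrm{cast}_{\mathrm{sint}}e))\,(\mathrm{OReturn}\,z)$ if $\mathrm{eval}\,\sigma\,e\,z$. $\mathrm{execinf}\,\sigma\,s$ (divergence) is coinductively defined by: $s_1;;s_2$ diverges from $\sigma$ if $\mathrm{execinf}\,\sigma\,s_1$, or $\mathrm{exec}\,\sigma\,s_1\,(\mathrm{ONormal}\,\sigma')$ and $\mathrm{execinf}\,\sigma'\,s_2$; $\mathrm{local}_{\mathrm{sint}}\,s$ if $\mathrm{execinf}\,(\mathrm{None}::\sigma)\,s$; $\mathrm{if}\{e\}\,s_1\,\mathrm{else}\,s_2$ if $\mathrm{eval}\,\sigma\,e\,z$ and the selected branch ($s_2$ if $z=0$, else $s_1$) diverges from $\sigma$; $\mathrm{catch}\,s$ if $\mathrm{execinf}\,\sigma\,s$; $\mathrm{loop}\,s$ if $\mathrm{execinf}\,\sigma\,s$, or $\mathrm{exec}\,\sigma\,s\,(\mathrm{ONormal}\,\sigma')$ and $\mathrm{execinf}\,\sigma'\,(\mathrm{loop}\,s)$. $\mathrm{CHcorrect}(n,s,\sigma)$ means: if $\mathrm{length}\,\sigma=n$ and every integer stored in $\sigma$ is in range, then $(\exists z,\ \mathrm{exec}\,\sigma\,s\,(\mathrm{OReturn}\,z))$ or $\mathrm{execinf}\,\sigma\,s$. **Environments and typing.** A type environment $\Gamma$ gives the field types of structs/unions and the types of functions; it is valid if all these types are well-formed (no ill-founded recursion). A function environment (program) $\delta$ maps function names to bodies; it is valid w.r.t.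 $\Gamma$ and a memory typing if its functions are exactly those declared in $\Gamma$ and each body is well-typed with the declared parameters as locals and the declared return type, all its gotos have targets and all its throws are caught. A statement type is a pair $(c,\tau^?)$: $c=\mathrm{true}$ records that the statement never finishes normally (control does not fall through), $\tau^?$ is the optional type of returned values. E.g. $\mathrm{skip}$ and $!e$ ($e$ well-typed) have type $(\mathrm{false},\mathrm{None})$; $\mathrm{throw}\,n$ has $(\mathrm{true},\mathrm{None})$; $\mathrm{ret}\,e$ has $(\mathrm{true},\mathrm{Some}\,\tau)$ for $e$ an rvalue of type $\tau$; $\mathrm{local}_\tau s$ has the type of $s$ with $\tau$ prepended to the local types; $\mathrm{catch}\,s$ has $(\mathrm{false},\tau^?)$ and $\mathrm{loop}\,s$ has $(\mathrm{true},\tau^?)$ if $s$ has $(c,\tau^?)$; $s_1;;s_2$ has flag $c_2$ and $\mathrm{if}$ has flag $c_1\wedge c_2$, with the return types of the two parts required to be compatible and merged. **States.** A state $\mathbf S(k,\phi,m)$ has a program context $k$ (a list of items: $\mathrm{CStmt}\,E$ for a one-hole statement context $E$ such as $\Box;;s_2$, $s_1;;\Box$, $\mathrm{catch}\,\Box$, $\mathrm{loop}\,\Box$, $\mathrm{if}\{e\}\Box\,\mathrm{else}\,s_2$, $\mathrm{if}\{e\}s_1\,\mathrm{else}\,\Box$; $\mathrm{CLocal}\,o\,\tau$ for a local stored at object identifier $o$; $\mathrm{CExpr}\,e\,E$ for an expression $e$ under evaluation inside a statement context $E\in\{!\Box,\mathrm{ret}\,\Box,\mathrm{if}\{\Box\}s_1\,\mathrm{else}\,s_2,\dots\}$;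 $\mathrm{CFun}$ for a calling expression context; $\mathrm{CParams}\,f\,\overline{(o,\tau)}$ for the parameters of the running function $f$), a focus $\phi$ (a statement with direction $(d,s)$, $d\in\{\searrow,\nearrow,\uparrow n\text{ (throw)},\uparrow\uparrow v\text{ (return)},\text{goto, switch}\}$; an expression; a call; $\mathrm{Return}\,f\,v$; or $\mathrm{Undef}$, denoting undefined behaviour) and a memory $m$ ($\emptyset$ = empty memory). $\mathrm{locals}(k)$ is the list of $(o,\tau)$ for the $\mathrm{CLocal}$ items from the top of $k$ up to the nearest $\mathrm{CParams}$, followed by the parameters in that item. The memory maps object identifiers to typed objects whose (sub)addresses may be locked; a new sint object is indeterminate. **Small steps** $\Gamma,\delta,\rho\vdash S_1\Rightarrow S_2$ (the list $\rho$ of (object, type) pairs is appended to $\mathrm{locals}(k)$ when resolving variables; here $\rho=[\,]$; memory unchanged unless stated): - $(\searrow,\mathrm{skip})$ steps to $(\nearrow,\mathrm{skip})$; $(\searrow,\mathrm{throw}\,n)$ to $(\uparrow n,\mathrm{throw}\,n)$. - $(\searrow,E[e])$ in $k$ steps to expression focus $e$ in $\mathrm{CExpr}\,e\,E::k$. When the expression has become a value with lock set $\Omega$, the addresses in $\Omega$ are unlocked and: for $!\Box$ go to $(\nearrow,!e)$; for $\mathrm{ret}\,\Box$ with value $v$ go to $(\uparrow\uparrow v,\mathrm{ret}\,e)$; for $\mathrm{if}$ enter ($\searrow$) $s_1$ if the value is nonzero, $s_2$ if zero, pushing the corresponding $\mathrm{CStmt}$ item, and go to $\mathrm{Undef}$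 if the value cannot be branched on (e.g. indeterminate). - Entering $(\searrow)$ $s_1;;s_2$, $\mathrm{catch}\,s$, $\mathrm{loop}\,s$ pushes the context item and enters $s_1$, resp. $s$. Leaving $(\nearrow)$: from $s_1$ in $\Box;;s_2$ enter $s_2$ in $s_1;;\Box$; from $s_2$ in $s_1;;\Box$, from the body of $\mathrm{catch}$, and from a branch of $\mathrm{if}$ pop the item with direction $\nearrow$; from the body of $\mathrm{loop}\,\Box$ pop to $(\searrow,\mathrm{loop}\,s)$. - $(\uparrow 0,s)$ under $\mathrm{catch}\,\Box$ steps to $(\nearrow,\mathrm{catch}\,s)$, $(\uparrow(n+1),s)$ under $\mathrm{catch}\,\Box$ to $(\uparrow n,\mathrm{catch}\,s)$; under any other statement context item $E$, $(\uparrow n,s)$ steps to $(\uparrow n,E[s])$; under any statement context item, $(\uparrow\uparrow v,s)$ steps to $(\uparrow\uparrow v,E[s])$. - $(\searrow,\mathrm{local}_\tau s)$ pushes $\mathrm{CLocal}\,o\,\tau$ for any fresh $o$, allocating a new indeterminate object of type $\tau$ at $o$, and enters $s$; a focus on $s$ with outgoing direction ($\nearrow$, $\uparrow n$, $\uparrow\uparrow v$) under $\mathrm{CLocal}\,o\,\tau$ pops it, frees $o$, and keeps the direction on $\mathrm{local}_\tau s$. - Under $\mathrm{CParams}\,f\,\overline{(o,\tau)}::k$: $(\uparrow\uparrow v,s)$ steps to focus $\mathrm{Return}\,f\,v$ in $k$, $(\nearrow,s)$ steps to $\mathrm{Return}\,f$ with the void value in $k$, freeing the parameters. $\mathrm{Return}\,f\,v$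 under a $\mathrm{CFun}$ item resumes the caller; with empty context it does not step. - Expression focus: any redex in any expression evaluation context (evaluation order is nondeterministic) may be head-reduced: $\mathrm{var}\,i$ to the address of the $i$-th entry of the locals; $\mathrm{load}$ of an address to the stored value if readable and not locked; $a::=v$ to the value $v$ converted to the type of $a$, storing it at $a$ and locking $a$ (adding $a$ to the value's lock set), if $a$ is writable and not locked and the conversion is defined; unary/binary operations and casts on values to their C results, if defined (no signed overflow, no division by zero, no indeterminate operands, casts of in-range ints to sint being the identity and casts to void giving the void value). If a redex has no head reduction (and is not a call), the state steps to $\mathrm{Undef}$. An $\mathrm{Undef}$ state does not step. - The remaining rules (calls, goto, switch, etc.) are as in CH2O. $\Rightarrow^*$ is the reflexive-transitive closure. *)

theory Defs
  imports Complex_Main "HOL-Library.Finite_Map" "HOL-Library.Signed_Division"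
begin

(* Core C of CH2O (R. Krebbers, "The C standard formalized in Coq"), instantiated with the LP64
   data model: 8-bit bytes, two's complement, little endian, natural alignment. *)

section \<open>Types and type environments\<close>

type_synonym tag = string
type_synonym funname = string
type_synonym labelname = string
type_synonym index = nat

datatype signedness = Signed | Unsigned
datatype c_rank = CharRank | ShortRank | IntRank | LongRank | LongLongRank
datatype int_type = IntType (int_sign: signedness) (int_rank: c_rank)
datatype compound_kind = Struct_kind | Union_kind

datatype ptr_type = TType ctype | TAny | TFun "ctype list" ctype
and base_type = TVoid | TInt int_type | TPtr ptr_type
and ctype = TBase base_type | TArray ctype nat | TCompound compound_kind tag

abbreviation "sintI \<equiv> IntType Signed IntRank"
abbreviation "uintI \<equiv> IntType Unsigned IntRank"
abbreviation "ucharI \<equiv> IntType Unsigned CharRank"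
abbreviation "sptrI \<equiv> IntType Signed LongRank"
abbreviation "sintT \<equiv> TBase (TInt sintI)"
abbreviation "ucharT \<equiv> TBase (TInt ucharI)"
abbreviation "sptrT \<equiv> TBase (TInt sptrI)"
abbreviation "voidT \<equiv> TBase TVoid"

datatype env = Env
  (env_t: "(tag, ctype list) fmap")
  (env_f: "(funname, ctype list \<times> ctype) fmap")

definition env_delete :: "tag \<Rightarrow> env \<Rightarrow> env" where
  "env_delete t \<Gamma> = Env (fmdrop t (env_t \<Gamma>)) (env_f \<Gamma>)"

definition lookup :: "'a list \<Rightarrow> nat \<Rightarrow> 'a option" where
  "lookup xs i = (if i < length xs then Some (xs ! i) else None)"

definition list_alter :: "('a \<Rightarrow> 'a) \<Rightarrow> nat \<Rightarrow> 'a list \<Rightarrow> 'a list" where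
  "list_alter f i xs = xs[i := f (xs ! i)]"

definition field_type :: "env \<Rightarrow> tag \<Rightarrow> nat \<Rightarrow> ctype option" where
  "field_type \<Gamma> t i = Option.bind (fmlookup (env_t \<Gamma>) t) (\<lambda>\<tau>s. lookup \<tau>s i)"

(* A compound tag below a pointer need not be declared, which allows recursive data types. *)
inductive ptr_type_valid :: "env \<Rightarrow> ptr_type \<Rightarrow> bool"
  and base_type_valid :: "env \<Rightarrow> base_type \<Rightarrow> bool"
  and type_valid :: "env \<Rightarrow> ctype \<Rightarrow> bool"
  for \<Gamma> :: env where
  "ptr_type_valid \<Gamma> TAny"
| "base_type_valid \<Gamma> \<tau>b \<Longrightarrow> ptr_type_valid \<Gamma> (TType (TBase \<tau>b))"
| "type_valid \<Gamma> \<tau> \<Longrightarrow> n \<noteq> 0 \<Longrightarrow> ptr_type_valid \<Gamma> (TType (TArray \<tau> n))"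
| "ptr_type_valid \<Gamma> (TType (TCompound c t))"
| "\<forall>\<tau>\<in>set \<tau>s. ptr_type_valid \<Gamma> (TType \<tau>) \<Longrightarrow> ptr_type_valid \<Gamma> (TType \<tau>) \<Longrightarrow>
    ptr_type_valid \<Gamma> (TFun \<tau>s \<tau>)"
| "base_type_valid \<Gamma> TVoid"
| "base_type_valid \<Gamma> (TInt \<tau>i)"
| "ptr_type_valid \<Gamma> \<tau>p \<Longrightarrow> base_type_valid \<Gamma> (TPtr \<tau>p)"
| "base_type_valid \<Gamma> \<tau>b \<Longrightarrow> type_valid \<Gamma> (TBase \<tau>b)"
| "type_valid \<Gamma> \<tau> \<Longrightarrow> n \<noteq> 0 \<Longrightarrow> type_valid \<Gamma> (TArray \<tau> n)"
| "t |\<in>| fmdom (env_t \<Gamma>) \<Longrightarrow> type_valid \<Gamma> (TCompound c t)"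

inductive type_complete :: "env \<Rightarrow> ctype \<Rightarrow> bool" for \<Gamma> :: env where
  "type_complete \<Gamma> (TBase \<tau>b)"
| "type_complete \<Gamma> (TArray \<tau> n)"
| "t |\<in>| fmdom (env_t \<Gamma>) \<Longrightarrow> type_complete \<Gamma> (TCompound c t)"

inductive env_t_valid :: "env \<Rightarrow> bool" where
  "env_t_valid (Env fmempty F)"
| "env_t_valid (Env T F) \<Longrightarrow> fmlookup T t = None \<Longrightarrow> \<tau>s \<noteq> [] \<Longrightarrow>
    \<forall>\<tau>\<in>set \<tau>s. type_valid (Env T F) \<tau> \<Longrightarrow> env_t_valid (Env (fmupd t \<tau>s T) F)"

definition env_valid :: "env \<Rightarrow> bool" where
  "env_valid \<Gamma> \<longleftrightarrow> env_t_valid \<Gamma> \<and>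
    (\<forall>f \<tau>s \<tau>. fmlookup (env_f \<Gamma>) f = Some (\<tau>s, \<tau>) \<longrightarrow>
      (\<forall>\<sigma>\<in>set \<tau>s. ptr_type_valid \<Gamma> (TType \<sigma>)) \<and> ptr_type_valid \<Gamma> (TType \<tau>))"

section \<open>Data layout\<close>

definition char_bits :: nat where "char_bits = 8"

fun rank_size :: "c_rank \<Rightarrow> nat" where
  "rank_size CharRank = 1"
| "rank_size ShortRank = 2"
| "rank_size IntRank = 4"
| "rank_size LongRank = 8"
| "rank_size LongLongRank = 8"

fun base_size :: "base_type \<Rightarrow> nat" where
  "base_size TVoid = 1"
| "base_size (TInt \<tau>i) = rank_size (int_rank \<tau>i)"
| "base_size (TPtr \<tau>p) = 8"

(* Recursion over a type and the fields of its compounds. Looking up a tag removes it from the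
   environment, so the recursion is total; for valid environments this makes no difference. *)
function type_iter :: "(base_type \<Rightarrow> 'a) \<Rightarrow> (ctype \<Rightarrow> nat \<Rightarrow> 'a \<Rightarrow> 'a) \<Rightarrow>
    (compound_kind \<Rightarrow> tag \<Rightarrow> ctype list \<Rightarrow> 'a list \<Rightarrow> 'a) \<Rightarrow> env \<Rightarrow> ctype \<Rightarrow> 'a" where
  "type_iter fb fa fc \<Gamma> (TBase \<tau>b) = fb \<tau>b"
| "type_iter fb fa fc \<Gamma> (TArray \<tau> n) = fa \<tau> n (type_iter fb fa fc \<Gamma> \<tau>)"
| "type_iter fb fa fc \<Gamma> (TCompound c t) =
    (case fmlookup (env_t \<Gamma>) t of
      None \<Rightarrow> fc c t [] []
    | Some \<tau>s \<Rightarrow> fc c t \<tau>s (map (type_iter fb fa fc (env_delete t \<Gamma>)) \<tau>s))"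
  by pat_completeness auto
termination
proof (relation "measures [\<lambda>(_, _, _, \<Gamma>, _). fcard (fmdom (env_t \<Gamma>)), \<lambda>(_, _, _, _, \<tau>). size \<tau>]")
  fix fb :: "base_type \<Rightarrow> 'a" and fa :: "ctype \<Rightarrow> nat \<Rightarrow> 'a \<Rightarrow> 'a"
    and fc :: "compound_kind \<Rightarrow> tag \<Rightarrow> ctype list \<Rightarrow> 'a list \<Rightarrow> 'a"
    and \<Gamma> :: env and c t \<tau>s \<tau>
  assume "fmlookup (env_t \<Gamma>) t = Some \<tau>s"
  then have "t |\<in>| fmdom (env_t \<Gamma>)" by (rule fmdomI)
  then have "fcard (fmdom (env_t (env_delete t \<Gamma>))) < fcard (fmdom (env_t \<Gamma>))"
    by (simp only: env_delete_def env.sel fmdom_drop fcard_fminus1_less)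
  then show "((fb, fa, fc, env_delete t \<Gamma>, \<tau>), (fb, fa, fc, \<Gamma>, TCompound c t)) \<in>
    measures [\<lambda>(_, _, _, \<Gamma>, _). fcard (fmdom (env_t \<Gamma>)), \<lambda>(_, _, _, _, \<tau>). size \<tau>]"
    by simp
qed auto

definition align_up :: "nat \<Rightarrow> nat \<Rightarrow> nat" where
  "align_up al n = ((n + al - 1) div al) * al"

(* struct_layout al pos fs: the sizes, including the padding that follows, of consecutive fields
   with (size, alignment) fs starting at position pos in a struct of alignment al. *)
fun struct_layout :: "nat \<Rightarrow> nat \<Rightarrow> (nat \<times> nat) list \<Rightarrow> nat list" where
  "struct_layout al pos [] = []"
| "struct_layout al pos [(sz, _)] = [align_up al (pos + sz) - pos]"
| "struct_layout al pos ((sz, _) # (sz', al') # fs) =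
    (let pos' = align_up al' (pos + sz)
     in (pos' - pos) # struct_layout al pos' ((sz', al') # fs))"

definition fields_align :: "(nat \<times> nat) list \<Rightarrow> nat" where
  "fields_align fs = foldr lcm (map snd fs) 1"

fun compound_layout :: "compound_kind \<Rightarrow> (nat \<times> nat) list \<Rightarrow> nat \<times> nat" where
  "compound_layout Struct_kind fs =
    (sum_list (struct_layout (fields_align fs) 0 fs), fields_align fs)"
| "compound_layout Union_kind fs =
    (align_up (fields_align fs) (foldr max (map fst fs) 0), fields_align fs)"

definition size_align_of :: "env \<Rightarrow> ctype \<Rightarrow> nat \<times> nat" where
  "size_align_of = type_iter
    (\<lambda>\<tau>b. (base_size \<tau>b, base_size \<tau>b))
    (\<lambda>_ n (sz, al). (n * sz, al))
    (\<lambda>c _ _ fs. compound_layout c fs)"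

definition size_of :: "env \<Rightarrow> ctype \<Rightarrow> nat" where
  "size_of \<Gamma> \<tau> = fst (size_align_of \<Gamma> \<tau>)"

definition bit_size_of :: "env \<Rightarrow> ctype \<Rightarrow> nat" where
  "bit_size_of \<Gamma> \<tau> = size_of \<Gamma> \<tau> * char_bits"

definition field_bit_sizes :: "env \<Rightarrow> ctype list \<Rightarrow> nat list" where
  "field_bit_sizes \<Gamma> \<tau>s =
    (let fs = map (size_align_of \<Gamma>) \<tau>s
     in map (\<lambda>n. n * char_bits) (struct_layout (fields_align fs) 0 fs))"

fun ptr_size_of :: "env \<Rightarrow> ptr_type \<Rightarrow> nat" where
  "ptr_size_of \<Gamma> (TType \<tau>) = size_of \<Gamma> \<tau>"
| "ptr_size_of \<Gamma> TAny = 1"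
| "ptr_size_of \<Gamma> (TFun \<tau>s \<tau>) = 1"

section \<open>Integers\<close>

definition int_width :: "int_type \<Rightarrow> nat" where
  "int_width \<tau>i = rank_size (int_rank \<tau>i) * char_bits"

definition int_lower :: "int_type \<Rightarrow> int" where
  "int_lower \<tau>i = (case int_sign \<tau>i of Signed \<Rightarrow> - (2 ^ (int_width \<tau>i - 1)) | Unsigned \<Rightarrow> 0)"

(* Exclusive upper bound. *)
definition int_upper :: "int_type \<Rightarrow> int" where
  "int_upper \<tau>i = (case int_sign \<tau>i of Signed \<Rightarrow> 2 ^ (int_width \<tau>i - 1) | Unsigned \<Rightarrow> 2 ^ int_width \<tau>i)"

definition int_typed :: "int \<Rightarrow> int_type \<Rightarrow> bool" where
  "int_typed x \<tau>i \<longleftrightarrow> int_lower \<tau>i \<le> x \<and> x < int_upper \<tau>i"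

definition int_to_bits :: "int_type \<Rightarrow> int \<Rightarrow> bool list" where
  "int_to_bits \<tau>i x = map (bit x) [0..<int_width \<tau>i]"

definition int_of_bits :: "int_type \<Rightarrow> bool list \<Rightarrow> int" where
  "int_of_bits \<tau>i bs = horner_sum of_bool 2 bs -
    (if int_sign \<tau>i = Signed \<and> bs \<noteq> [] \<and> last bs then 2 ^ length bs else 0)"

fun rank_num :: "c_rank \<Rightarrow> nat" where
  "rank_num CharRank = 0"
| "rank_num ShortRank = 1"
| "rank_num IntRank = 2"
| "rank_num LongRank = 3"
| "rank_num LongLongRank = 4"

definition rank_max :: "c_rank \<Rightarrow> c_rank \<Rightarrow> c_rank" where
  "rank_max k1 k2 = (if rank_num k1 \<le> rank_num k2 then k2 else k1)"

definition int_promote :: "int_type \<Rightarrow> int_type" where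
  "int_promote \<tau>i =
    (if rank_num (int_rank \<tau>i) \<le> rank_num IntRank
     then (if int_upper \<tau>i \<le> int_upper sintI then sintI else uintI)
     else \<tau>i)"

(* Common type of two promoted integer types: usual arithmetic conversions, C11 6.3.1.8. *)
definition int_union_mixed :: "c_rank \<Rightarrow> c_rank \<Rightarrow> int_type" where
  "int_union_mixed ks ku =
    (if rank_num ks \<le> rank_num ku then IntType Unsigned ku
     else if int_upper (IntType Unsigned ku) \<le> int_upper (IntType Signed ks) then IntType Signed ks
     else IntType Unsigned ks)"

fun int_union :: "int_type \<Rightarrow> int_type \<Rightarrow> int_type" where
  "int_union (IntType Signed k1) (IntType Signed k2) = IntType Signed (rank_max k1 k2)"
| "int_union (IntType Unsigned k1) (IntType Unsigned k2) = IntType Unsigned (rank_max k1 k2)"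
| "int_union (IntType Signed k1) (IntType Unsigned k2) = int_union_mixed k1 k2"
| "int_union (IntType Unsigned k1) (IntType Signed k2) = int_union_mixed k2 k1"

datatype arithop = PlusOp | MinusOp | MultOp | DivOp | ModOp
datatype shiftop = ShiftLOp | ShiftROp
datatype bitop = AndOp | OrOp | XorOp
datatype compop = EqOp | LtOp | LeOp
datatype binop = ArithOp arithop | ShiftOp shiftop | BitOp bitop | CompOp compop
datatype unop = NegOp | ComplOp | NotOp

definition int_cast_ok :: "int_type \<Rightarrow> int \<Rightarrow> bool" where
  "int_cast_ok \<tau>i x \<longleftrightarrow> (int_sign \<tau>i = Signed \<longrightarrow> int_typed x \<tau>i)"

definition int_cast :: "int_type \<Rightarrow> int \<Rightarrow> int" where
  "int_cast \<tau>i x = (case int_sign \<tau>i of Signed \<Rightarrow> x | Unsigned \<Rightarrow> x mod int_upper \<tau>i)"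

fun arith_result :: "arithop \<Rightarrow> int \<Rightarrow> int \<Rightarrow> int" where
  "arith_result PlusOp x y = x + y"
| "arith_result MinusOp x y = x - y"
| "arith_result MultOp x y = x * y"
| "arith_result DivOp x y = x sdiv y"
| "arith_result ModOp x y = x smod y"

(* The remainder is undefined if the quotient is not representable (C11 6.5.5). *)
fun int_arithop_ok :: "arithop \<Rightarrow> int \<Rightarrow> int \<Rightarrow> int_type \<Rightarrow> bool" where
  "int_arithop_ok op x y \<tau>i \<longleftrightarrow>
    (op \<in> {DivOp, ModOp} \<longrightarrow> y \<noteq> 0) \<and>
    int_cast_ok \<tau>i (arith_result (if op = ModOp then DivOp else op) x y)"

definition int_arithop :: "arithop \<Rightarrow> int \<Rightarrow> int \<Rightarrow> int_type \<Rightarrow> int" where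
  "int_arithop op x y \<tau>i = int_cast \<tau>i (arith_result op x y)"

definition int_shiftop_ok :: "shiftop \<Rightarrow> int \<Rightarrow> int \<Rightarrow> int_type \<Rightarrow> bool" where
  "int_shiftop_ok op x y \<tau>i \<longleftrightarrow> 0 \<le> y \<and> y < int (int_width \<tau>i) \<and>
    (int_sign \<tau>i = Signed \<longrightarrow>
      0 \<le> x \<and> (op = ShiftLOp \<longrightarrow> x * 2 ^ nat y < int_upper \<tau>i))"

fun int_shiftop :: "shiftop \<Rightarrow> int \<Rightarrow> int \<Rightarrow> int_type \<Rightarrow> int" where
  "int_shiftop ShiftLOp x y \<tau>i = int_cast \<tau>i (x * 2 ^ nat y)"
| "int_shiftop ShiftROp x y \<tau>i = x div 2 ^ nat y"

fun bool_bitop :: "bitop \<Rightarrow> bool \<Rightarrow> bool \<Rightarrow> bool" where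
  "bool_bitop AndOp x y = (x \<and> y)"
| "bool_bitop OrOp x y = (x \<or> y)"
| "bool_bitop XorOp x y = (x \<noteq> y)"

fun comp_holds :: "compop \<Rightarrow> int \<Rightarrow> int \<Rightarrow> bool" where
  "comp_holds EqOp x y \<longleftrightarrow> x = y"
| "comp_holds LtOp x y \<longleftrightarrow> x < y"
| "comp_holds LeOp x y \<longleftrightarrow> x \<le> y"

definition int_common :: "int_type \<Rightarrow> int_type \<Rightarrow> int_type" where
  "int_common \<tau>i1 \<tau>i2 = int_union (int_promote \<tau>i1) (int_promote \<tau>i2)"

fun int_binop_type :: "binop \<Rightarrow> int_type \<Rightarrow> int_type \<Rightarrow> int_type" where
  "int_binop_type (ArithOp _) \<tau>i1 \<tau>i2 = int_common \<tau>i1 \<tau>i2"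
| "int_binop_type (ShiftOp _) \<tau>i1 \<tau>i2 = int_promote \<tau>i1"
| "int_binop_type (BitOp _) \<tau>i1 \<tau>i2 = int_common \<tau>i1 \<tau>i2"
| "int_binop_type (CompOp _) \<tau>i1 \<tau>i2 = sintI"

fun int_binop_ok :: "binop \<Rightarrow> int \<Rightarrow> int_type \<Rightarrow> int \<Rightarrow> int_type \<Rightarrow> bool" where
  "int_binop_ok (ArithOp op) x \<tau>i1 y \<tau>i2 \<longleftrightarrow>
    (let \<tau>i = int_common \<tau>i1 \<tau>i2
     in int_cast_ok \<tau>i x \<and> int_cast_ok \<tau>i y \<and> int_arithop_ok op (int_cast \<tau>i x) (int_cast \<tau>i y) \<tau>i)"
| "int_binop_ok (ShiftOp op) x \<tau>i1 y \<tau>i2 \<longleftrightarrow>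
    (let \<tau>i = int_promote \<tau>i1 in int_cast_ok \<tau>i x \<and> int_shiftop_ok op (int_cast \<tau>i x) y \<tau>i)"
| "int_binop_ok (BitOp op) x \<tau>i1 y \<tau>i2 \<longleftrightarrow>
    (let \<tau>i = int_common \<tau>i1 \<tau>i2 in int_cast_ok \<tau>i x \<and> int_cast_ok \<tau>i y)"
| "int_binop_ok (CompOp op) x \<tau>i1 y \<tau>i2 \<longleftrightarrow>
    (let \<tau>i = int_common \<tau>i1 \<tau>i2 in int_cast_ok \<tau>i x \<and> int_cast_ok \<tau>i y)"

fun int_binop :: "binop \<Rightarrow> int \<Rightarrow> int_type \<Rightarrow> int \<Rightarrow> int_type \<Rightarrow> int" where
  "int_binop (ArithOp op) x \<tau>i1 y \<tau>i2 =
    (let \<tau>i = int_common \<tau>i1 \<tau>i2 in int_arithop op (int_cast \<tau>i x) (int_cast \<tau>i y) \<tau>i)"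
| "int_binop (ShiftOp op) x \<tau>i1 y \<tau>i2 =
    (let \<tau>i = int_promote \<tau>i1 in int_shiftop op (int_cast \<tau>i x) y \<tau>i)"
| "int_binop (BitOp op) x \<tau>i1 y \<tau>i2 =
    (let \<tau>i = int_common \<tau>i1 \<tau>i2
     in int_of_bits \<tau>i (map2 (bool_bitop op)
          (int_to_bits \<tau>i (int_cast \<tau>i x)) (int_to_bits \<tau>i (int_cast \<tau>i y))))"
| "int_binop (CompOp op) x \<tau>i1 y \<tau>i2 =
    (let \<tau>i = int_common \<tau>i1 \<tau>i2 in of_bool (comp_holds op (int_cast \<tau>i x) (int_cast \<tau>i y)))"

fun int_unop_type :: "unop \<Rightarrow> int_type \<Rightarrow> int_type" where
  "int_unop_type NotOp \<tau>i = sintI"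
| "int_unop_type NegOp \<tau>i = int_promote \<tau>i"
| "int_unop_type ComplOp \<tau>i = int_promote \<tau>i"

fun int_unop_ok :: "unop \<Rightarrow> int \<Rightarrow> int_type \<Rightarrow> bool" where
  "int_unop_ok NegOp x \<tau>i \<longleftrightarrow>
    (let \<tau>i' = int_promote \<tau>i
     in int_cast_ok \<tau>i' x \<and> int_arithop_ok MinusOp 0 (int_cast \<tau>i' x) \<tau>i')"
| "int_unop_ok ComplOp x \<tau>i \<longleftrightarrow> int_cast_ok (int_promote \<tau>i) x"
| "int_unop_ok NotOp x \<tau>i \<longleftrightarrow> True"

fun int_unop :: "unop \<Rightarrow> int \<Rightarrow> int_type \<Rightarrow> int" where
  "int_unop NegOp x \<tau>i =
    (let \<tau>i' = int_promote \<tau>i in int_arithop MinusOp 0 (int_cast \<tau>i' x) \<tau>i')"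
| "int_unop ComplOp x \<tau>i =
    (let \<tau>i' = int_promote \<tau>i in int_of_bits \<tau>i' (map Not (int_to_bits \<tau>i' (int_cast \<tau>i' x))))"
| "int_unop NotOp x \<tau>i = of_bool (x = 0)"

section \<open>Permissions\<close>

(* Separation permissions: a lockable counting/fractional permission for ordinary objects, or a
   fraction of a read-only permission for const objects. *)
datatype counter = Counter rat rat
datatype 'a lockable = LUnlocked 'a | LLocked 'a
datatype perm = PObj "counter lockable" | PConst rat

datatype perm_kind = Existing | Readable | Writable | Locked

definition perm_full :: perm where "perm_full = PObj (LUnlocked (Counter 0 1))"

fun kind_of_perm :: "perm \<Rightarrow> perm_kind" where
  "kind_of_perm (PObj (LLocked _)) = Locked"
| "kind_of_perm (PObj (LUnlocked (Counter _ q))) =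
    (if q = 0 then Existing else if q = 1 then Writable else Readable)"
| "kind_of_perm (PConst _) = Readable"

definition perm_readable :: "perm \<Rightarrow> bool" where
  "perm_readable x \<longleftrightarrow> kind_of_perm x \<in> {Readable, Writable}"

definition perm_writable :: "perm \<Rightarrow> bool" where
  "perm_writable x \<longleftrightarrow> kind_of_perm x = Writable"

fun perm_unshared :: "perm \<Rightarrow> bool" where
  "perm_unshared (PObj (LLocked (Counter _ q))) \<longleftrightarrow> q = 1"
| "perm_unshared (PObj (LUnlocked (Counter _ q))) \<longleftrightarrow> q = 1"
| "perm_unshared (PConst _) \<longleftrightarrow> False"

fun perm_lock :: "perm \<Rightarrow> perm" where
  "perm_lock (PObj (LUnlocked x)) = PObj (LLocked x)"
| "perm_lock x = x"

fun perm_unlock :: "perm \<Rightarrow> perm" where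
  "perm_unlock (PObj (LLocked x)) = PObj (LUnlocked x)"
| "perm_unlock x = x"

section \<open>References, addresses and pointers\<close>

(* The flag of RUnion is True if the reference is frozen, i.e. may not be used for type punning. *)
datatype ref_seg =
    RArray nat ctype nat
  | RStruct nat tag
  | RUnion nat tag bool

(* The head of the list is the innermost segment. *)
type_synonym ref = "ref_seg list"

fun ref_seg_type :: "env \<Rightarrow> ref_seg \<Rightarrow> ctype \<Rightarrow> ctype option" where
  "ref_seg_type \<Gamma> (RArray i \<tau> n) (TArray \<tau>' n') =
    (if \<tau>' = \<tau> \<and> n' = n \<and> i < n then Some \<tau> else None)"
| "ref_seg_type \<Gamma> (RStruct i t) (TCompound Struct_kind t') =
    (if t' = t then field_type \<Gamma> t i else None)"
| "ref_seg_type \<Gamma> (RUnion i t _) (TCompound Union_kind t') =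
    (if t' = t then field_type \<Gamma> t i else None)"
| "ref_seg_type \<Gamma> _ _ = None"

fun ref_type :: "env \<Rightarrow> ref \<Rightarrow> ctype \<Rightarrow> ctype option" where
  "ref_type \<Gamma> [] \<tau> = Some \<tau>"
| "ref_type \<Gamma> (rs # r) \<tau> = Option.bind (ref_type \<Gamma> r \<tau>) (ref_seg_type \<Gamma> rs)"

fun ref_seg_offset :: "ref_seg \<Rightarrow> nat" where
  "ref_seg_offset (RArray i _ _) = i"
| "ref_seg_offset _ = 0"

fun ref_seg_set_offset :: "nat \<Rightarrow> ref_seg \<Rightarrow> ref_seg" where
  "ref_seg_set_offset i (RArray _ \<tau> n) = RArray i \<tau> n"
| "ref_seg_set_offset i rs = rs"

fun ref_offset :: "ref \<Rightarrow> nat" where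
  "ref_offset [] = 0"
| "ref_offset (rs # _) = ref_seg_offset rs"

fun ref_set_offset :: "nat \<Rightarrow> ref \<Rightarrow> ref" where
  "ref_set_offset i [] = []"
| "ref_set_offset i (rs # r) = ref_seg_set_offset i rs # r"

fun ref_size :: "ref \<Rightarrow> nat" where
  "ref_size (RArray _ _ n # _) = n"
| "ref_size _ = 1"

fun ref_seg_freeze :: "ref_seg \<Rightarrow> ref_seg" where
  "ref_seg_freeze (RUnion i t _) = RUnion i t True"
| "ref_seg_freeze rs = rs"

definition ref_freeze :: "ref \<Rightarrow> ref" where
  "ref_freeze = map ref_seg_freeze"

fun ref_seg_object_offset :: "env \<Rightarrow> ref_seg \<Rightarrow> nat" where
  "ref_seg_object_offset \<Gamma> (RArray i \<tau> _) = i * bit_size_of \<Gamma> \<tau>"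
| "ref_seg_object_offset \<Gamma> (RStruct i t) =
    (case fmlookup (env_t \<Gamma>) t of
      None \<Rightarrow> 0 | Some \<tau>s \<Rightarrow> sum_list (take i (field_bit_sizes \<Gamma> \<tau>s)))"
| "ref_seg_object_offset \<Gamma> (RUnion _ _ _) = 0"

definition ref_object_offset :: "env \<Rightarrow> ref \<Rightarrow> nat" where
  "ref_object_offset \<Gamma> r = sum_list (map (ref_seg_object_offset \<Gamma>) r)"

(* The position in the innermost array is not kept in addr_ref_base but, together with a position
   inside the bytes of an element, in addr_byte. addr_type_base is the type of the elements
   addr_ref_base points to; it differs from addr_type for void* and byte-wise access. *)
datatype addr = Addr
  (addr_index: index)
  (addr_ref_base: ref)
  (addr_byte: nat)
  (addr_type_object: ctype)
  (addr_type_base: ctype)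
  (addr_type: ptr_type)

datatype ptr = NULL ptr_type | Ptr addr | FunPtr funname "ctype list" ctype

definition castable :: "ctype \<Rightarrow> ptr_type \<Rightarrow> bool" where
  "castable \<sigma> \<sigma>p \<longleftrightarrow> \<sigma>p = TType \<sigma> \<or> \<sigma>p = TAny \<or> \<sigma>p = TType ucharT"

definition addr_freeze :: "addr \<Rightarrow> addr" where
  "addr_freeze a = Addr (addr_index a) (ref_freeze (addr_ref_base a)) (addr_byte a)
    (addr_type_object a) (addr_type_base a) (addr_type a)"

definition addr_strict :: "env \<Rightarrow> addr \<Rightarrow> bool" where
  "addr_strict \<Gamma> a \<longleftrightarrow> addr_byte a < size_of \<Gamma> (addr_type_base a) * ref_size (addr_ref_base a)"

definition addr_is_obj :: "addr \<Rightarrow> bool" where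
  "addr_is_obj a \<longleftrightarrow> addr_type a = TType (addr_type_base a)"

definition addr_ref :: "env \<Rightarrow> addr \<Rightarrow> ref" where
  "addr_ref \<Gamma> a =
    ref_set_offset (addr_byte a div size_of \<Gamma> (addr_type_base a)) (addr_ref_base a)"

definition addr_ref_byte :: "env \<Rightarrow> addr \<Rightarrow> nat" where
  "addr_ref_byte \<Gamma> a = addr_byte a mod size_of \<Gamma> (addr_type_base a)"

definition addr_object_offset :: "env \<Rightarrow> addr \<Rightarrow> nat" where
  "addr_object_offset \<Gamma> a = ref_object_offset \<Gamma> (addr_ref_base a) + addr_byte a * char_bits"

definition addr_top :: "index \<Rightarrow> ctype \<Rightarrow> addr" where
  "addr_top x \<tau> = Addr x [] 0 \<tau> \<tau> (TType \<tau>)"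

definition addr_top_array :: "index \<Rightarrow> ctype \<Rightarrow> nat \<Rightarrow> addr" where
  "addr_top_array x \<tau> n = Addr x [RArray 0 \<tau> n] 0 (TArray \<tau> n) \<tau> (TType \<tau>)"

definition addr_is_top_array :: "addr \<Rightarrow> bool" where
  "addr_is_top_array a \<longleftrightarrow>
    (\<exists>\<tau> n. addr_type_object a = TArray \<tau> n \<and> addr_ref_base a = [RArray 0 \<tau> n]) \<and> addr_byte a = 0"

definition addr_cast :: "ptr_type \<Rightarrow> addr \<Rightarrow> addr" where
  "addr_cast \<sigma>p a = Addr (addr_index a) (addr_ref_base a) (addr_byte a)
    (addr_type_object a) (addr_type_base a) \<sigma>p"

definition addr_elt :: "env \<Rightarrow> ref_seg \<Rightarrow> addr \<Rightarrow> addr" where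
  "addr_elt \<Gamma> rs a =
    (case ref_seg_type \<Gamma> rs (addr_type_base a) of
      None \<Rightarrow> a
    | Some \<sigma> \<Rightarrow> Addr (addr_index a) (ref_seg_set_offset 0 rs # addr_ref \<Gamma> a)
        (size_of \<Gamma> \<sigma> * ref_seg_offset rs) (addr_type_object a) \<sigma> (TType \<sigma>))"

fun ptr_freeze :: "ptr \<Rightarrow> ptr" where
  "ptr_freeze (Ptr a) = Ptr (addr_freeze a)"
| "ptr_freeze p = p"

fun type_of_ptr :: "ptr \<Rightarrow> ptr_type" where
  "type_of_ptr (NULL \<tau>p) = \<tau>p"
| "type_of_ptr (Ptr a) = addr_type a"
| "type_of_ptr (FunPtr f \<tau>s \<tau>) = TFun \<tau>s \<tau>"

section \<open>Memory typings\<close>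

(* The flag is True if the object has been freed. *)
type_synonym memenv = "(index, ctype \<times> bool) fmap"

definition index_typed :: "memenv \<Rightarrow> index \<Rightarrow> ctype \<Rightarrow> bool" where
  "index_typed \<Delta> x \<tau> \<longleftrightarrow> (\<exists>\<beta>. fmlookup \<Delta> x = Some (\<tau>, \<beta>))"

definition addr_typed :: "env \<Rightarrow> memenv \<Rightarrow> addr \<Rightarrow> ptr_type \<Rightarrow> bool" where
  "addr_typed \<Gamma> \<Delta> a \<sigma>p \<longleftrightarrow>
    index_typed \<Delta> (addr_index a) (addr_type_object a) \<and>
    type_valid \<Gamma> (addr_type_object a) \<and>
    int_typed (int (size_of \<Gamma> (addr_type_object a))) sptrI \<and>
    ref_type \<Gamma> (addr_ref_base a) (addr_type_object a) = Some (addr_type_base a) \<and>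
    ref_offset (addr_ref_base a) = 0 \<and>
    addr_byte a \<le> size_of \<Gamma> (addr_type_base a) * ref_size (addr_ref_base a) \<and>
    ptr_size_of \<Gamma> (addr_type a) dvd addr_byte a \<and>
    castable (addr_type_base a) (addr_type a) \<and>
    \<sigma>p = addr_type a"

inductive ptr_typed :: "env \<Rightarrow> memenv \<Rightarrow> ptr \<Rightarrow> ptr_type \<Rightarrow> bool" for \<Gamma> \<Delta> where
  "ptr_type_valid \<Gamma> \<sigma>p \<Longrightarrow> ptr_typed \<Gamma> \<Delta> (NULL \<sigma>p) \<sigma>p"
| "addr_typed \<Gamma> \<Delta> a \<sigma>p \<Longrightarrow> ptr_typed \<Gamma> \<Delta> (Ptr a) \<sigma>p"
| "fmlookup (env_f \<Gamma>) f = Some (\<tau>s, \<tau>) \<Longrightarrow> ptr_typed \<Gamma> \<Delta> (FunPtr f \<tau>s \<tau>) (TFun \<tau>s \<tau>)"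

section \<open>Bits and base values\<close>

(* PtrBit p i is the i-th bit of the object representation of the pointer p. *)
datatype ptr_bit = PtrBit ptr nat
datatype bit = BIndet | BBit bool | BPtr ptr_bit
datatype pbit = PBit (pbit_perm: perm) (pbit_bit: bit)

definition pbit_indetify :: "pbit \<Rightarrow> pbit" where
  "pbit_indetify xb = PBit (pbit_perm xb) BIndet"

definition pbit_lock :: "pbit \<Rightarrow> pbit" where
  "pbit_lock xb = PBit (perm_lock (pbit_perm xb)) (pbit_bit xb)"

definition pbit_unlock_if :: "pbit \<Rightarrow> bool \<Rightarrow> pbit" where
  "pbit_unlock_if xb \<beta> = (if \<beta> then PBit (perm_unlock (pbit_perm xb)) (pbit_bit xb) else xb)"

inductive bit_valid :: "env \<Rightarrow> memenv \<Rightarrow> bit \<Rightarrow> bool" for \<Gamma> \<Delta> where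
  "bit_valid \<Gamma> \<Delta> BIndet"
| "bit_valid \<Gamma> \<Delta> (BBit \<beta>)"
| "ptr_typed \<Gamma> \<Delta> p \<sigma>p \<Longrightarrow> ptr_freeze p = p \<Longrightarrow> i < bit_size_of \<Gamma> (TBase (TPtr \<sigma>p)) \<Longrightarrow>
    bit_valid \<Gamma> \<Delta> (BPtr (PtrBit p i))"

(* VByte: an unsigned char made of bits that are not all determinate (e.g. a byte of a pointer). *)
datatype base_val =
    VIndet base_type
  | VVoid
  | VInt int_type int
  | VPtr ptr
  | VByte "bit list"

fun type_of_base_val :: "base_val \<Rightarrow> base_type" where
  "type_of_base_val (VIndet \<tau>b) = \<tau>b"
| "type_of_base_val VVoid = TVoid"
| "type_of_base_val (VInt \<tau>i _) = TInt \<tau>i"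
| "type_of_base_val (VPtr p) = TPtr (type_of_ptr p)"
| "type_of_base_val (VByte _) = TInt ucharI"

inductive base_val_typed :: "env \<Rightarrow> memenv \<Rightarrow> base_val \<Rightarrow> base_type \<Rightarrow> bool" for \<Gamma> \<Delta> where
  "base_type_valid \<Gamma> \<tau>b \<Longrightarrow> \<tau>b \<noteq> TVoid \<Longrightarrow> base_val_typed \<Gamma> \<Delta> (VIndet \<tau>b) \<tau>b"
| "base_val_typed \<Gamma> \<Delta> VVoid TVoid"
| "int_typed x \<tau>i \<Longrightarrow> base_val_typed \<Gamma> \<Delta> (VInt \<tau>i x) (TInt \<tau>i)"
| "ptr_typed \<Gamma> \<Delta> p \<sigma>p \<Longrightarrow> base_val_typed \<Gamma> \<Delta> (VPtr p) (TPtr \<sigma>p)"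
| "length bs = char_bits \<Longrightarrow> \<forall>b\<in>set bs. bit_valid \<Gamma> \<Delta> b \<Longrightarrow>
    \<not> (\<exists>\<beta>s. bs = map BBit \<beta>s) \<Longrightarrow> \<not> (\<forall>b\<in>set bs. b = BIndet) \<Longrightarrow>
    base_val_typed \<Gamma> \<Delta> (VByte bs) (TInt ucharI)"

fun bit_to_bool :: "bit \<Rightarrow> bool option" where
  "bit_to_bool (BBit \<beta>) = Some \<beta>"
| "bit_to_bool _ = None"

fun bit_to_ptr_bit :: "bit \<Rightarrow> ptr_bit option" where
  "bit_to_ptr_bit (BPtr pb) = Some pb"
| "bit_to_ptr_bit _ = None"

definition ptr_to_bits :: "env \<Rightarrow> ptr \<Rightarrow> ptr_bit list" where
  "ptr_to_bits \<Gamma> p =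
    map (PtrBit (ptr_freeze p)) [0..<bit_size_of \<Gamma> (TBase (TPtr (type_of_ptr p)))]"

definition ptr_of_bits :: "env \<Rightarrow> ptr_type \<Rightarrow> ptr_bit list \<Rightarrow> ptr option" where
  "ptr_of_bits \<Gamma> \<tau>p pbs =
    (case pbs of
      [] \<Rightarrow> None
    | PtrBit p _ # _ \<Rightarrow> if type_of_ptr p = \<tau>p \<and> pbs = ptr_to_bits \<Gamma> p then Some p else None)"

fun base_val_flatten :: "env \<Rightarrow> base_val \<Rightarrow> bit list" where
  "base_val_flatten \<Gamma> (VIndet \<tau>b) = replicate (bit_size_of \<Gamma> (TBase \<tau>b)) BIndet"
| "base_val_flatten \<Gamma> VVoid = replicate (bit_size_of \<Gamma> voidT) BIndet"
| "base_val_flatten \<Gamma> (VInt \<tau>i x) = map BBit (int_to_bits \<tau>i x)"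
| "base_val_flatten \<Gamma> (VPtr p) = map BPtr (ptr_to_bits \<Gamma> p)"
| "base_val_flatten \<Gamma> (VByte bs) = bs"

fun base_val_unflatten :: "env \<Rightarrow> base_type \<Rightarrow> bit list \<Rightarrow> base_val" where
  "base_val_unflatten \<Gamma> TVoid bs = VVoid"
| "base_val_unflatten \<Gamma> (TInt \<tau>i) bs =
    (case those (map bit_to_bool bs) of
      Some \<beta>s \<Rightarrow> VInt \<tau>i (int_of_bits \<tau>i \<beta>s)
    | None \<Rightarrow> if \<tau>i = ucharI \<and> \<not> (\<forall>b\<in>set bs. b = BIndet) then VByte bs else VIndet (TInt \<tau>i))"
| "base_val_unflatten \<Gamma> (TPtr \<tau>p) bs =
    (case Option.bind (those (map bit_to_ptr_bit bs)) (ptr_of_bits \<Gamma> \<tau>p) of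
      Some p \<Rightarrow> VPtr p
    | None \<Rightarrow> VIndet (TPtr \<tau>p))"

section \<open>Memory trees and values\<close>

(* MUnion t i w xbs: field i of the union is active, xbs is the padding after it.
   MUnionAll t xbs: the active field is unknown. *)
datatype 'a ctree =
    MBase base_type "'a list"
  | MArray ctype "'a ctree list"
  | MStruct tag "('a ctree \<times> 'a list) list"
  | MUnion tag nat "'a ctree" "'a list"
  | MUnionAll tag "'a list"

type_synonym mtree = "pbit ctree"

(* VUnionAll t vs: a union whose active field is unknown, seen as each of its fields. *)
datatype val =
    VBase base_val
  | VArray ctype "val list"
  | VStruct tag "val list"
  | VUnion tag nat val
  | VUnionAll tag "val list"

abbreviation voidV :: val where "voidV \<equiv> VBase VVoid"
abbreviation intV :: "int_type \<Rightarrow> int \<Rightarrow> val" where "intV \<tau>i x \<equiv> VBase (VInt \<tau>i x)"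
abbreviation ptrV :: "ptr \<Rightarrow> val" where "ptrV p \<equiv> VBase (VPtr p)"

fun type_of_ctree :: "'a ctree \<Rightarrow> ctype" where
  "type_of_ctree (MBase \<tau>b _) = TBase \<tau>b"
| "type_of_ctree (MArray \<tau> ws) = TArray \<tau> (length ws)"
| "type_of_ctree (MStruct t _) = TCompound Struct_kind t"
| "type_of_ctree (MUnion t _ _ _) = TCompound Union_kind t"
| "type_of_ctree (MUnionAll t _) = TCompound Union_kind t"

fun type_of_val :: "val \<Rightarrow> ctype" where
  "type_of_val (VBase vb) = TBase (type_of_base_val vb)"
| "type_of_val (VArray \<tau> vs) = TArray \<tau> (length vs)"
| "type_of_val (VStruct t _) = TCompound Struct_kind t"
| "type_of_val (VUnion t _ _) = TCompound Union_kind t"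
| "type_of_val (VUnionAll t _) = TCompound Union_kind t"

fun split_sizes :: "nat list \<Rightarrow> 'a list \<Rightarrow> 'a list list" where
  "split_sizes [] xs = []"
| "split_sizes (n # ns) xs = take n xs # split_sizes ns (drop n xs)"

definition resize :: "nat \<Rightarrow> 'a \<Rightarrow> 'a list \<Rightarrow> 'a list" where
  "resize n x xs = take n xs @ replicate (n - length xs) x"

primrec ctree_flatten :: "'a ctree \<Rightarrow> 'a list" where
  "ctree_flatten (MBase _ xs) = xs"
| "ctree_flatten (MArray _ ws) = concat (map ctree_flatten ws)"
| "ctree_flatten (MStruct _ wxs) =
    concat (map (\<lambda>(ys, xs). ys @ xs) (map (map_prod ctree_flatten id) wxs))"
| "ctree_flatten (MUnion _ _ w xs) = ctree_flatten w @ xs"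
| "ctree_flatten (MUnionAll _ xs) = xs"

(* ctree_merge f w ys applies f to each leaf of w and the corresponding element of ys. *)
primrec ctree_merge :: "('a \<Rightarrow> 'b \<Rightarrow> 'a) \<Rightarrow> 'a ctree \<Rightarrow> 'b list \<Rightarrow> 'a ctree" where
  "ctree_merge f (MBase \<tau>b xs) = (\<lambda>ys. MBase \<tau>b (map2 f xs ys))"
| "ctree_merge f (MArray \<tau> ws) = (\<lambda>ys.
    MArray \<tau> (map2 (\<lambda>g zs. g zs) (map (ctree_merge f) ws)
      (split_sizes (map (\<lambda>w. length (ctree_flatten w)) ws) ys)))"
| "ctree_merge f (MStruct t wxs) = (\<lambda>ys.
    MStruct t (map2 (\<lambda>((g, n), xs) zs. (g (take n zs), map2 f xs (drop n zs)))
      (map (map_prod (\<lambda>w. (ctree_merge f w, length (ctree_flatten w))) id) wxs)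
      (split_sizes (map (\<lambda>(w, xs). length (ctree_flatten w) + length xs) wxs) ys)))"
| "ctree_merge f (MUnion t i w xs) = (\<lambda>ys.
    let n = length (ctree_flatten w)
    in MUnion t i (ctree_merge f w (take n ys)) (map2 f xs (drop n ys)))"
| "ctree_merge f (MUnionAll t xs) = (\<lambda>ys. MUnionAll t (map2 f xs ys))"

definition ctree_unshared :: "mtree \<Rightarrow> bool" where
  "ctree_unshared w \<longleftrightarrow> (\<forall>xb\<in>set_ctree w. perm_unshared (pbit_perm xb))"

definition ctree_unflatten :: "env \<Rightarrow> ctype \<Rightarrow> pbit list \<Rightarrow> mtree" where
  "ctree_unflatten \<Gamma> = type_iter
    (\<lambda>\<tau>b xbs. MBase \<tau>b xbs)
    (\<lambda>\<tau> n f xbs. MArray \<tau> (map f (split_sizes (replicate n (bit_size_of \<Gamma> \<tau>)) xbs)))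
    (\<lambda>c t \<tau>s fs xbs. case c of
        Struct_kind \<Rightarrow> MStruct t (map2
          (\<lambda>(\<tau>, f) ys. (f (take (bit_size_of \<Gamma> \<tau>) ys), map pbit_indetify (drop (bit_size_of \<Gamma> \<tau>) ys)))
          (zip \<tau>s fs) (split_sizes (field_bit_sizes \<Gamma> \<tau>s) xbs))
      | Union_kind \<Rightarrow> MUnionAll t xbs)
    \<Gamma>"

definition val_unflatten :: "env \<Rightarrow> ctype \<Rightarrow> bit list \<Rightarrow> val" where
  "val_unflatten \<Gamma> = type_iter
    (\<lambda>\<tau>b bs. VBase (base_val_unflatten \<Gamma> \<tau>b bs))
    (\<lambda>\<tau> n f bs. VArray \<tau> (map f (split_sizes (replicate n (bit_size_of \<Gamma> \<tau>)) bs)))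
    (\<lambda>c t \<tau>s fs bs. case c of
        Struct_kind \<Rightarrow> VStruct t (map2 (\<lambda>(\<tau>, f) ys. f (take (bit_size_of \<Gamma> \<tau>) ys))
          (zip \<tau>s fs) (split_sizes (field_bit_sizes \<Gamma> \<tau>s) bs))
      | Union_kind \<Rightarrow> VUnionAll t (map2 (\<lambda>\<tau> f. f (take (bit_size_of \<Gamma> \<tau>) bs)) \<tau>s fs))
    \<Gamma>"

definition vals_unflatten :: "env \<Rightarrow> ctype list \<Rightarrow> bit list \<Rightarrow> val list" where
  "vals_unflatten \<Gamma> \<tau>s bs = map (\<lambda>\<tau>. val_unflatten \<Gamma> \<tau> (take (bit_size_of \<Gamma> \<tau>) bs)) \<tau>s"

(* The indeterminate value of a type. *)
definition val_new :: "env \<Rightarrow> ctype \<Rightarrow> val" where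
  "val_new = type_iter
    (\<lambda>\<tau>b. VBase (if \<tau>b = TVoid then VVoid else VIndet \<tau>b))
    (\<lambda>\<tau> n v. VArray \<tau> (replicate n v))
    (\<lambda>c t _ vs. case c of Struct_kind \<Rightarrow> VStruct t vs | Union_kind \<Rightarrow> VUnionAll t vs)"

definition field_types :: "env \<Rightarrow> tag \<Rightarrow> ctype list" where
  "field_types \<Gamma> t = (case fmlookup (env_t \<Gamma>) t of None \<Rightarrow> [] | Some \<tau>s \<Rightarrow> \<tau>s)"

(* Joining bits: indeterminate bits are below all others. *)
definition bit_join :: "bit \<Rightarrow> bit \<Rightarrow> bit option" where
  "bit_join b1 b2 =
    (if b1 = BIndet then Some b2 else if b2 = BIndet \<or> b1 = b2 then Some b1 else None)"

fun bits_list_join :: "nat \<Rightarrow> bit list list \<Rightarrow> bit list option" where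
  "bits_list_join n [] = Some (replicate n BIndet)"
| "bits_list_join n (bs # bss) = Option.bind (bits_list_join n bss)
    (\<lambda>bs'. those (map2 bit_join (resize n BIndet bs) bs'))"

definition bits_list_join_default :: "nat \<Rightarrow> bit list list \<Rightarrow> bit list" where
  "bits_list_join_default n bss =
    (case bits_list_join n bss of Some bs \<Rightarrow> bs | None \<Rightarrow> replicate n BIndet)"

primrec val_flatten :: "env \<Rightarrow> val \<Rightarrow> bit list" where
  "val_flatten \<Gamma> (VBase vb) = base_val_flatten \<Gamma> vb"
| "val_flatten \<Gamma> (VArray _ vs) = concat (map (val_flatten \<Gamma>) vs)"
| "val_flatten \<Gamma> (VStruct t vs) =
    concat (map2 (\<lambda>n bs. resize n BIndet bs) (field_bit_sizes \<Gamma> (field_types \<Gamma> t))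
      (map (val_flatten \<Gamma>) vs))"
| "val_flatten \<Gamma> (VUnion t _ v) =
    resize (bit_size_of \<Gamma> (TCompound Union_kind t)) BIndet (val_flatten \<Gamma> v)"
| "val_flatten \<Gamma> (VUnionAll t vs) =
    bits_list_join_default (bit_size_of \<Gamma> (TCompound Union_kind t)) (map (val_flatten \<Gamma>) vs)"

primrec to_val :: "env \<Rightarrow> mtree \<Rightarrow> val" where
  "to_val \<Gamma> (MBase \<tau>b xbs) = VBase (base_val_unflatten \<Gamma> \<tau>b (map pbit_bit xbs))"
| "to_val \<Gamma> (MArray \<tau> ws) = VArray \<tau> (map (to_val \<Gamma>) ws)"
| "to_val \<Gamma> (MStruct t wxbs) = VStruct t (map fst (map (map_prod (to_val \<Gamma>) id) wxbs))"
| "to_val \<Gamma> (MUnion t i w _) = VUnion t i (to_val \<Gamma> w)"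
| "to_val \<Gamma> (MUnionAll t xbs) =
    VUnionAll t (vals_unflatten \<Gamma> (field_types \<Gamma> t) (map pbit_bit xbs))"

(* The memory tree of a value, with the given permissions on its bits. *)
primrec of_val :: "env \<Rightarrow> val \<Rightarrow> perm list \<Rightarrow> mtree" where
  "of_val \<Gamma> (VBase vb) = (\<lambda>xs.
    MBase (type_of_base_val vb) (map2 PBit xs (base_val_flatten \<Gamma> vb)))"
| "of_val \<Gamma> (VArray \<tau> vs) = (\<lambda>xs.
    MArray \<tau> (map2 (\<lambda>f ys. f ys) (map (of_val \<Gamma>) vs)
      (split_sizes (replicate (length vs) (bit_size_of \<Gamma> \<tau>)) xs)))"
| "of_val \<Gamma> (VStruct t vs) = (\<lambda>xs.
    MStruct t (map2
      (\<lambda>(\<tau>, f) ys. (f (take (bit_size_of \<Gamma> \<tau>) ys),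
        map (\<lambda>x. PBit x BIndet) (drop (bit_size_of \<Gamma> \<tau>) ys)))
      (zip (field_types \<Gamma> t) (map (of_val \<Gamma>) vs))
      (split_sizes (field_bit_sizes \<Gamma> (field_types \<Gamma> t)) xs)))"
| "of_val \<Gamma> (VUnion t i v) = (\<lambda>xs.
    let n = bit_size_of \<Gamma> (type_of_val v)
    in MUnion t i (of_val \<Gamma> v (take n xs)) (map (\<lambda>x. PBit x BIndet) (drop n xs)))"
| "of_val \<Gamma> (VUnionAll t vs) = (\<lambda>xs.
    MUnionAll t (map2 PBit xs
      (bits_list_join_default (bit_size_of \<Gamma> (TCompound Union_kind t)) (map (val_flatten \<Gamma>) vs))))"

definition vals_representable :: "env \<Rightarrow> memenv \<Rightarrow> val list \<Rightarrow> ctype list \<Rightarrow> bool" where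
  "vals_representable \<Gamma> \<Delta> vs \<tau>s \<longleftrightarrow>
    (\<exists>bs. (\<forall>b\<in>set bs. bit_valid \<Gamma> \<Delta> b) \<and> (\<forall>\<tau>\<in>set \<tau>s. bit_size_of \<Gamma> \<tau> \<le> length bs) \<and>
      vs = vals_unflatten \<Gamma> \<tau>s bs)"

inductive val_typed :: "env \<Rightarrow> memenv \<Rightarrow> val \<Rightarrow> ctype \<Rightarrow> bool" for \<Gamma> \<Delta> where
  "base_val_typed \<Gamma> \<Delta> vb \<tau>b \<Longrightarrow> val_typed \<Gamma> \<Delta> (VBase vb) (TBase \<tau>b)"
| "\<forall>v\<in>set vs. val_typed \<Gamma> \<Delta> v \<tau> \<Longrightarrow> n = length vs \<Longrightarrow> n \<noteq> 0 \<Longrightarrow>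
    val_typed \<Gamma> \<Delta> (VArray \<tau> vs) (TArray \<tau> n)"
| "fmlookup (env_t \<Gamma>) t = Some \<tau>s \<Longrightarrow> list_all2 (val_typed \<Gamma> \<Delta>) vs \<tau>s \<Longrightarrow>
    val_typed \<Gamma> \<Delta> (VStruct t vs) (TCompound Struct_kind t)"
| "field_type \<Gamma> t i = Some \<tau> \<Longrightarrow> val_typed \<Gamma> \<Delta> v \<tau> \<Longrightarrow>
    val_typed \<Gamma> \<Delta> (VUnion t i v) (TCompound Union_kind t)"
| "fmlookup (env_t \<Gamma>) t = Some \<tau>s \<Longrightarrow> list_all2 (val_typed \<Gamma> \<Delta>) vs \<tau>s \<Longrightarrow>
    vals_representable \<Gamma> \<Delta> vs \<tau>s \<Longrightarrow> val_typed \<Gamma> \<Delta> (VUnionAll t vs) (TCompound Union_kind t)"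

fun val_lookup_seg :: "env \<Rightarrow> ref_seg \<Rightarrow> val \<Rightarrow> val option" where
  "val_lookup_seg \<Gamma> (RArray i \<tau> n) (VArray \<tau>' vs) =
    (if n = length vs \<and> \<tau> = \<tau>' then lookup vs i else None)"
| "val_lookup_seg \<Gamma> (RStruct i t) (VStruct t' vs) = (if t = t' then lookup vs i else None)"
| "val_lookup_seg \<Gamma> (RUnion i t frozen) (VUnion t' j v) =
    (if t \<noteq> t' then None
     else if i = j then Some v
     else if frozen then None
     else map_option (\<lambda>\<tau>. val_unflatten \<Gamma> \<tau> (resize (bit_size_of \<Gamma> \<tau>) BIndet (val_flatten \<Gamma> v)))
       (field_type \<Gamma> t i))"
| "val_lookup_seg \<Gamma> (RUnion i t _) (VUnionAll t' vs) = (if t = t' then lookup vs i else None)"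
| "val_lookup_seg \<Gamma> _ _ = None"

fun val_lookup :: "env \<Rightarrow> ref \<Rightarrow> val \<Rightarrow> val option" where
  "val_lookup \<Gamma> [] v = Some v"
| "val_lookup \<Gamma> (rs # r) v = Option.bind (val_lookup \<Gamma> r v) (val_lookup_seg \<Gamma> rs)"

fun val_alter_seg :: "env \<Rightarrow> (val \<Rightarrow> val) \<Rightarrow> ref_seg \<Rightarrow> val \<Rightarrow> val" where
  "val_alter_seg \<Gamma> g (RArray i _ _) (VArray \<tau> vs) = VArray \<tau> (list_alter g i vs)"
| "val_alter_seg \<Gamma> g (RStruct i _) (VStruct t vs) = VStruct t (list_alter g i vs)"
| "val_alter_seg \<Gamma> g (RUnion i _ _) (VUnion t j v) =
    (if i = j then VUnion t i (g v)
     else case field_type \<Gamma> t i of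
       None \<Rightarrow> VUnion t j v
     | Some \<tau> \<Rightarrow> VUnion t i
         (g (val_unflatten \<Gamma> \<tau> (resize (bit_size_of \<Gamma> \<tau>) BIndet (val_flatten \<Gamma> v)))))"
| "val_alter_seg \<Gamma> g (RUnion i _ _) (VUnionAll t vs) =
    (case lookup vs i of None \<Rightarrow> VUnionAll t vs | Some v \<Rightarrow> VUnion t i (g v))"
| "val_alter_seg \<Gamma> g _ v = v"

fun val_alter :: "env \<Rightarrow> (val \<Rightarrow> val) \<Rightarrow> ref \<Rightarrow> val \<Rightarrow> val" where
  "val_alter \<Gamma> g [] = g"
| "val_alter \<Gamma> g (rs # r) = val_alter \<Gamma> (val_alter_seg \<Gamma> g rs) r"

fun ctree_lookup_seg :: "env \<Rightarrow> ref_seg \<Rightarrow> mtree \<Rightarrow> mtree option" where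
  "ctree_lookup_seg \<Gamma> (RArray i \<tau> n) (MArray \<tau>' ws) =
    (if n = length ws \<and> \<tau> = \<tau>' then lookup ws i else None)"
| "ctree_lookup_seg \<Gamma> (RStruct i t) (MStruct t' wxbs) =
    (if t = t' then map_option fst (lookup wxbs i) else None)"
| "ctree_lookup_seg \<Gamma> (RUnion i t frozen) (MUnion t' j w xbs) =
    (if t \<noteq> t' then None
     else if i = j then Some w
     else if frozen \<or> \<not> ctree_unshared (MUnion t' j w xbs) then None
     else map_option (\<lambda>\<tau>. ctree_unflatten \<Gamma> \<tau> (take (bit_size_of \<Gamma> \<tau>) (ctree_flatten w @ xbs)))
       (field_type \<Gamma> t i))"
| "ctree_lookup_seg \<Gamma> (RUnion i t _) (MUnionAll t' xbs) =
    (if t \<noteq> t' \<or> \<not> ctree_unshared (MUnionAll t' xbs) then None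
     else map_option (\<lambda>\<tau>. ctree_unflatten \<Gamma> \<tau> (take (bit_size_of \<Gamma> \<tau>) xbs)) (field_type \<Gamma> t i))"
| "ctree_lookup_seg \<Gamma> _ _ = None"

fun ctree_lookup :: "env \<Rightarrow> ref \<Rightarrow> mtree \<Rightarrow> mtree option" where
  "ctree_lookup \<Gamma> [] w = Some w"
| "ctree_lookup \<Gamma> (rs # r) w = Option.bind (ctree_lookup \<Gamma> r w) (ctree_lookup_seg \<Gamma> rs)"

definition ctree_switch :: "env \<Rightarrow> (mtree \<Rightarrow> mtree) \<Rightarrow> tag \<Rightarrow> nat \<Rightarrow> pbit list \<Rightarrow> mtree \<Rightarrow> mtree" where
  "ctree_switch \<Gamma> g t i xbs w0 =
    (case field_type \<Gamma> t i of
      None \<Rightarrow> w0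
    | Some \<tau> \<Rightarrow> MUnion t i (g (ctree_unflatten \<Gamma> \<tau> (take (bit_size_of \<Gamma> \<tau>) xbs)))
        (map pbit_indetify (drop (bit_size_of \<Gamma> \<tau>) xbs)))"

fun ctree_alter_seg :: "env \<Rightarrow> (mtree \<Rightarrow> mtree) \<Rightarrow> ref_seg \<Rightarrow> mtree \<Rightarrow> mtree" where
  "ctree_alter_seg \<Gamma> g (RArray i _ _) (MArray \<tau> ws) = MArray \<tau> (list_alter g i ws)"
| "ctree_alter_seg \<Gamma> g (RStruct i _) (MStruct t wxbs) =
    MStruct t (list_alter (map_prod g id) i wxbs)"
| "ctree_alter_seg \<Gamma> g (RUnion i _ _) (MUnion t j w xbs) =
    (if i = j then MUnion t i (g w) xbs
     else ctree_switch \<Gamma> g t i (ctree_flatten w @ xbs) (MUnion t j w xbs))"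
| "ctree_alter_seg \<Gamma> g (RUnion i _ _) (MUnionAll t xbs) =
    ctree_switch \<Gamma> g t i xbs (MUnionAll t xbs)"
| "ctree_alter_seg \<Gamma> g _ w = w"

fun ctree_alter :: "env \<Rightarrow> (mtree \<Rightarrow> mtree) \<Rightarrow> ref \<Rightarrow> mtree \<Rightarrow> mtree" where
  "ctree_alter \<Gamma> g [] = g"
| "ctree_alter \<Gamma> g (rs # r) = ctree_alter \<Gamma> (ctree_alter_seg \<Gamma> g rs) r"

definition ctree_lookup_byte :: "env \<Rightarrow> mtree \<Rightarrow> nat \<Rightarrow> mtree option" where
  "ctree_lookup_byte \<Gamma> w i =
    (if (i + 1) * char_bits \<le> length (ctree_flatten w)
     then Some (ctree_unflatten \<Gamma> ucharT (take char_bits (drop (i * char_bits) (ctree_flatten w))))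
     else None)"

definition ctree_alter_byte :: "env \<Rightarrow> (mtree \<Rightarrow> mtree) \<Rightarrow> nat \<Rightarrow> mtree \<Rightarrow> mtree" where
  "ctree_alter_byte \<Gamma> g i w =
    (let xbs = ctree_flatten w
     in ctree_unflatten \<Gamma> (type_of_ctree w)
          (take (i * char_bits) xbs @
           ctree_flatten (g (ctree_unflatten \<Gamma> ucharT (take char_bits (drop (i * char_bits) xbs)))) @
           drop ((i + 1) * char_bits) xbs))"

section \<open>The memory\<close>

(* The flag is True if the object was obtained by alloc. *)
datatype mobj = Freed ctype | Obj mtree bool

type_synonym mem = "(index, mobj) fmap"

(* Locked bits, as pairs of an object and a bit offset in it. *)
type_synonym lockset = "(index \<times> nat) fset"

definition lockset_valid :: "env \<Rightarrow> memenv \<Rightarrow> lockset \<Rightarrow> bool" where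
  "lockset_valid \<Gamma> \<Delta> \<Omega> \<longleftrightarrow>
    (\<forall>x i. (x, i) |\<in>| \<Omega> \<longrightarrow> (\<exists>\<tau>. index_typed \<Delta> x \<tau> \<and> type_valid \<Gamma> \<tau> \<and> i < bit_size_of \<Gamma> \<tau>))"

definition index_alive :: "mem \<Rightarrow> index \<Rightarrow> bool" where
  "index_alive m x \<longleftrightarrow> (\<exists>w \<mu>. fmlookup m x = Some (Obj w \<mu>))"

definition mem_alter_obj :: "(mtree \<Rightarrow> mtree) \<Rightarrow> index \<Rightarrow> mem \<Rightarrow> mem" where
  "mem_alter_obj g x m =
    (case fmlookup m x of Some (Obj w \<mu>) \<Rightarrow> fmupd x (Obj (g w) \<mu>) m | _ \<Rightarrow> m)"

definition cmap_lookup :: "env \<Rightarrow> addr \<Rightarrow> mem \<Rightarrow> mtree option" where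
  "cmap_lookup \<Gamma> a m =
    (if addr_strict \<Gamma> a then
      (case fmlookup m (addr_index a) of
        Some (Obj w0 _) \<Rightarrow> Option.bind (ctree_lookup \<Gamma> (addr_ref \<Gamma> a) w0) (\<lambda>w.
          if addr_is_obj a then Some w
          else if ctree_unshared w then ctree_lookup_byte \<Gamma> w (addr_ref_byte \<Gamma> a)
          else None)
      | _ \<Rightarrow> None)
     else None)"

definition cmap_alter :: "env \<Rightarrow> (mtree \<Rightarrow> mtree) \<Rightarrow> addr \<Rightarrow> mem \<Rightarrow> mem" where
  "cmap_alter \<Gamma> g a =
    mem_alter_obj
      (ctree_alter \<Gamma>
        (if addr_is_obj a then g else ctree_alter_byte \<Gamma> g (addr_ref_byte \<Gamma> a))
        (addr_ref \<Gamma> a))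
      (addr_index a)"

definition mem_lookup :: "env \<Rightarrow> addr \<Rightarrow> mem \<Rightarrow> val option" where
  "mem_lookup \<Gamma> a m = Option.bind (cmap_lookup \<Gamma> a m) (\<lambda>w.
    if \<forall>xb\<in>set_ctree w. perm_readable (pbit_perm xb) then Some (to_val \<Gamma> w) else None)"

(* Reading through a union changes its active field; this is the identity if no union is involved. *)
definition mem_force :: "env \<Rightarrow> addr \<Rightarrow> mem \<Rightarrow> mem" where
  "mem_force \<Gamma> a = mem_alter_obj (ctree_alter \<Gamma> id (addr_ref \<Gamma> a)) (addr_index a)"

definition mem_writable :: "env \<Rightarrow> addr \<Rightarrow> mem \<Rightarrow> bool" where
  "mem_writable \<Gamma> a m \<longleftrightarrow>
    (\<exists>w. cmap_lookup \<Gamma> a m = Some w \<and> (\<forall>xb\<in>set_ctree w. perm_writable (pbit_perm xb)))"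

definition mem_insert :: "env \<Rightarrow> addr \<Rightarrow> val \<Rightarrow> mem \<Rightarrow> mem" where
  "mem_insert \<Gamma> a v = cmap_alter \<Gamma> (\<lambda>w. of_val \<Gamma> v (map pbit_perm (ctree_flatten w))) a"

definition mem_alloc :: "env \<Rightarrow> index \<Rightarrow> bool \<Rightarrow> perm \<Rightarrow> val \<Rightarrow> mem \<Rightarrow> mem" where
  "mem_alloc \<Gamma> x \<mu> \<gamma> v =
    fmupd x (Obj (of_val \<Gamma> v (replicate (bit_size_of \<Gamma> (type_of_val v)) \<gamma>)) \<mu>)"

fun mem_alloc_list :: "env \<Rightarrow> index list \<Rightarrow> val list \<Rightarrow> mem \<Rightarrow> mem" where
  "mem_alloc_list \<Gamma> (x # xs) (v # vs) m =
    mem_alloc \<Gamma> x False perm_full v (mem_alloc_list \<Gamma> xs vs m)"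
| "mem_alloc_list \<Gamma> _ _ m = m"

definition mem_free :: "index \<Rightarrow> mem \<Rightarrow> mem" where
  "mem_free x m =
    (case fmlookup m x of Some (Obj w _) \<Rightarrow> fmupd x (Freed (type_of_ctree w)) m | _ \<Rightarrow> m)"

definition mem_freeable :: "addr \<Rightarrow> mem \<Rightarrow> bool" where
  "mem_freeable a m \<longleftrightarrow> addr_is_top_array a \<and>
    (\<exists>w. fmlookup m (addr_index a) = Some (Obj w True) \<and>
      (\<forall>xb\<in>set_ctree w. pbit_perm xb = perm_full))"

definition mem_lock :: "env \<Rightarrow> addr \<Rightarrow> mem \<Rightarrow> mem" where
  "mem_lock \<Gamma> = cmap_alter \<Gamma> (map_ctree pbit_lock)"

definition lock_singleton :: "env \<Rightarrow> addr \<Rightarrow> lockset" where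
  "lock_singleton \<Gamma> a =
    (let n = addr_object_offset \<Gamma> a
     in fset_of_list (map (Pair (addr_index a)) [n..<n + ptr_size_of \<Gamma> (addr_type a) * char_bits]))"

definition mem_unlock :: "lockset \<Rightarrow> mem \<Rightarrow> mem" where
  "mem_unlock \<Omega> = fmmap_keys (\<lambda>x ob. case ob of
      Freed \<tau> \<Rightarrow> Freed \<tau>
    | Obj w \<mu> \<Rightarrow> Obj (ctree_merge pbit_unlock_if w
        (map (\<lambda>i. (x, i) |\<in>| \<Omega>) [0..<length (ctree_flatten w)])) \<mu>)"

section \<open>Operations on pointers and values\<close>

fun ptr_alive :: "mem \<Rightarrow> ptr \<Rightarrow> bool" where
  "ptr_alive m (Ptr a) \<longleftrightarrow> index_alive m (addr_index a)"
| "ptr_alive m _ \<longleftrightarrow> True"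

definition same_array :: "addr \<Rightarrow> addr \<Rightarrow> bool" where
  "same_array a1 a2 \<longleftrightarrow>
    addr_index a1 = addr_index a2 \<and> ref_freeze (addr_ref_base a1) = ref_freeze (addr_ref_base a2)"

definition addr_plus_ok :: "env \<Rightarrow> mem \<Rightarrow> int \<Rightarrow> addr \<Rightarrow> bool" where
  "addr_plus_ok \<Gamma> m j a \<longleftrightarrow> index_alive m (addr_index a) \<and>
    0 \<le> int (addr_byte a) + j * int (ptr_size_of \<Gamma> (addr_type a)) \<and>
    int (addr_byte a) + j * int (ptr_size_of \<Gamma> (addr_type a)) \<le>
      int (size_of \<Gamma> (addr_type_base a) * ref_size (addr_ref_base a))"

definition addr_plus :: "env \<Rightarrow> int \<Rightarrow> addr \<Rightarrow> addr" where
  "addr_plus \<Gamma> j a = Addr (addr_index a) (addr_ref_base a)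
    (nat (int (addr_byte a) + j * int (ptr_size_of \<Gamma> (addr_type a))))
    (addr_type_object a) (addr_type_base a) (addr_type a)"

definition addr_minus_ok :: "mem \<Rightarrow> addr \<Rightarrow> addr \<Rightarrow> bool" where
  "addr_minus_ok m a1 a2 \<longleftrightarrow> index_alive m (addr_index a1) \<and> same_array a1 a2"

definition addr_minus :: "env \<Rightarrow> addr \<Rightarrow> addr \<Rightarrow> int" where
  "addr_minus \<Gamma> a1 a2 =
    (int (addr_byte a1) - int (addr_byte a2)) div int (ptr_size_of \<Gamma> (addr_type a1))"

(* Pointers to distinct objects may only be compared for equality, and only if neither is a
   past-the-end pointer. *)
definition addr_compop_ok :: "env \<Rightarrow> mem \<Rightarrow> compop \<Rightarrow> addr \<Rightarrow> addr \<Rightarrow> bool" where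
  "addr_compop_ok \<Gamma> m c a1 a2 \<longleftrightarrow>
    index_alive m (addr_index a1) \<and> index_alive m (addr_index a2) \<and>
    (same_array a1 a2 \<or>
     c = EqOp \<and> addr_index a1 \<noteq> addr_index a2 \<and> addr_strict \<Gamma> a1 \<and> addr_strict \<Gamma> a2)"

definition addr_compop :: "compop \<Rightarrow> addr \<Rightarrow> addr \<Rightarrow> bool" where
  "addr_compop c a1 a2 \<longleftrightarrow>
    addr_index a1 = addr_index a2 \<and> comp_holds c (int (addr_byte a1)) (int (addr_byte a2))"

fun ptr_plus_ok :: "env \<Rightarrow> mem \<Rightarrow> int \<Rightarrow> ptr \<Rightarrow> bool" where
  "ptr_plus_ok \<Gamma> m j (NULL _) \<longleftrightarrow> j = 0"
| "ptr_plus_ok \<Gamma> m j (Ptr a) \<longleftrightarrow> addr_plus_ok \<Gamma> m j a"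
| "ptr_plus_ok \<Gamma> m j (FunPtr _ _ _) \<longleftrightarrow> False"

fun ptr_plus :: "env \<Rightarrow> int \<Rightarrow> ptr \<Rightarrow> ptr" where
  "ptr_plus \<Gamma> j (Ptr a) = Ptr (addr_plus \<Gamma> j a)"
| "ptr_plus \<Gamma> j p = p"

fun ptr_minus_ok :: "mem \<Rightarrow> ptr \<Rightarrow> ptr \<Rightarrow> bool" where
  "ptr_minus_ok m (NULL _) (NULL _) \<longleftrightarrow> True"
| "ptr_minus_ok m (Ptr a1) (Ptr a2) \<longleftrightarrow> addr_minus_ok m a1 a2"
| "ptr_minus_ok m _ _ \<longleftrightarrow> False"

fun ptr_minus :: "env \<Rightarrow> ptr \<Rightarrow> ptr \<Rightarrow> int" where
  "ptr_minus \<Gamma> (Ptr a1) (Ptr a2) = addr_minus \<Gamma> a1 a2"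
| "ptr_minus \<Gamma> _ _ = 0"

fun ptr_compop_ok :: "env \<Rightarrow> mem \<Rightarrow> compop \<Rightarrow> ptr \<Rightarrow> ptr \<Rightarrow> bool" where
  "ptr_compop_ok \<Gamma> m c (NULL _) (NULL _) \<longleftrightarrow> True"
| "ptr_compop_ok \<Gamma> m c (Ptr a1) (Ptr a2) \<longleftrightarrow> addr_compop_ok \<Gamma> m c a1 a2"
| "ptr_compop_ok \<Gamma> m c (NULL _) (Ptr a) \<longleftrightarrow> c = EqOp \<and> index_alive m (addr_index a)"
| "ptr_compop_ok \<Gamma> m c (Ptr a) (NULL _) \<longleftrightarrow> c = EqOp \<and> index_alive m (addr_index a)"
| "ptr_compop_ok \<Gamma> m c (FunPtr _ _ _) (FunPtr _ _ _) \<longleftrightarrow> c = EqOp"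
| "ptr_compop_ok \<Gamma> m c (NULL _) (FunPtr _ _ _) \<longleftrightarrow> c = EqOp"
| "ptr_compop_ok \<Gamma> m c (FunPtr _ _ _) (NULL _) \<longleftrightarrow> c = EqOp"
| "ptr_compop_ok \<Gamma> m c _ _ \<longleftrightarrow> False"

fun ptr_compop :: "compop \<Rightarrow> ptr \<Rightarrow> ptr \<Rightarrow> bool" where
  "ptr_compop c (Ptr a1) (Ptr a2) \<longleftrightarrow> addr_compop c a1 a2"
| "ptr_compop c (NULL _) (NULL _) \<longleftrightarrow> comp_holds c 0 0"
| "ptr_compop c (FunPtr f _ _) (FunPtr g _ _) \<longleftrightarrow> f = g"
| "ptr_compop c _ _ \<longleftrightarrow> False"

fun ptr_cast_ok :: "env \<Rightarrow> mem \<Rightarrow> ptr_type \<Rightarrow> ptr \<Rightarrow> bool" where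
  "ptr_cast_ok \<Gamma> m \<sigma>p (NULL _) \<longleftrightarrow> True"
| "ptr_cast_ok \<Gamma> m \<sigma>p (Ptr a) \<longleftrightarrow> index_alive m (addr_index a) \<and>
    castable (addr_type_base a) \<sigma>p \<and> ptr_size_of \<Gamma> \<sigma>p dvd addr_byte a"
| "ptr_cast_ok \<Gamma> m \<sigma>p (FunPtr _ \<tau>s \<tau>) \<longleftrightarrow> \<sigma>p = TFun \<tau>s \<tau>"

fun ptr_cast :: "ptr_type \<Rightarrow> ptr \<Rightarrow> ptr" where
  "ptr_cast \<sigma>p (NULL _) = NULL \<sigma>p"
| "ptr_cast \<sigma>p (Ptr a) = Ptr (addr_cast \<sigma>p a)"
| "ptr_cast \<sigma>p (FunPtr f \<tau>s \<tau>) = FunPtr f \<tau>s \<tau>"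

fun base_val_branchable :: "mem \<Rightarrow> base_val \<Rightarrow> bool" where
  "base_val_branchable m (VInt _ _) \<longleftrightarrow> True"
| "base_val_branchable m (VPtr p) \<longleftrightarrow> ptr_alive m p"
| "base_val_branchable m _ \<longleftrightarrow> False"

fun base_val_is_0 :: "base_val \<Rightarrow> bool" where
  "base_val_is_0 (VInt _ x) \<longleftrightarrow> x = 0"
| "base_val_is_0 (VPtr (NULL _)) \<longleftrightarrow> True"
| "base_val_is_0 _ \<longleftrightarrow> False"

fun val_unop_ok :: "mem \<Rightarrow> unop \<Rightarrow> val \<Rightarrow> bool" where
  "val_unop_ok m op (VBase (VInt \<tau>i x)) \<longleftrightarrow> int_unop_ok op x \<tau>i"
| "val_unop_ok m op (VBase (VPtr p)) \<longleftrightarrow> op = NotOp \<and> ptr_alive m p"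
| "val_unop_ok m op _ \<longleftrightarrow> False"

fun val_unop :: "unop \<Rightarrow> val \<Rightarrow> val" where
  "val_unop op (VBase (VInt \<tau>i x)) = intV (int_unop_type op \<tau>i) (int_unop op x \<tau>i)"
| "val_unop op (VBase (VPtr p)) = intV sintI (of_bool (base_val_is_0 (VPtr p)))"
| "val_unop op v = v"

definition val_binop_ok :: "env \<Rightarrow> mem \<Rightarrow> binop \<Rightarrow> val \<Rightarrow> val \<Rightarrow> bool" where
  "val_binop_ok \<Gamma> m op v1 v2 \<longleftrightarrow>
    (case (v1, v2) of
      (VBase (VInt \<tau>i1 x), VBase (VInt \<tau>i2 y)) \<Rightarrow> int_binop_ok op x \<tau>i1 y \<tau>i2
    | (VBase (VPtr p1), VBase (VPtr p2)) \<Rightarrow>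
        (case op of
          CompOp c \<Rightarrow> ptr_compop_ok \<Gamma> m c p1 p2
        | ArithOp aop \<Rightarrow> aop = MinusOp \<and> ptr_minus_ok m p1 p2
        | _ \<Rightarrow> False)
    | (VBase (VPtr p), VBase (VInt _ j)) \<Rightarrow>
        op = ArithOp PlusOp \<and> ptr_plus_ok \<Gamma> m j p \<or>
        op = ArithOp MinusOp \<and> ptr_plus_ok \<Gamma> m (- j) p
    | (VBase (VInt _ j), VBase (VPtr p)) \<Rightarrow> op = ArithOp PlusOp \<and> ptr_plus_ok \<Gamma> m j p
    | _ \<Rightarrow> False)"

(* The result is only meaningful if val_binop_ok holds. *)
definition val_binop :: "env \<Rightarrow> binop \<Rightarrow> val \<Rightarrow> val \<Rightarrow> val" where
  "val_binop \<Gamma> op v1 v2 =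
    (case (v1, v2) of
      (VBase (VInt \<tau>i1 x), VBase (VInt \<tau>i2 y)) \<Rightarrow>
        intV (int_binop_type op \<tau>i1 \<tau>i2) (int_binop op x \<tau>i1 y \<tau>i2)
    | (VBase (VPtr p1), VBase (VPtr p2)) \<Rightarrow>
        (case op of
          CompOp c \<Rightarrow> intV sintI (of_bool (ptr_compop c p1 p2))
        | _ \<Rightarrow> intV sptrI (ptr_minus \<Gamma> p1 p2))
    | (VBase (VPtr p), VBase (VInt _ j)) \<Rightarrow>
        ptrV (ptr_plus \<Gamma> (if op = ArithOp MinusOp then - j else j) p)
    | (VBase (VInt _ j), VBase (VPtr p)) \<Rightarrow> ptrV (ptr_plus \<Gamma> j p)
    | _ \<Rightarrow> v1)"

(* Indeterminate bytes may be copied as unsigned char. *)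
fun base_val_cast_ok :: "env \<Rightarrow> mem \<Rightarrow> base_type \<Rightarrow> base_val \<Rightarrow> bool" where
  "base_val_cast_ok \<Gamma> m TVoid _ \<longleftrightarrow> True"
| "base_val_cast_ok \<Gamma> m (TInt \<tau>i) (VInt _ x) \<longleftrightarrow> int_cast_ok \<tau>i x"
| "base_val_cast_ok \<Gamma> m (TPtr \<tau>p) (VPtr p) \<longleftrightarrow> ptr_cast_ok \<Gamma> m \<tau>p p"
| "base_val_cast_ok \<Gamma> m (TInt \<tau>i) (VByte _) \<longleftrightarrow> \<tau>i = ucharI"
| "base_val_cast_ok \<Gamma> m (TInt \<tau>i) (VIndet \<tau>b) \<longleftrightarrow> \<tau>i = ucharI \<and> \<tau>b = TInt ucharI"
| "base_val_cast_ok \<Gamma> m _ _ \<longleftrightarrow> False"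

fun base_val_cast :: "base_type \<Rightarrow> base_val \<Rightarrow> base_val" where
  "base_val_cast TVoid _ = VVoid"
| "base_val_cast (TInt \<tau>i) (VInt _ x) = VInt \<tau>i (int_cast \<tau>i x)"
| "base_val_cast (TPtr \<tau>p) (VPtr p) = VPtr (ptr_cast \<tau>p p)"
| "base_val_cast _ vb = vb"

fun val_cast_ok :: "env \<Rightarrow> mem \<Rightarrow> ptr_type \<Rightarrow> val \<Rightarrow> bool" where
  "val_cast_ok \<Gamma> m (TType (TBase \<tau>b)) (VBase vb) \<longleftrightarrow> base_val_cast_ok \<Gamma> m \<tau>b vb"
| "val_cast_ok \<Gamma> m _ _ \<longleftrightarrow> True"

fun val_cast :: "ptr_type \<Rightarrow> val \<Rightarrow> val" where
  "val_cast (TType (TBase \<tau>b)) (VBase vb) = VBase (base_val_cast \<tau>b vb)"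
| "val_cast (TType (TBase TVoid)) _ = voidV"
| "val_cast _ v = v"

section \<open>Expressions and statements\<close>

(* Results of expressions: Inl p is an lvalue, Inr v an rvalue; likewise for their types. *)
type_synonym lrval = "ptr + val"
type_synonym lrtype = "ptr_type + ctype"

datatype assign = Assign | PreOp binop | PostOp binop

(* ERtoL is the C operator * and ERofL is &. EEltL and EEltR select a subobject of an lvalue resp.
   rvalue, and EInsert r e1 e2 replaces the part of e2 at r by e1. *)
datatype expr =
    EVar nat
  | EVal lockset lrval
  | ERtoL expr
  | ERofL expr
  | EAssign assign expr expr
  | ECall expr "expr list"
  | EAbort ctype
  | ELoad expr
  | EEltL expr ref_seg
  | EEltR expr ref_seg
  | EAlloc ctype expr
  | EFree expr
  | EUnOp unop expr
  | EBinOp binop expr expr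
  | EIf expr expr expr
  | EComma expr expr
  | ECast ctype expr
  | EInsert ref expr expr

abbreviation EInt :: "int \<Rightarrow> expr" where
  "EInt z \<equiv> EVal {||} (Inr (intV sintI z))"

(* SCase None is the default label of a switch. *)
datatype stmt =
    SSkip
  | SDo expr
  | SGoto labelname
  | SThrow nat
  | SRet expr
  | SLabel labelname
  | SCase "int option"
  | SLocal ctype stmt
  | SComp stmt stmt
  | SCatch stmt
  | SLoop stmt
  | SIf expr stmt stmt
  | SSwitch expr stmt

fun labels :: "stmt \<Rightarrow> labelname set" where
  "labels (SLabel l) = {l}"
| "labels (SLocal _ s) = labels s"
| "labels (SComp s1 s2) = labels s1 \<union> labels s2"
| "labels (SCatch s) = labels s"
| "labels (SLoop s) = labels s"
| "labels (SIf _ s1 s2) = labels s1 \<union> labels s2"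
| "labels (SSwitch _ s) = labels s"
| "labels _ = {}"

fun gotos :: "stmt \<Rightarrow> labelname set" where
  "gotos (SGoto l) = {l}"
| "gotos (SLocal _ s) = gotos s"
| "gotos (SComp s1 s2) = gotos s1 \<union> gotos s2"
| "gotos (SCatch s) = gotos s"
| "gotos (SLoop s) = gotos s"
| "gotos (SIf _ s1 s2) = gotos s1 \<union> gotos s2"
| "gotos (SSwitch _ s) = gotos s"
| "gotos _ = {}"

(* Case labels inside a nested switch do not belong to the enclosing one. *)
fun cases :: "stmt \<Rightarrow> int option set" where
  "cases (SCase mx) = {mx}"
| "cases (SLocal _ s) = cases s"
| "cases (SComp s1 s2) = cases s1 \<union> cases s2"
| "cases (SCatch s) = cases s"
| "cases (SLoop s) = cases s"
| "cases (SIf _ s1 s2) = cases s1 \<union> cases s2"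
| "cases _ = {}"

fun throws_valid :: "nat \<Rightarrow> stmt \<Rightarrow> bool" where
  "throws_valid n (SThrow i) \<longleftrightarrow> i < n"
| "throws_valid n (SLocal _ s) \<longleftrightarrow> throws_valid n s"
| "throws_valid n (SComp s1 s2) \<longleftrightarrow> throws_valid n s1 \<and> throws_valid n s2"
| "throws_valid n (SCatch s) \<longleftrightarrow> throws_valid (Suc n) s"
| "throws_valid n (SLoop s) \<longleftrightarrow> throws_valid n s"
| "throws_valid n (SIf _ s1 s2) \<longleftrightarrow> throws_valid n s1 \<and> throws_valid n s2"
| "throws_valid n (SSwitch _ s) \<longleftrightarrow> throws_valid n s"
| "throws_valid n _ \<longleftrightarrow> True"

type_synonym funenv = "(funname, stmt) fmap"

section \<open>Type system\<close>

inductive unop_typed :: "unop \<Rightarrow> ctype \<Rightarrow> ctype \<Rightarrow> bool" where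
  "unop_typed op (TBase (TInt \<tau>i)) (TBase (TInt (int_unop_type op \<tau>i)))"
| "unop_typed NotOp (TBase (TPtr \<tau>p)) sintT"

inductive binop_typed :: "env \<Rightarrow> binop \<Rightarrow> ctype \<Rightarrow> ctype \<Rightarrow> ctype \<Rightarrow> bool" for \<Gamma> where
  "binop_typed \<Gamma> op (TBase (TInt \<tau>i1)) (TBase (TInt \<tau>i2)) (TBase (TInt (int_binop_type op \<tau>i1 \<tau>i2)))"
| "binop_typed \<Gamma> (CompOp c) (TBase (TPtr \<tau>p)) (TBase (TPtr \<tau>p)) sintT"
| "type_complete \<Gamma> \<tau> \<Longrightarrow> binop_typed \<Gamma> (ArithOp PlusOp)
    (TBase (TPtr (TType \<tau>))) (TBase (TInt \<tau>i)) (TBase (TPtr (TType \<tau>)))"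
| "type_complete \<Gamma> \<tau> \<Longrightarrow> binop_typed \<Gamma> (ArithOp PlusOp)
    (TBase (TInt \<tau>i)) (TBase (TPtr (TType \<tau>))) (TBase (TPtr (TType \<tau>)))"
| "type_complete \<Gamma> \<tau> \<Longrightarrow> binop_typed \<Gamma> (ArithOp MinusOp)
    (TBase (TPtr (TType \<tau>))) (TBase (TInt \<tau>i)) (TBase (TPtr (TType \<tau>)))"
| "type_complete \<Gamma> \<tau> \<Longrightarrow> binop_typed \<Gamma> (ArithOp MinusOp)
    (TBase (TPtr (TType \<tau>))) (TBase (TPtr (TType \<tau>))) sptrT"

(* cast_typed \<Gamma> \<tau> \<sigma>: a value of type \<tau> can be cast to \<sigma>. *)
inductive cast_typed :: "env \<Rightarrow> ctype \<Rightarrow> ctype \<Rightarrow> bool" for \<Gamma> where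
  "cast_typed \<Gamma> \<tau> \<tau>"
| "cast_typed \<Gamma> \<tau> voidT"
| "cast_typed \<Gamma> (TBase (TInt \<tau>i1)) (TBase (TInt \<tau>i2))"
| "cast_typed \<Gamma> (TBase (TPtr (TType \<tau>))) (TBase (TPtr TAny))"
| "cast_typed \<Gamma> (TBase (TPtr (TType \<tau>))) (TBase (TPtr (TType ucharT)))"
| "type_complete \<Gamma> \<tau> \<Longrightarrow> cast_typed \<Gamma> (TBase (TPtr TAny)) (TBase (TPtr (TType \<tau>)))"
| "type_complete \<Gamma> \<tau> \<Longrightarrow> cast_typed \<Gamma> (TBase (TPtr (TType ucharT))) (TBase (TPtr (TType \<tau>)))"

inductive assign_typed :: "env \<Rightarrow> ctype \<Rightarrow> ctype \<Rightarrow> assign \<Rightarrow> bool" for \<Gamma> where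
  "cast_typed \<Gamma> \<tau>2 \<tau>1 \<Longrightarrow> assign_typed \<Gamma> \<tau>1 \<tau>2 Assign"
| "binop_typed \<Gamma> op \<tau>1 \<tau>2 \<sigma> \<Longrightarrow> cast_typed \<Gamma> \<sigma> \<tau>1 \<Longrightarrow> assign_typed \<Gamma> \<tau>1 \<tau>2 (PreOp op)"
| "binop_typed \<Gamma> op \<tau>1 \<tau>2 \<sigma> \<Longrightarrow> cast_typed \<Gamma> \<sigma> \<tau>1 \<Longrightarrow> assign_typed \<Gamma> \<tau>1 \<tau>2 (PostOp op)"

inductive lrval_typed :: "env \<Rightarrow> memenv \<Rightarrow> lrval \<Rightarrow> lrtype \<Rightarrow> bool" for \<Gamma> \<Delta> where
  "ptr_typed \<Gamma> \<Delta> p \<tau>p \<Longrightarrow> lrval_typed \<Gamma> \<Delta> (Inl p) (Inl \<tau>p)"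
| "val_typed \<Gamma> \<Delta> v \<tau> \<Longrightarrow> lrval_typed \<Gamma> \<Delta> (Inr v) (Inr \<tau>)"

inductive expr_typed :: "env \<Rightarrow> memenv \<Rightarrow> ctype list \<Rightarrow> expr \<Rightarrow> lrtype \<Rightarrow> bool" for \<Gamma> \<Delta> \<tau>s where
  EVar_typed: "lookup \<tau>s i = Some \<tau> \<Longrightarrow> expr_typed \<Gamma> \<Delta> \<tau>s (EVar i) (Inl (TType \<tau>))"
| EVal_typed: "lockset_valid \<Gamma> \<Delta> \<Omega> \<Longrightarrow> lrval_typed \<Gamma> \<Delta> \<nu> \<tau>lr \<Longrightarrow> expr_typed \<Gamma> \<Delta> \<tau>s (EVal \<Omega> \<nu>) \<tau>lr"
| ERtoL_typed: "expr_typed \<Gamma> \<Delta> \<tau>s e (Inr (TBase (TPtr \<tau>p))) \<Longrightarrow> expr_typed \<Gamma> \<Delta> \<tau>s (ERtoL e) (Inl \<tau>p)"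
| ERofL_typed: "expr_typed \<Gamma> \<Delta> \<tau>s e (Inl \<tau>p) \<Longrightarrow> expr_typed \<Gamma> \<Delta> \<tau>s (ERofL e) (Inr (TBase (TPtr \<tau>p)))"
| EAssign_typed: "assign_typed \<Gamma> \<tau>1 \<tau>2 ass \<Longrightarrow> expr_typed \<Gamma> \<Delta> \<tau>s e1 (Inl (TType \<tau>1)) \<Longrightarrow>
    expr_typed \<Gamma> \<Delta> \<tau>s e2 (Inr \<tau>2) \<Longrightarrow> expr_typed \<Gamma> \<Delta> \<tau>s (EAssign ass e1 e2) (Inr \<tau>1)"
| ECall_typed: "expr_typed \<Gamma> \<Delta> \<tau>s e (Inl (TFun \<sigma>s \<sigma>)) \<Longrightarrow>
    list_all2 (\<lambda>e' \<sigma>'. expr_typed \<Gamma> \<Delta> \<tau>s e' (Inr \<sigma>')) es \<sigma>s \<Longrightarrow> type_complete \<Gamma> \<sigma> \<Longrightarrow>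
    expr_typed \<Gamma> \<Delta> \<tau>s (ECall e es) (Inr \<sigma>)"
| EAbort_typed: "type_valid \<Gamma> \<tau> \<Longrightarrow> expr_typed \<Gamma> \<Delta> \<tau>s (EAbort \<tau>) (Inr \<tau>)"
| ELoad_typed: "type_complete \<Gamma> \<tau> \<Longrightarrow> expr_typed \<Gamma> \<Delta> \<tau>s e (Inl (TType \<tau>)) \<Longrightarrow>
    expr_typed \<Gamma> \<Delta> \<tau>s (ELoad e) (Inr \<tau>)"
| EEltL_typed: "expr_typed \<Gamma> \<Delta> \<tau>s e (Inl (TType \<tau>)) \<Longrightarrow> ref_seg_type \<Gamma> rs \<tau> = Some \<sigma> \<Longrightarrow>
    expr_typed \<Gamma> \<Delta> \<tau>s (EEltL e rs) (Inl (TType \<sigma>))"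
| EEltR_typed: "expr_typed \<Gamma> \<Delta> \<tau>s e (Inr \<tau>) \<Longrightarrow> ref_seg_type \<Gamma> rs \<tau> = Some \<sigma> \<Longrightarrow>
    expr_typed \<Gamma> \<Delta> \<tau>s (EEltR e rs) (Inr \<sigma>)"
| EAlloc_typed: "type_valid \<Gamma> \<tau> \<Longrightarrow> expr_typed \<Gamma> \<Delta> \<tau>s e (Inr (TBase (TInt \<tau>i))) \<Longrightarrow>
    expr_typed \<Gamma> \<Delta> \<tau>s (EAlloc \<tau> e) (Inr (TBase (TPtr (TType \<tau>))))"
| EFree_typed: "expr_typed \<Gamma> \<Delta> \<tau>s e (Inl (TType \<tau>)) \<Longrightarrow> expr_typed \<Gamma> \<Delta> \<tau>s (EFree e) (Inr voidT)"
| EUnOp_typed: "unop_typed op \<tau> \<sigma> \<Longrightarrow> expr_typed \<Gamma> \<Delta> \<tau>s e (Inr \<tau>) \<Longrightarrow>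
    expr_typed \<Gamma> \<Delta> \<tau>s (EUnOp op e) (Inr \<sigma>)"
| EBinOp_typed: "binop_typed \<Gamma> op \<tau>1 \<tau>2 \<sigma> \<Longrightarrow> expr_typed \<Gamma> \<Delta> \<tau>s e1 (Inr \<tau>1) \<Longrightarrow>
    expr_typed \<Gamma> \<Delta> \<tau>s e2 (Inr \<tau>2) \<Longrightarrow> expr_typed \<Gamma> \<Delta> \<tau>s (EBinOp op e1 e2) (Inr \<sigma>)"
| EIf_typed: "expr_typed \<Gamma> \<Delta> \<tau>s e1 (Inr (TBase \<tau>b)) \<Longrightarrow> \<tau>b \<noteq> TVoid \<Longrightarrow>
    expr_typed \<Gamma> \<Delta> \<tau>s e2 \<sigma>lr \<Longrightarrow> expr_typed \<Gamma> \<Delta> \<tau>s e3 \<sigma>lr \<Longrightarrow> expr_typed \<Gamma> \<Delta> \<tau>s (EIf e1 e2 e3) \<sigma>lr"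
| EComma_typed: "expr_typed \<Gamma> \<Delta> \<tau>s e1 \<tau>lr1 \<Longrightarrow> expr_typed \<Gamma> \<Delta> \<tau>s e2 \<tau>lr2 \<Longrightarrow>
    expr_typed \<Gamma> \<Delta> \<tau>s (EComma e1 e2) \<tau>lr2"
| ECast_typed: "cast_typed \<Gamma> \<tau> \<sigma> \<Longrightarrow> type_valid \<Gamma> \<sigma> \<Longrightarrow> expr_typed \<Gamma> \<Delta> \<tau>s e (Inr \<tau>) \<Longrightarrow>
    expr_typed \<Gamma> \<Delta> \<tau>s (ECast \<sigma> e) (Inr \<sigma>)"
| EInsert_typed: "ref_type \<Gamma> r \<tau> = Some \<sigma> \<Longrightarrow> expr_typed \<Gamma> \<Delta> \<tau>s e1 (Inr \<sigma>) \<Longrightarrow>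
    expr_typed \<Gamma> \<Delta> \<tau>s e2 (Inr \<tau>) \<Longrightarrow> expr_typed \<Gamma> \<Delta> \<tau>s (EInsert r e1 e2) (Inr \<tau>)"

type_synonym rettype = "bool \<times> ctype option"

inductive rettype_union :: "ctype option \<Rightarrow> ctype option \<Rightarrow> ctype option \<Rightarrow> bool" where
  "rettype_union m\<sigma> m\<sigma> m\<sigma>"
| "rettype_union m\<sigma> None m\<sigma>"
| "rettype_union None m\<sigma> m\<sigma>"

inductive stmt_typed :: "env \<Rightarrow> memenv \<Rightarrow> ctype list \<Rightarrow> stmt \<Rightarrow> rettype \<Rightarrow> bool" for \<Gamma> \<Delta> where
  SSkip_typed: "stmt_typed \<Gamma> \<Delta> \<tau>s SSkip (False, None)"
| SDo_typed: "expr_typed \<Gamma> \<Delta> \<tau>s e \<tau>lr \<Longrightarrow> stmt_typed \<Gamma> \<Delta> \<tau>s (SDo e) (False, None)"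
| SGoto_typed: "stmt_typed \<Gamma> \<Delta> \<tau>s (SGoto l) (True, None)"
| SThrow_typed: "stmt_typed \<Gamma> \<Delta> \<tau>s (SThrow n) (True, None)"
| SRet_typed: "expr_typed \<Gamma> \<Delta> \<tau>s e (Inr \<tau>) \<Longrightarrow> stmt_typed \<Gamma> \<Delta> \<tau>s (SRet e) (True, Some \<tau>)"
| SLabel_typed: "stmt_typed \<Gamma> \<Delta> \<tau>s (SLabel l) (False, None)"
| SCase_typed: "stmt_typed \<Gamma> \<Delta> \<tau>s (SCase mx) (False, None)"
| SLocal_typed: "type_valid \<Gamma> \<tau> \<Longrightarrow> stmt_typed \<Gamma> \<Delta> (\<tau> # \<tau>s) s cm\<sigma> \<Longrightarrow>
    stmt_typed \<Gamma> \<Delta> \<tau>s (SLocal \<tau> s) cm\<sigma>"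
| SComp_typed: "stmt_typed \<Gamma> \<Delta> \<tau>s s1 (c1, m\<sigma>1) \<Longrightarrow> stmt_typed \<Gamma> \<Delta> \<tau>s s2 (c2, m\<sigma>2) \<Longrightarrow>
    rettype_union m\<sigma>1 m\<sigma>2 m\<sigma> \<Longrightarrow> stmt_typed \<Gamma> \<Delta> \<tau>s (SComp s1 s2) (c2, m\<sigma>)"
| SCatch_typed: "stmt_typed \<Gamma> \<Delta> \<tau>s s (c, m\<sigma>) \<Longrightarrow> stmt_typed \<Gamma> \<Delta> \<tau>s (SCatch s) (False, m\<sigma>)"
| SLoop_typed: "stmt_typed \<Gamma> \<Delta> \<tau>s s (c, m\<sigma>) \<Longrightarrow> stmt_typed \<Gamma> \<Delta> \<tau>s (SLoop s) (True, m\<sigma>)"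
| SIf_typed: "expr_typed \<Gamma> \<Delta> \<tau>s e (Inr (TBase \<tau>b)) \<Longrightarrow> \<tau>b \<noteq> TVoid \<Longrightarrow>
    stmt_typed \<Gamma> \<Delta> \<tau>s s1 (c1, m\<sigma>1) \<Longrightarrow> stmt_typed \<Gamma> \<Delta> \<tau>s s2 (c2, m\<sigma>2) \<Longrightarrow>
    rettype_union m\<sigma>1 m\<sigma>2 m\<sigma> \<Longrightarrow> stmt_typed \<Gamma> \<Delta> \<tau>s (SIf e s1 s2) (c1 \<and> c2, m\<sigma>)"
| SSwitch_typed: "expr_typed \<Gamma> \<Delta> \<tau>s e (Inr (TBase (TInt \<tau>i))) \<Longrightarrow>
    stmt_typed \<Gamma> \<Delta> \<tau>s s (c, m\<sigma>) \<Longrightarrow> stmt_typed \<Gamma> \<Delta> \<tau>s (SSwitch e s) (False, m\<sigma>)"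

fun rettype_match :: "rettype \<Rightarrow> ctype \<Rightarrow> bool" where
  "rettype_match (True, Some \<tau>) \<sigma> \<longleftrightarrow> \<tau> = \<sigma>"
| "rettype_match (False, Some \<tau>) \<sigma> \<longleftrightarrow> \<tau> = voidT \<and> \<sigma> = voidT"
| "rettype_match (True, None) \<sigma> \<longleftrightarrow> True"
| "rettype_match (False, None) \<sigma> \<longleftrightarrow> \<sigma> = voidT"

definition funenv_valid :: "env \<Rightarrow> memenv \<Rightarrow> funenv \<Rightarrow> bool" where
  "funenv_valid \<Gamma> \<Delta> \<delta> \<longleftrightarrow>
    fmdom \<delta> = fmdom (env_f \<Gamma>) \<and>
    (\<forall>f s. fmlookup \<delta> f = Some s \<longrightarrow>
      (\<exists>\<tau>s \<tau> cm\<tau>. fmlookup (env_f \<Gamma>) f = Some (\<tau>s, \<tau>) \<and>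
        (\<forall>\<sigma>\<in>set \<tau>s. type_complete \<Gamma> \<sigma>) \<and>
        stmt_typed \<Gamma> \<Delta> \<tau>s s cm\<tau> \<and> rettype_match cm\<tau> \<tau> \<and>
        gotos s \<subseteq> labels s \<and> throws_valid 0 s))"

section \<open>Contexts and states\<close>

datatype ectx_item =
    CRtoL
  | CROfL
  | CAssignL assign expr
  | CAssignR assign expr
  | CCallL "expr list"
  | CCallR expr "expr list" "expr list"
  | CLoad
  | CEltL ref_seg
  | CEltR ref_seg
  | CAlloc ctype
  | CFree
  | CUnOp unop
  | CBinOpL binop expr
  | CBinOpR binop expr
  | CIf expr expr
  | CComma expr
  | CCast ctype
  | CInsertL ref expr
  | CInsertR ref expr

(* The head of the list is the innermost item. *)
type_synonym ectx = "ectx_item list"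

fun ectx_item_fill :: "ectx_item \<Rightarrow> expr \<Rightarrow> expr" where
  "ectx_item_fill CRtoL e = ERtoL e"
| "ectx_item_fill CROfL e = ERofL e"
| "ectx_item_fill (CAssignL ass e2) e = EAssign ass e e2"
| "ectx_item_fill (CAssignR ass e1) e = EAssign ass e1 e"
| "ectx_item_fill (CCallL es) e = ECall e es"
| "ectx_item_fill (CCallR e0 es1 es2) e = ECall e0 (es1 @ e # es2)"
| "ectx_item_fill CLoad e = ELoad e"
| "ectx_item_fill (CEltL rs) e = EEltL e rs"
| "ectx_item_fill (CEltR rs) e = EEltR e rs"
| "ectx_item_fill (CAlloc \<tau>) e = EAlloc \<tau> e"
| "ectx_item_fill CFree e = EFree e"
| "ectx_item_fill (CUnOp op) e = EUnOp op e"
| "ectx_item_fill (CBinOpL op e2) e = EBinOp op e e2"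
| "ectx_item_fill (CBinOpR op e1) e = EBinOp op e1 e"
| "ectx_item_fill (CIf e2 e3) e = EIf e e2 e3"
| "ectx_item_fill (CComma e2) e = EComma e e2"
| "ectx_item_fill (CCast \<tau>) e = ECast \<tau> e"
| "ectx_item_fill (CInsertL r e2) e = EInsert r e e2"
| "ectx_item_fill (CInsertR r e1) e = EInsert r e1 e"

definition ectx_fill :: "ectx \<Rightarrow> expr \<Rightarrow> expr" where
  "ectx_fill E e = fold ectx_item_fill E e"

datatype sctx_item =
    CCatch
  | CCompL stmt
  | CCompR stmt
  | CLoop
  | CIfL expr stmt
  | CIfR expr stmt
  | CSwitch expr

fun sctx_item_fill :: "sctx_item \<Rightarrow> stmt \<Rightarrow> stmt" where
  "sctx_item_fill CCatch s = SCatch s"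
| "sctx_item_fill (CCompL s2) s = SComp s s2"
| "sctx_item_fill (CCompR s1) s = SComp s1 s"
| "sctx_item_fill CLoop s = SLoop s"
| "sctx_item_fill (CIfL e s2) s = SIf e s s2"
| "sctx_item_fill (CIfR e s1) s = SIf e s1 s"
| "sctx_item_fill (CSwitch e) s = SSwitch e s"

datatype esctx_item = CDoE | CRetE | CIfE stmt stmt | CSwitchE stmt

fun esctx_item_fill :: "esctx_item \<Rightarrow> expr \<Rightarrow> stmt" where
  "esctx_item_fill CDoE e = SDo e"
| "esctx_item_fill CRetE e = SRet e"
| "esctx_item_fill (CIfE s1 s2) e = SIf e s1 s2"
| "esctx_item_fill (CSwitchE s) e = SSwitch e s"

datatype ctx_item =
    CStmt sctx_item
  | CLocal index ctype
  | CExpr expr esctx_item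
  | CFun ectx
  | CParams funname "(index \<times> ctype) list"

type_synonym ctx = "ctx_item list"
type_synonym stack = "(index \<times> ctype) list"

fun locals :: "ctx \<Rightarrow> stack" where
  "locals [] = []"
| "locals (CStmt _ # k) = locals k"
| "locals (CLocal x \<tau> # k) = (x, \<tau>) # locals k"
| "locals (CExpr _ _ # k) = locals k"
| "locals (CFun _ # _) = []"
| "locals (CParams _ xs # _) = xs"

datatype direction =
    Down
  | Up
  | Throw nat
  | Top val
  | Jump labelname
  | Switch "int option"

fun direction_in :: "direction \<Rightarrow> stmt \<Rightarrow> bool" where
  "direction_in Down s \<longleftrightarrow> True"
| "direction_in (Jump l) s \<longleftrightarrow> l \<in> labels s"
| "direction_in (Switch mx) s \<longleftrightarrow> mx \<in> cases s"
| "direction_in _ s \<longleftrightarrow> False"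

fun direction_out :: "direction \<Rightarrow> stmt \<Rightarrow> bool" where
  "direction_out Up s \<longleftrightarrow> True"
| "direction_out (Throw n) s \<longleftrightarrow> True"
| "direction_out (Top v) s \<longleftrightarrow> True"
| "direction_out (Jump l) s \<longleftrightarrow> l \<notin> labels s"
| "direction_out _ s \<longleftrightarrow> False"

datatype undef_state =
    UndefExpr ectx expr
  | UndefBranch esctx_item lockset val

datatype focus =
    Stmt direction stmt
  | Expr expr
  | Call funname "val list"
  | Return funname val
  | Undef undef_state

datatype state = State ctx focus mem

section \<open>Small-step semantics\<close>

(* assign_sem \<Gamma> m a v ass v' va: assigning v to a yields the value v' and stores va. *)
inductive assign_sem :: "env \<Rightarrow> mem \<Rightarrow> addr \<Rightarrow> val \<Rightarrow> assign \<Rightarrow> val \<Rightarrow> val \<Rightarrow> bool" for \<Gamma> m a v where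
  Assign_sem: "val_cast_ok \<Gamma> m (addr_type a) v \<Longrightarrow> v' = val_cast (addr_type a) v \<Longrightarrow>
    assign_sem \<Gamma> m a v Assign v' v'"
| PreOp_sem: "mem_lookup \<Gamma> a m = Some va \<Longrightarrow> val_binop_ok \<Gamma> m op va v \<Longrightarrow>
    val_cast_ok \<Gamma> m (addr_type a) (val_binop \<Gamma> op va v) \<Longrightarrow>
    v' = val_cast (addr_type a) (val_binop \<Gamma> op va v) \<Longrightarrow> assign_sem \<Gamma> m a v (PreOp op) v' v'"
| PostOp_sem: "mem_lookup \<Gamma> a m = Some va \<Longrightarrow> val_binop_ok \<Gamma> m op va v \<Longrightarrow>
    val_cast_ok \<Gamma> m (addr_type a) (val_binop \<Gamma> op va v) \<Longrightarrow>
    v' = val_cast (addr_type a) (val_binop \<Gamma> op va v) \<Longrightarrow> assign_sem \<Gamma> m a v (PostOp op) va v'"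

inductive ehstep :: "env \<Rightarrow> stack \<Rightarrow> expr \<Rightarrow> mem \<Rightarrow> expr \<Rightarrow> mem \<Rightarrow> bool" for \<Gamma> \<rho> where
  estep_var: "lookup \<rho> i = Some (x, \<tau>) \<Longrightarrow>
    ehstep \<Gamma> \<rho> (EVar i) m (EVal {||} (Inl (Ptr (addr_top x \<tau>)))) m"
| estep_rtol: "ptr_alive m p \<Longrightarrow>
    ehstep \<Gamma> \<rho> (ERtoL (EVal \<Omega> (Inr (ptrV p)))) m (EVal \<Omega> (Inl p)) m"
| estep_rofl: "ehstep \<Gamma> \<rho> (ERofL (EVal \<Omega> (Inl p))) m (EVal \<Omega> (Inr (ptrV p))) m"
| estep_assign: "mem_writable \<Gamma> a m \<Longrightarrow> assign_sem \<Gamma> m a v ass v' va \<Longrightarrow>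
    ehstep \<Gamma> \<rho> (EAssign ass (EVal \<Omega>1 (Inl (Ptr a))) (EVal \<Omega>2 (Inr v))) m
      (EVal (lock_singleton \<Gamma> a |\<union>| \<Omega>1 |\<union>| \<Omega>2) (Inr v')) (mem_lock \<Gamma> a (mem_insert \<Gamma> a va m))"
| estep_load: "mem_lookup \<Gamma> a m = Some v \<Longrightarrow>
    ehstep \<Gamma> \<rho> (ELoad (EVal \<Omega> (Inl (Ptr a)))) m (EVal \<Omega> (Inr v)) (mem_force \<Gamma> a m)"
| estep_eltl: "addr_strict \<Gamma> a \<Longrightarrow>
    ehstep \<Gamma> \<rho> (EEltL (EVal \<Omega> (Inl (Ptr a))) rs) m (EVal \<Omega> (Inl (Ptr (addr_elt \<Gamma> rs a)))) m"
| estep_eltr: "val_lookup_seg \<Gamma> rs v = Some v' \<Longrightarrow>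
    ehstep \<Gamma> \<rho> (EEltR (EVal \<Omega> (Inr v)) rs) m (EVal \<Omega> (Inr v')) m"
| estep_alloc: "x |\<notin>| fmdom m \<Longrightarrow> 0 < n \<Longrightarrow> int_typed (n * int (size_of \<Gamma> \<tau>)) sptrI \<Longrightarrow>
    ehstep \<Gamma> \<rho> (EAlloc \<tau> (EVal \<Omega> (Inr (intV \<tau>i n)))) m
      (EVal \<Omega> (Inr (ptrV (Ptr (addr_top_array x \<tau> (nat n))))))
      (mem_alloc \<Gamma> x True perm_full (val_new \<Gamma> (TArray \<tau> (nat n))) m)"
| estep_alloc_fail:
   "ehstep \<Gamma> \<rho> (EAlloc \<tau> (EVal \<Omega> (Inr (intV \<tau>i n)))) m (EVal \<Omega> (Inr (ptrV (NULL (TType \<tau>))))) m"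
| estep_free: "mem_freeable a m \<Longrightarrow>
    ehstep \<Gamma> \<rho> (EFree (EVal \<Omega> (Inl (Ptr a)))) m (EVal \<Omega> (Inr voidV)) (mem_free (addr_index a) m)"
| estep_unop: "val_unop_ok m op v \<Longrightarrow>
    ehstep \<Gamma> \<rho> (EUnOp op (EVal \<Omega> (Inr v))) m (EVal \<Omega> (Inr (val_unop op v))) m"
| estep_binop: "val_binop_ok \<Gamma> m op v1 v2 \<Longrightarrow>
    ehstep \<Gamma> \<rho> (EBinOp op (EVal \<Omega>1 (Inr v1)) (EVal \<Omega>2 (Inr v2))) m
      (EVal (\<Omega>1 |\<union>| \<Omega>2) (Inr (val_binop \<Gamma> op v1 v2))) m"
| estep_if_true: "base_val_branchable m vb \<Longrightarrow> \<not> base_val_is_0 vb \<Longrightarrow>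
    ehstep \<Gamma> \<rho> (EIf (EVal \<Omega> (Inr (VBase vb))) e2 e3) m e2 (mem_unlock \<Omega> m)"
| estep_if_false: "base_val_branchable m vb \<Longrightarrow> base_val_is_0 vb \<Longrightarrow>
    ehstep \<Gamma> \<rho> (EIf (EVal \<Omega> (Inr (VBase vb))) e2 e3) m e3 (mem_unlock \<Omega> m)"
| estep_comma: "ehstep \<Gamma> \<rho> (EComma (EVal \<Omega> \<nu>) e2) m e2 (mem_unlock \<Omega> m)"
| estep_cast: "val_cast_ok \<Gamma> m (TType \<tau>) v \<Longrightarrow>
    ehstep \<Gamma> \<rho> (ECast \<tau> (EVal \<Omega> (Inr v))) m (EVal \<Omega> (Inr (val_cast (TType \<tau>) v))) m"
| estep_insert: "val_lookup \<Gamma> r v2 \<noteq> None \<Longrightarrow>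
    ehstep \<Gamma> \<rho> (EInsert r (EVal \<Omega>1 (Inr v1)) (EVal \<Omega>2 (Inr v2))) m
      (EVal (\<Omega>1 |\<union>| \<Omega>2) (Inr (val_alter \<Gamma> (\<lambda>_. v1) r v2))) m"

inductive is_nf :: "expr \<Rightarrow> bool" where
  "is_nf (EVal \<Omega> \<nu>)"

inductive is_redex :: "expr \<Rightarrow> bool" where
  "is_redex (EVar i)"
| "is_nf e \<Longrightarrow> is_redex (ERtoL e)"
| "is_nf e \<Longrightarrow> is_redex (ERofL e)"
| "is_nf e1 \<Longrightarrow> is_nf e2 \<Longrightarrow> is_redex (EAssign ass e1 e2)"
| "is_nf e \<Longrightarrow> \<forall>e'\<in>set es. is_nf e' \<Longrightarrow> is_redex (ECall e es)"
| "is_redex (EAbort \<tau>)"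
| "is_nf e \<Longrightarrow> is_redex (ELoad e)"
| "is_nf e \<Longrightarrow> is_redex (EEltL e rs)"
| "is_nf e \<Longrightarrow> is_redex (EEltR e rs)"
| "is_nf e \<Longrightarrow> is_redex (EAlloc \<tau> e)"
| "is_nf e \<Longrightarrow> is_redex (EFree e)"
| "is_nf e \<Longrightarrow> is_redex (EUnOp op e)"
| "is_nf e1 \<Longrightarrow> is_nf e2 \<Longrightarrow> is_redex (EBinOp op e1 e2)"
| "is_nf e1 \<Longrightarrow> is_redex (EIf e1 e2 e3)"
| "is_nf e1 \<Longrightarrow> is_redex (EComma e1 e2)"
| "is_nf e \<Longrightarrow> is_redex (ECast \<tau> e)"
| "is_nf e1 \<Longrightarrow> is_nf e2 \<Longrightarrow> is_redex (EInsert r e1 e2)"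

definition call_redex :: "lockset \<Rightarrow> funname \<Rightarrow> ctype list \<Rightarrow> ctype \<Rightarrow> (lockset \<times> val) list \<Rightarrow> expr" where
  "call_redex \<Omega> f \<tau>s \<tau> \<Omega>vs =
    ECall (EVal \<Omega> (Inl (FunPtr f \<tau>s \<tau>))) (map (\<lambda>(\<Omega>', v). EVal \<Omega>' (Inr v)) \<Omega>vs)"

inductive ehsafe :: "env \<Rightarrow> stack \<Rightarrow> expr \<Rightarrow> mem \<Rightarrow> bool" for \<Gamma> \<rho> where
  "ehsafe \<Gamma> \<rho> (call_redex \<Omega> f \<tau>s \<tau> \<Omega>vs) m"
| "ehstep \<Gamma> \<rho> e1 m1 e2 m2 \<Longrightarrow> ehsafe \<Gamma> \<rho> e1 m1"

inductive cstep :: "env \<Rightarrow> funenv \<Rightarrow> stack \<Rightarrow> state \<Rightarrow> state \<Rightarrow> bool" for \<Gamma> \<delta> \<rho> where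
  cstep_skip: "cstep \<Gamma> \<delta> \<rho> (State k (Stmt Down SSkip) m) (State k (Stmt Up SSkip) m)"
| cstep_goto: "cstep \<Gamma> \<delta> \<rho> (State k (Stmt Down (SGoto l)) m) (State k (Stmt (Jump l) (SGoto l)) m)"
| cstep_throw: "cstep \<Gamma> \<delta> \<rho> (State k (Stmt Down (SThrow n)) m) (State k (Stmt (Throw n) (SThrow n)) m)"
| cstep_in_label: "cstep \<Gamma> \<delta> \<rho> (State k (Stmt Down (SLabel l)) m) (State k (Stmt Up (SLabel l)) m)"
| cstep_in_case: "cstep \<Gamma> \<delta> \<rho> (State k (Stmt Down (SCase mx)) m) (State k (Stmt Up (SCase mx)) m)"
| cstep_expr:
   "cstep \<Gamma> \<delta> \<rho> (State k (Stmt Down (esctx_item_fill E e)) m) (State (CExpr e E # k) (Expr e) m)"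

| cstep_expr_head: "ehstep \<Gamma> (locals k @ \<rho>) e1 m1 e2 m2 \<Longrightarrow>
    cstep \<Gamma> \<delta> \<rho> (State k (Expr (ectx_fill E e1)) m1) (State k (Expr (ectx_fill E e2)) m2)"
| cstep_expr_call:
   "cstep \<Gamma> \<delta> \<rho> (State k (Expr (ectx_fill E (call_redex \<Omega> f \<tau>s \<tau> \<Omega>vs))) m)
      (State (CFun E # k) (Call f (map snd \<Omega>vs))
        (mem_unlock (fold (|\<union>|) (map fst \<Omega>vs) \<Omega>) m))"
| cstep_expr_undef: "is_redex e \<Longrightarrow> \<not> ehsafe \<Gamma> (locals k @ \<rho>) e m \<Longrightarrow>
    cstep \<Gamma> \<delta> \<rho> (State k (Expr (ectx_fill E e)) m) (State k (Undef (UndefExpr E e)) m)"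

| cstep_expr_do:
   "cstep \<Gamma> \<delta> \<rho> (State (CExpr e CDoE # k) (Expr (EVal \<Omega> \<nu>)) m)
      (State k (Stmt Up (SDo e)) (mem_unlock \<Omega> m))"
| cstep_expr_ret:
   "cstep \<Gamma> \<delta> \<rho> (State (CExpr e CRetE # k) (Expr (EVal \<Omega> (Inr v))) m)
      (State k (Stmt (Top v) (SRet e)) (mem_unlock \<Omega> m))"
| cstep_expr_if_true: "base_val_branchable m vb \<Longrightarrow> \<not> base_val_is_0 vb \<Longrightarrow>
    cstep \<Gamma> \<delta> \<rho> (State (CExpr e (CIfE s1 s2) # k) (Expr (EVal \<Omega> (Inr (VBase vb)))) m)
      (State (CStmt (CIfL e s2) # k) (Stmt Down s1) (mem_unlock \<Omega> m))"
| cstep_expr_if_false: "base_val_branchable m vb \<Longrightarrow> base_val_is_0 vb \<Longrightarrow>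
    cstep \<Gamma> \<delta> \<rho> (State (CExpr e (CIfE s1 s2) # k) (Expr (EVal \<Omega> (Inr (VBase vb)))) m)
      (State (CStmt (CIfR e s1) # k) (Stmt Down s2) (mem_unlock \<Omega> m))"
| cstep_expr_if_indet: "\<not> base_val_branchable m vb \<Longrightarrow>
    cstep \<Gamma> \<delta> \<rho> (State (CExpr e (CIfE s1 s2) # k) (Expr (EVal \<Omega> (Inr (VBase vb)))) m)
      (State k (Undef (UndefBranch (CIfE s1 s2) \<Omega> (VBase vb))) m)"
| cstep_expr_switch_case: "Some x \<in> cases s \<Longrightarrow>
    cstep \<Gamma> \<delta> \<rho> (State (CExpr e (CSwitchE s) # k) (Expr (EVal \<Omega> (Inr (intV \<tau>i x)))) m)
      (State (CStmt (CSwitch e) # k) (Stmt (Switch (Some x)) s) (mem_unlock \<Omega> m))"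
| cstep_expr_switch_default: "Some x \<notin> cases s \<Longrightarrow> None \<in> cases s \<Longrightarrow>
    cstep \<Gamma> \<delta> \<rho> (State (CExpr e (CSwitchE s) # k) (Expr (EVal \<Omega> (Inr (intV \<tau>i x)))) m)
      (State (CStmt (CSwitch e) # k) (Stmt (Switch None) s) (mem_unlock \<Omega> m))"
| cstep_expr_switch_out: "Some x \<notin> cases s \<Longrightarrow> None \<notin> cases s \<Longrightarrow>
    cstep \<Gamma> \<delta> \<rho> (State (CExpr e (CSwitchE s) # k) (Expr (EVal \<Omega> (Inr (intV \<tau>i x)))) m)
      (State k (Stmt Up (SSwitch e s)) (mem_unlock \<Omega> m))"
| cstep_expr_switch_indet: "\<not> base_val_branchable m vb \<Longrightarrow>
    cstep \<Gamma> \<delta> \<rho> (State (CExpr e (CSwitchE s) # k) (Expr (EVal \<Omega> (Inr (VBase vb)))) m)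
      (State k (Undef (UndefBranch (CSwitchE s) \<Omega> (VBase vb))) m)"

| cstep_in_comp:
   "cstep \<Gamma> \<delta> \<rho> (State k (Stmt Down (SComp s1 s2)) m) (State (CStmt (CCompL s2) # k) (Stmt Down s1) m)"
| cstep_out_comp1:
   "cstep \<Gamma> \<delta> \<rho> (State (CStmt (CCompL s2) # k) (Stmt Up s1) m)
      (State (CStmt (CCompR s1) # k) (Stmt Down s2) m)"
| cstep_out_comp2:
   "cstep \<Gamma> \<delta> \<rho> (State (CStmt (CCompR s1) # k) (Stmt Up s2) m) (State k (Stmt Up (SComp s1 s2)) m)"
| cstep_in_catch:
   "cstep \<Gamma> \<delta> \<rho> (State k (Stmt Down (SCatch s)) m) (State (CStmt CCatch # k) (Stmt Down s) m)"
| cstep_out_catch: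
   "cstep \<Gamma> \<delta> \<rho> (State (CStmt CCatch # k) (Stmt Up s) m) (State k (Stmt Up (SCatch s)) m)"
| cstep_in_loop:
   "cstep \<Gamma> \<delta> \<rho> (State k (Stmt Down (SLoop s)) m) (State (CStmt CLoop # k) (Stmt Down s) m)"
| cstep_out_loop:
   "cstep \<Gamma> \<delta> \<rho> (State (CStmt CLoop # k) (Stmt Up s) m) (State k (Stmt Down (SLoop s)) m)"
| cstep_out_if1:
   "cstep \<Gamma> \<delta> \<rho> (State (CStmt (CIfL e s2) # k) (Stmt Up s1) m) (State k (Stmt Up (SIf e s1 s2)) m)"
| cstep_out_if2:
   "cstep \<Gamma> \<delta> \<rho> (State (CStmt (CIfR e s1) # k) (Stmt Up s2) m) (State k (Stmt Up (SIf e s1 s2)) m)"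
| cstep_out_switch:
   "cstep \<Gamma> \<delta> \<rho> (State (CStmt (CSwitch e) # k) (Stmt Up s) m) (State k (Stmt Up (SSwitch e s)) m)"

| cstep_call: "fmlookup \<delta> f = Some s \<Longrightarrow> length xs = length vs \<Longrightarrow> distinct xs \<Longrightarrow>
    \<forall>x\<in>set xs. x |\<notin>| fmdom m \<Longrightarrow>
    cstep \<Gamma> \<delta> \<rho> (State k (Call f vs) m)
      (State (CParams f (zip xs (map type_of_val vs)) # k) (Stmt Down s) (mem_alloc_list \<Gamma> xs vs m))"
| cstep_free_params:
   "cstep \<Gamma> \<delta> \<rho> (State (CParams f xs # k) (Stmt Up s) m)
      (State k (Return f voidV) (fold mem_free (map fst xs) m))"
| cstep_free_params_top:
   "cstep \<Gamma> \<delta> \<rho> (State (CParams f xs # k) (Stmt (Top v) s) m)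
      (State k (Return f v) (fold mem_free (map fst xs) m))"
| cstep_return:
   "cstep \<Gamma> \<delta> \<rho> (State (CFun E # k) (Return f v) m)
      (State k (Expr (ectx_fill E (EVal {||} (Inr v)))) m)"

| cstep_label_here: "cstep \<Gamma> \<delta> \<rho> (State k (Stmt (Jump l) (SLabel l)) m) (State k (Stmt Up (SLabel l)) m)"
| cstep_case_here: "cstep \<Gamma> \<delta> \<rho> (State k (Stmt (Switch mx) (SCase mx)) m) (State k (Stmt Up (SCase mx)) m)"
| cstep_throw_here:
   "cstep \<Gamma> \<delta> \<rho> (State (CStmt CCatch # k) (Stmt (Throw 0) s) m) (State k (Stmt Up (SCatch s)) m)"
| cstep_throw_further:
   "cstep \<Gamma> \<delta> \<rho> (State (CStmt CCatch # k) (Stmt (Throw (Suc n)) s) m)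
      (State k (Stmt (Throw n) (SCatch s)) m)"
| cstep_goto_in: "l \<in> labels s \<Longrightarrow>
    cstep \<Gamma> \<delta> \<rho> (State k (Stmt (Jump l) (sctx_item_fill E s)) m) (State (CStmt E # k) (Stmt (Jump l) s) m)"
| cstep_switch_in: "\<forall>e. E \<noteq> CSwitch e \<Longrightarrow> mx \<in> cases s \<Longrightarrow>
    cstep \<Gamma> \<delta> \<rho> (State k (Stmt (Switch mx) (sctx_item_fill E s)) m)
      (State (CStmt E # k) (Stmt (Switch mx) s) m)"
| cstep_top_out:
   "cstep \<Gamma> \<delta> \<rho> (State (CStmt E # k) (Stmt (Top v) s) m) (State k (Stmt (Top v) (sctx_item_fill E s)) m)"
| cstep_goto_out: "l \<notin> labels s \<Longrightarrow>
    cstep \<Gamma> \<delta> \<rho> (State (CStmt E # k) (Stmt (Jump l) s) m) (State k (Stmt (Jump l) (sctx_item_fill E s)) m)"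
| cstep_throw_out: "E \<noteq> CCatch \<Longrightarrow>
    cstep \<Gamma> \<delta> \<rho> (State (CStmt E # k) (Stmt (Throw n) s) m) (State k (Stmt (Throw n) (sctx_item_fill E s)) m)"

| cstep_in_block: "direction_in d s \<Longrightarrow> x |\<notin>| fmdom m \<Longrightarrow>
    cstep \<Gamma> \<delta> \<rho> (State k (Stmt d (SLocal \<tau> s)) m)
      (State (CLocal x \<tau> # k) (Stmt d s) (mem_alloc \<Gamma> x False perm_full (val_new \<Gamma> \<tau>) m))"
| cstep_out_block: "direction_out d s \<Longrightarrow>
    cstep \<Gamma> \<delta> \<rho> (State (CLocal x \<tau> # k) (Stmt d s) m) (State k (Stmt d (SLocal \<tau> s)) (mem_free x m))"

section \<open>Big-step semantics\<close>

type_synonym store = "int option list"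

definition in_range :: "int \<Rightarrow> bool" where
  "in_range z \<longleftrightarrow> - (2 ^ 31) \<le> z \<and> z \<le> 2 ^ 31 - 1"

fun eval_binop :: "binop \<Rightarrow> int \<Rightarrow> int \<Rightarrow> int option" where
  "eval_binop (ArithOp PlusOp) z1 z2 = Some (z1 + z2)"
| "eval_binop (ArithOp MinusOp) z1 z2 = Some (z1 - z2)"
| "eval_binop (ArithOp DivOp) z1 z2 = (if z2 = 0 then None else Some (z1 sdiv z2))"
| "eval_binop (CompOp LtOp) z1 z2 = Some (if z1 < z2 then 1 else 0)"
| "eval_binop (CompOp LeOp) z1 z2 = Some (if z1 \<le> z2 then 1 else 0)"
| "eval_binop (CompOp EqOp) z1 z2 = Some (if z1 = z2 then 1 else 0)"
| "eval_binop _ _ _ = None"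

inductive eval :: "store \<Rightarrow> expr \<Rightarrow> int \<Rightarrow> bool" for \<sigma> where
  eval_lit: "in_range z \<Longrightarrow> eval \<sigma> (EInt z) z"
| eval_load: "lookup \<sigma> i = Some (Some z) \<Longrightarrow> eval \<sigma> (ELoad (EVar i)) z"
| eval_not: "eval \<sigma> e z \<Longrightarrow> eval \<sigma> (EUnOp NotOp e) (if z = 0 then 1 else 0)"
| eval_binop: "eval \<sigma> e1 z1 \<Longrightarrow> eval \<sigma> e2 z2 \<Longrightarrow> eval_binop op z1 z2 = Some r \<Longrightarrow> in_range r \<Longrightarrow>
    eval \<sigma> (EBinOp op e1 e2) r"

datatype outcome = ONormal store | OReturn int | OThrow nat store

definition abnormal :: "outcome \<Rightarrow> bool" where
  "abnormal ou \<longleftrightarrow> (\<forall>\<sigma>. ou \<noteq> ONormal \<sigma>)"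

definition nothrown :: "outcome \<Rightarrow> bool" where
  "nothrown ou \<longleftrightarrow> (\<forall>n \<sigma>. ou \<noteq> OThrow n \<sigma>)"

inductive exec :: "store \<Rightarrow> stmt \<Rightarrow> outcome \<Rightarrow> bool" where
  exec_skip: "exec \<sigma> SSkip (ONormal \<sigma>)"
| exec_comp: "exec \<sigma> s1 (ONormal \<sigma>') \<Longrightarrow> exec \<sigma>' s2 ou \<Longrightarrow> exec \<sigma> (SComp s1 s2) ou"
| exec_comp_abnormal: "abnormal ou \<Longrightarrow> exec \<sigma> s1 ou \<Longrightarrow> exec \<sigma> (SComp s1 s2) ou"
| exec_local_normal: "exec (None # \<sigma>) s (ONormal (mv # \<sigma>')) \<Longrightarrow>
    exec \<sigma> (SLocal sintT s) (ONormal \<sigma>')"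
| exec_local_return: "exec (None # \<sigma>) s (OReturn z) \<Longrightarrow> exec \<sigma> (SLocal sintT s) (OReturn z)"
| exec_local_throw: "exec (None # \<sigma>) s (OThrow n (mv # \<sigma>')) \<Longrightarrow>
    exec \<sigma> (SLocal sintT s) (OThrow n \<sigma>')"
| exec_assign: "i < length \<sigma> \<Longrightarrow> eval \<sigma> e z \<Longrightarrow>
    exec \<sigma> (SDo (EAssign Assign (EVar i) (ECast sintT e))) (ONormal (\<sigma>[i := Some z]))"
| exec_assign_void: "i < length \<sigma> \<Longrightarrow> eval \<sigma> e z \<Longrightarrow>
    exec \<sigma> (SDo (ECast voidT (EAssign Assign (EVar i) e))) (ONormal (\<sigma>[i := Some z]))"
| exec_if: "eval \<sigma> e z \<Longrightarrow> exec \<sigma> (if z = 0 then s2 else s1) ou \<Longrightarrow> exec \<sigma> (SIf e s1 s2) ou"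
| exec_throw: "exec \<sigma> (SThrow n) (OThrow n \<sigma>)"
| exec_catch_here: "exec \<sigma> s (OThrow 0 \<sigma>') \<Longrightarrow> exec \<sigma> (SCatch s) (ONormal \<sigma>')"
| exec_catch_further: "exec \<sigma> s (OThrow (n + 1) \<sigma>') \<Longrightarrow> exec \<sigma> (SCatch s) (OThrow n \<sigma>')"
| exec_catch_nothrown: "nothrown ou \<Longrightarrow> exec \<sigma> s ou \<Longrightarrow> exec \<sigma> (SCatch s) ou"
| exec_loop_abnormal: "abnormal ou \<Longrightarrow> exec \<sigma> s ou \<Longrightarrow> exec \<sigma> (SLoop s) ou"
| exec_loop: "abnormal ou \<Longrightarrow> exec \<sigma> s (ONormal \<sigma>') \<Longrightarrow> exec \<sigma>' (SLoop s) ou \<Longrightarrow>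
    exec \<sigma> (SLoop s) ou"
| exec_ret: "eval \<sigma> e z \<Longrightarrow> exec \<sigma> (SRet (ECast sintT e)) (OReturn z)"

coinductive execinf :: "store \<Rightarrow> stmt \<Rightarrow> bool" where
  execinf_comp1: "execinf \<sigma> s1 \<Longrightarrow> execinf \<sigma> (SComp s1 s2)"
| execinf_comp2: "exec \<sigma> s1 (ONormal \<sigma>') \<Longrightarrow> execinf \<sigma>' s2 \<Longrightarrow> execinf \<sigma> (SComp s1 s2)"
| execinf_local: "execinf (None # \<sigma>) s \<Longrightarrow> execinf \<sigma> (SLocal sintT s)"
| execinf_if: "eval \<sigma> e z \<Longrightarrow> execinf \<sigma> (if z = 0 then s2 else s1) \<Longrightarrow> execinf \<sigma> (SIf e s1 s2)"
| execinf_catch: "execinf \<sigma> s \<Longrightarrow> execinf \<sigma> (SCatch s)"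
| execinf_loop1: "execinf \<sigma> s \<Longrightarrow> execinf \<sigma> (SLoop s)"
| execinf_loop2: "exec \<sigma> s (ONormal \<sigma>') \<Longrightarrow> execinf \<sigma>' (SLoop s) \<Longrightarrow> execinf \<sigma> (SLoop s)"

definition CHcorrect :: "nat \<Rightarrow> stmt \<Rightarrow> store \<Rightarrow> bool" where
  "CHcorrect n s \<sigma> \<longleftrightarrow>
    (length \<sigma> = n \<and> (\<forall>z. Some z \<in> set \<sigma> \<longrightarrow> in_range z) \<longrightarrow>
      (\<exists>z. exec \<sigma> s (OReturn z)) \<or> execinf \<sigma> s)"

end

theory Submission
  imports Defs
begin

text \<open>
  A state is safe for \<open>n\<close> steps if no run of length at most \<open>n\<close> gets stuck in a state other than a
  return from \<open>main\<close>. With this index, a terminating execution of \<open>s\<close> is a statement about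
  continuations: entering \<open>s\<close> is safe for \<open>n\<close> steps if leaving \<open>s\<close> is, in the direction and with a
  memory that match the outcome. It is proved by induction on the big-step derivation. A diverging
  execution performs a small step before every appeal to divergence of another statement, so its
  safety follows by induction on \<open>n\<close>. Big-step expressions have no side effects: apart from the
  final store of an assignment, all nondeterministic reductions leave the memory unchanged and
  preserve the value of the expression, which rules out undefined behaviour.
\<close>

section \<open>Step-indexed safety\<close>

definition final :: "state \<Rightarrow> bool" where
  "final S \<longleftrightarrow> (\<exists>m z. S = State [] (Return ''main'' (intV sintI z)) m)"

primrec safe :: "env \<Rightarrow> funenv \<Rightarrow> nat \<Rightarrow> state \<Rightarrow> bool" where
  "safe \<Gamma> \<delta> 0 S \<longleftrightarrow> True"
| "safe \<Gamma> \<delta> (Suc n) S \<longleftrightarrow>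
    (final S \<or> (\<exists>S'. cstep \<Gamma> \<delta> [] S S')) \<and> (\<forall>S'. cstep \<Gamma> \<delta> [] S S' \<longrightarrow> safe \<Gamma> \<delta> n S')"

lemma safe_Suc_imp: "safe \<Gamma> \<delta> (Suc n) S \<Longrightarrow> safe \<Gamma> \<delta> n S"
proof (induction n arbitrary: S)
  case (Suc n)
  then show ?case
    by (metis safe.simps(2))
qed simp

text \<open>A unique successor, stated as one equivalence, yields progress and preservation
  together. This version counts the step, as the induction on the index for divergence
  requires.\<close>

lemma safe_step_Suc:
  assumes "\<And>S'. cstep \<Gamma> \<delta> [] S S' \<longleftrightarrow> S' = T" and "safe \<Gamma> \<delta> n T"
  shows "safe \<Gamma> \<delta> (Suc n) S"
  using assms by auto

text \<open>Here the step is not counted, so the index can stay fixed in the treatment of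
  terminating executions.\<close>

lemma safe_step:
  assumes "\<And>S'. cstep \<Gamma> \<delta> [] S S' \<longleftrightarrow> S' = T" and "safe \<Gamma> \<delta> n T"
  shows "safe \<Gamma> \<delta> n S"
  by (rule safe_Suc_imp, rule safe_step_Suc[OF assms])

text \<open>Safety at all indices passes to successors, since index \<open>Suc n\<close> before a
  step gives \<open>n\<close> after it; index 1 at the end of the run is the claim.\<close>

lemma safe_rtranclp:
  assumes "(cstep \<Gamma> \<delta> [])\<^sup>*\<^sup>* S S'" and "\<And>n. safe \<Gamma> \<delta> n S"
  shows "final S' \<or> (\<exists>S''. cstep \<Gamma> \<delta> [] S' S'')"
proof -
  from assms have "safe \<Gamma> \<delta> n S'" for n
  proof (induction arbitrary: n)
    case (step T U)
    then show ?case
      using safe.simps(2) by blast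
  qed
  then show ?thesis
    using safe.simps(2) by blast
qed

section \<open>Steps between statements\<close>

text \<open>The source of \<open>cstep_expr\<close> is a function application, not a constructor
  pattern, so inverting \<open>cstep\<close> has to solve equations with
  \<open>esctx_item_fill\<close>, in either orientation.\<close>

lemma esctx_item_fill_simps [simp]:
  "esctx_item_fill E e \<noteq> SSkip"
  "esctx_item_fill E e \<noteq> SThrow n"
  "esctx_item_fill E e \<noteq> SComp s1 s2"
  "esctx_item_fill E e \<noteq> SCatch s"
  "esctx_item_fill E e \<noteq> SLoop s"
  "esctx_item_fill E e \<noteq> SLocal \<tau> s"
  "esctx_item_fill E e = SDo e' \<longleftrightarrow> E = CDoE \<and> e = e'"
  "esctx_item_fill E e = SRet e' \<longleftrightarrow> E = CRetE \<and> e = e'"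
  "esctx_item_fill E e = SIf e' s1 s2 \<longleftrightarrow> E = CIfE s1 s2 \<and> e = e'"
  by (cases E; auto)+

lemmas esctx_item_fill_sym_simps [simp] =
  esctx_item_fill_simps(1-6)[symmetric]
  esctx_item_fill_simps(7-9)[THEN eq_iff_swap]

text \<open>Entering a statement is deterministic except for \<open>SLocal\<close>, where any fresh
  object identifier may be chosen.\<close>

lemma cstep_down:
  "cstep \<Gamma> \<delta> \<rho> (State k (Stmt Down SSkip) m) S \<longleftrightarrow> S = State k (Stmt Up SSkip) m"
  "cstep \<Gamma> \<delta> \<rho> (State k (Stmt Down (SThrow n)) m) S \<longleftrightarrow> S = State k (Stmt (Throw n) (SThrow n)) m"
  "cstep \<Gamma> \<delta> \<rho> (State k (Stmt Down (SDo e)) m) S \<longleftrightarrow> S = State (CExpr e CDoE # k) (Expr e) m"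
  "cstep \<Gamma> \<delta> \<rho> (State k (Stmt Down (SRet e)) m) S \<longleftrightarrow> S = State (CExpr e CRetE # k) (Expr e) m"
  "cstep \<Gamma> \<delta> \<rho> (State k (Stmt Down (SIf e s1 s2)) m) S \<longleftrightarrow>
    S = State (CExpr e (CIfE s1 s2) # k) (Expr e) m"
  "cstep \<Gamma> \<delta> \<rho> (State k (Stmt Down (SComp s1 s2)) m) S \<longleftrightarrow>
    S = State (CStmt (CCompL s2) # k) (Stmt Down s1) m"
  "cstep \<Gamma> \<delta> \<rho> (State k (Stmt Down (SCatch s)) m) S \<longleftrightarrow>
    S = State (CStmt CCatch # k) (Stmt Down s) m"
  "cstep \<Gamma> \<delta> \<rho> (State k (Stmt Down (SLoop s)) m) S \<longleftrightarrow>
    S = State (CStmt CLoop # k) (Stmt Down s) m"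
  "cstep \<Gamma> \<delta> \<rho> (State k (Stmt Down (SLocal \<tau> s)) m) S \<longleftrightarrow>
    (\<exists>x. x |\<notin>| fmdom m \<and> S = State (CLocal x \<tau> # k) (Stmt Down s)
      (mem_alloc \<Gamma> x False perm_full (val_new \<Gamma> \<tau>) m))"
  by (auto elim!: cstep.cases intro: cstep.intros
    cstep_expr[where E = CDoE, simplified] cstep_expr[where E = CRetE, simplified]
    cstep_expr[where E = "CIfE s1 s2", simplified])

lemma cstep_up:
  "cstep \<Gamma> \<delta> \<rho> (State (CStmt (CCompL s2) # k) (Stmt Up s) m) S \<longleftrightarrow>
    S = State (CStmt (CCompR s) # k) (Stmt Down s2) m"
  "cstep \<Gamma> \<delta> \<rho> (State (CStmt (CCompR s1) # k) (Stmt Up s) m) S \<longleftrightarrow>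
    S = State k (Stmt Up (SComp s1 s)) m"
  "cstep \<Gamma> \<delta> \<rho> (State (CStmt CCatch # k) (Stmt Up s) m) S \<longleftrightarrow> S = State k (Stmt Up (SCatch s)) m"
  "cstep \<Gamma> \<delta> \<rho> (State (CStmt CLoop # k) (Stmt Up s) m) S \<longleftrightarrow> S = State k (Stmt Down (SLoop s)) m"
  "cstep \<Gamma> \<delta> \<rho> (State (CStmt (CIfL e s2) # k) (Stmt Up s) m) S \<longleftrightarrow>
    S = State k (Stmt Up (SIf e s s2)) m"
  "cstep \<Gamma> \<delta> \<rho> (State (CStmt (CIfR e s1) # k) (Stmt Up s) m) S \<longleftrightarrow>
    S = State k (Stmt Up (SIf e s1 s)) m"
  by (auto elim!: cstep.cases intro: cstep.intros)

lemma cstep_unwind: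
  "cstep \<Gamma> \<delta> \<rho> (State (CStmt CCatch # k) (Stmt (Throw 0) s) m) S \<longleftrightarrow>
    S = State k (Stmt Up (SCatch s)) m"
  "cstep \<Gamma> \<delta> \<rho> (State (CStmt CCatch # k) (Stmt (Throw (Suc n)) s) m) S \<longleftrightarrow>
    S = State k (Stmt (Throw n) (SCatch s)) m"
  "E \<noteq> CCatch \<Longrightarrow> cstep \<Gamma> \<delta> \<rho> (State (CStmt E # k) (Stmt (Throw n) s) m) S \<longleftrightarrow>
    S = State k (Stmt (Throw n) (sctx_item_fill E s)) m"
  "cstep \<Gamma> \<delta> \<rho> (State (CStmt E # k) (Stmt (Top v) s) m) S \<longleftrightarrow>
    S = State k (Stmt (Top v) (sctx_item_fill E s)) m"
  "cstep \<Gamma> \<delta> \<rho> (State (CParams f xs # k) (Stmt (Top v) s) m) S \<longleftrightarrow>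
    S = State k (Return f v) (fold mem_free (map fst xs) m)"
  by (auto elim!: cstep.cases intro: cstep.intros)

lemma cstep_out_local:
  assumes "d \<in> {Up} \<union> range Throw \<union> range Top"
  shows "cstep \<Gamma> \<delta> \<rho> (State (CLocal x \<tau> # k) (Stmt d s) m) S \<longleftrightarrow>
    S = State k (Stmt d (SLocal \<tau> s)) (mem_free x m)"
  using assms by (auto elim!: cstep.cases intro: cstep.intros)

lemma cstep_return_main: "\<not> cstep \<Gamma> \<delta> \<rho> (State [] (Return f v) m) S"
  by (auto elim: cstep.cases)

section \<open>Reduction of expressions\<close>

lemma ectx_fill_Nil [simp]: "ectx_fill [] e = e"
  by (simp add: ectx_fill_def)

text \<open>The head of a context is its innermost item, so the outermost constructor of a filled
  expression comes from the last item; contexts are therefore analysed from the end.\<close>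

lemma ectx_fill_snoc [simp]: "ectx_fill (E @ [i]) e = ectx_item_fill i (ectx_fill E e)"
  by (simp add: ectx_fill_def)

lemma ectx_fill_eq_EVal [simp]: "ectx_fill E e = EVal \<Omega> \<nu> \<longleftrightarrow> E = [] \<and> e = EVal \<Omega> \<nu>"
proof (cases E rule: rev_cases)
  case (snoc E' i)
  then show ?thesis
    by (cases i) auto
qed simp

lemma EVal_eq_ectx_fill [simp]: "EVal \<Omega> \<nu> = ectx_fill E e \<longleftrightarrow> E = [] \<and> e = EVal \<Omega> \<nu>"
  using ectx_fill_eq_EVal by metis

lemma is_nf_iff: "is_nf e \<longleftrightarrow> (\<exists>\<Omega> \<nu>. e = EVal \<Omega> \<nu>)"
  by (auto elim: is_nf.cases intro: is_nf.intros)

lemma not_is_redex_EVal [simp]: "\<not> is_redex (EVal \<Omega> \<nu>)"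
  by (auto elim: is_redex.cases)

lemma call_redex_neq_EVal [simp]:
  "call_redex \<Omega> f \<tau>s \<tau> \<Omega>vs \<noteq> EVal \<Omega>' \<nu>" "EVal \<Omega>' \<nu> \<noteq> call_redex \<Omega> f \<tau>s \<tau> \<Omega>vs"
  by (simp_all add: call_redex_def)

lemma is_redex_call_redex: "is_redex (call_redex \<Omega> f \<tau>s \<tau> \<Omega>vs)"
  by (auto simp: call_redex_def intro!: is_redex.intros is_nf.intros)

lemma ehstep_is_redex: "ehstep \<Gamma> \<rho> e m e' m' \<Longrightarrow> is_redex e"
  by (erule ehstep.cases) (auto intro!: is_redex.intros is_nf.intros)

lemma not_ehstep_EVal [simp]: "\<not> ehstep \<Gamma> \<rho> (EVal \<Omega> \<nu>) m e' m'"
  using ehstep_is_redex not_is_redex_EVal by blast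

section \<open>Existence of redexes\<close>

definition has_redex :: "expr \<Rightarrow> bool" where
  "has_redex e \<longleftrightarrow> (\<exists>E e'. e = ectx_fill E e' \<and> is_redex e')"

lemma has_redex_item: "has_redex e \<Longrightarrow> has_redex (ectx_item_fill i e)"
  unfolding has_redex_def using ectx_fill_snoc by metis

lemma has_redex_head: "is_redex e \<Longrightarrow> has_redex e"
  unfolding has_redex_def by (metis ectx_fill_Nil)

text \<open>If all operands in evaluation position are values, the expression is itself a redex;
  otherwise an operand that is not a value contains one by induction.\<close>

lemma has_redex_if_not_nf: "\<not> is_nf e \<Longrightarrow> has_redex e"
proof (induction e)
  case (ECall e es)
  show ?case
  proof (cases "is_nf e")
    case e: True
    show ?thesis
    proof (cases "\<forall>e'\<in>set es. is_nf e'")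
      case True
      with e show ?thesis
        by (intro has_redex_head is_redex.intros)
    next
      case False
      then obtain es1 e' es2 where es: "es = es1 @ e' # es2" and "\<not> is_nf e'"
        by (meson split_list)
      then have "has_redex e'"
        using ECall.IH(2) by simp
      then show ?thesis
        using has_redex_item[of e' "CCallR e es1 es2"] es by simp
    qed
  next
    case False
    then show ?thesis
      using ECall.IH(1) has_redex_item[of e "CCallL es"] by simp
  qed
next
  case (EAssign ass e1 e2)
  then show ?case
    using has_redex_item[of e1 "CAssignL ass e2"] has_redex_item[of e2 "CAssignR ass e1"]
    by (auto intro: has_redex_head is_redex.intros)
next
  case (EBinOp op e1 e2)
  then show ?case
    using has_redex_item[of e1 "CBinOpL op e2"] has_redex_item[of e2 "CBinOpR op e1"]
    by (auto intro: has_redex_head is_redex.intros)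
next
  case (EInsert r e1 e2)
  then show ?case
    using has_redex_item[of e1 "CInsertL r e2"] has_redex_item[of e2 "CInsertR r e1"]
    by (auto intro: has_redex_head is_redex.intros)
next
  case (ERtoL e)
  then show ?case
    using has_redex_item[of e CRtoL] by (auto intro: has_redex_head is_redex.intros)
next
  case (ERofL e)
  then show ?case
    using has_redex_item[of e CROfL] by (auto intro: has_redex_head is_redex.intros)
next
  case (ELoad e)
  then show ?case
    using has_redex_item[of e CLoad] by (auto intro: has_redex_head is_redex.intros)
next
  case (EEltL e rs)
  then show ?case
    using has_redex_item[of e "CEltL rs"] by (auto intro: has_redex_head is_redex.intros)
next
  case (EEltR e rs)
  then show ?case
    using has_redex_item[of e "CEltR rs"] by (auto intro: has_redex_head is_redex.intros)
next
  case (EAlloc \<tau> e)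
  then show ?case
    using has_redex_item[of e "CAlloc \<tau>"] by (auto intro: has_redex_head is_redex.intros)
next
  case (EFree e)
  then show ?case
    using has_redex_item[of e CFree] by (auto intro: has_redex_head is_redex.intros)
next
  case (EUnOp op e)
  then show ?case
    using has_redex_item[of e "CUnOp op"] by (auto intro: has_redex_head is_redex.intros)
next
  case (EIf e1 e2 e3)
  then show ?case
    using has_redex_item[of e1 "CIf e2 e3"] by (auto intro: has_redex_head is_redex.intros)
next
  case (EComma e1 e2)
  then show ?case
    using has_redex_item[of e1 "CComma e2"] by (auto intro: has_redex_head is_redex.intros)
next
  case (ECast \<tau> e)
  then show ?case
    using has_redex_item[of e "CCast \<tau>"] by (auto intro: has_redex_head is_redex.intros)
qed (auto intro: has_redex_head is_redex.intros is_nf.intros)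

section \<open>Reducibility with a postcondition\<close>

text \<open>A weakest precondition for head steps that excludes the other two fates of a redex: a
  call, which leaves the expression focus, and undefined behaviour, which needs the absence of head
  steps.\<close>

definition head_reduces ::
    "env \<Rightarrow> stack \<Rightarrow> expr \<Rightarrow> mem \<Rightarrow> (expr \<Rightarrow> mem \<Rightarrow> bool) \<Rightarrow> bool" where
  "head_reduces \<Gamma> \<rho> e m Q \<longleftrightarrow> (\<nexists>\<Omega> f \<tau>s \<tau> \<Omega>vs. e = call_redex \<Omega> f \<tau>s \<tau> \<Omega>vs) \<and>
    (\<exists>e' m'. ehstep \<Gamma> \<rho> e m e' m') \<and> (\<forall>e' m'. ehstep \<Gamma> \<rho> e m e' m' \<longrightarrow> Q e' m')"

text \<open>Quantifying over all decompositions accounts for the nondeterministic evaluation order: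
  \<open>Q\<close> must hold whichever redex is reduced. Nothing is demanded of values.\<close>

definition reduces ::
    "env \<Rightarrow> stack \<Rightarrow> expr \<Rightarrow> mem \<Rightarrow> (expr \<Rightarrow> mem \<Rightarrow> bool) \<Rightarrow> bool" where
  "reduces \<Gamma> \<rho> e m Q \<longleftrightarrow> (\<forall>E e'. e = ectx_fill E e' \<longrightarrow> is_redex e' \<longrightarrow>
    head_reduces \<Gamma> \<rho> e' m (\<lambda>e'' m'. Q (ectx_fill E e'') m'))"

lemma reduces_mono:
  "reduces \<Gamma> \<rho> e m P \<Longrightarrow> (\<And>e' m'. P e' m' \<Longrightarrow> Q e' m') \<Longrightarrow> reduces \<Gamma> \<rho> e m Q"
  by (auto simp: reduces_def head_reduces_def)

text \<open>A redex is the whole expression or lies below the outermost constructor; in the second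
  case the postcondition is pulled back along that item.\<close>

lemma reducesI:
  assumes "is_redex e \<Longrightarrow> head_reduces \<Gamma> \<rho> e m Q"
    and "\<And>i e'. e = ectx_item_fill i e' \<Longrightarrow>
      reduces \<Gamma> \<rho> e' m (\<lambda>e'' m'. Q (ectx_item_fill i e'') m')"
  shows "reduces \<Gamma> \<rho> e m Q"
  unfolding reduces_def
proof (intro allI impI)
  fix E e'
  assume e: "e = ectx_fill E e'" and "is_redex e'"
  then show "head_reduces \<Gamma> \<rho> e' m (\<lambda>e'' m'. Q (ectx_fill E e'') m')"
  proof (cases E rule: rev_cases)
    case (snoc E' i)
    with e have "reduces \<Gamma> \<rho> (ectx_fill E' e') m (\<lambda>e'' m'. Q (ectx_item_fill i e'') m')"
      by (intro assms(2)) simp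
    with snoc \<open>is_redex e'\<close> show ?thesis
      by (auto simp: reduces_def)
  qed (use assms(1) in simp)
qed

lemma reduces_EVal [simp]: "reduces \<Gamma> \<rho> (EVal \<Omega> \<nu>) m Q"
  by (auto simp: reduces_def)

lemma reduces_EVar:
  assumes "lookup \<rho> i = Some (x, \<tau>)" and "Q (EVal {||} (Inl (Ptr (addr_top x \<tau>)))) m"
  shows "reduces \<Gamma> \<rho> (EVar i) m Q"
proof (rule reducesI)
  show "head_reduces \<Gamma> \<rho> (EVar i) m Q"
    using assms by (auto simp: head_reduces_def call_redex_def elim: ehstep.cases intro: estep_var)
  show "reduces \<Gamma> \<rho> e' m (\<lambda>e'' m'. Q (ectx_item_fill j e'') m')" if "EVar i = ectx_item_fill j e'" for j e'
    using that by (cases j) auto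
qed

text \<open>A congruence rule, like those for the other constructors below: reduction happens inside
  an operand, or at the root once all operands are values.\<close>

lemma reduces_ELoad:
  assumes "reduces \<Gamma> \<rho> e m (\<lambda>e' m'. Q (ELoad e') m')"
    and "is_nf e \<Longrightarrow> head_reduces \<Gamma> \<rho> (ELoad e) m Q"
  shows "reduces \<Gamma> \<rho> (ELoad e) m Q"
proof (rule reducesI)
  show "head_reduces \<Gamma> \<rho> (ELoad e) m Q" if "is_redex (ELoad e)"
    using that assms(2) by cases auto
  show "reduces \<Gamma> \<rho> e' m (\<lambda>e'' m'. Q (ectx_item_fill i e'') m')" if "ELoad e = ectx_item_fill i e'" for i e'
    using that assms(1) by (cases i) auto
qed

lemma reduces_EUnOp:
  assumes "reduces \<Gamma> \<rho> e m (\<lambda>e' m'. Q (EUnOp op e') m')"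
    and "is_nf e \<Longrightarrow> head_reduces \<Gamma> \<rho> (EUnOp op e) m Q"
  shows "reduces \<Gamma> \<rho> (EUnOp op e) m Q"
proof (rule reducesI)
  show "head_reduces \<Gamma> \<rho> (EUnOp op e) m Q" if "is_redex (EUnOp op e)"
    using that assms(2) by cases auto
  show "reduces \<Gamma> \<rho> e' m (\<lambda>e'' m'. Q (ectx_item_fill i e'') m')" if "EUnOp op e = ectx_item_fill i e'" for i e'
    using that assms(1) by (cases i) auto
qed

lemma reduces_ECast:
  assumes "reduces \<Gamma> \<rho> e m (\<lambda>e' m'. Q (ECast \<tau> e') m')"
    and "is_nf e \<Longrightarrow> head_reduces \<Gamma> \<rho> (ECast \<tau> e) m Q"
  shows "reduces \<Gamma> \<rho> (ECast \<tau> e) m Q"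
proof (rule reducesI)
  show "head_reduces \<Gamma> \<rho> (ECast \<tau> e) m Q" if "is_redex (ECast \<tau> e)"
    using that assms(2) by cases auto
  show "reduces \<Gamma> \<rho> e' m (\<lambda>e'' m'. Q (ectx_item_fill i e'') m')" if "ECast \<tau> e = ectx_item_fill i e'" for i e'
    using that assms(1) by (cases i) auto
qed

lemma reduces_EBinOp:
  assumes "reduces \<Gamma> \<rho> e1 m (\<lambda>e' m'. Q (EBinOp op e' e2) m')"
    and "reduces \<Gamma> \<rho> e2 m (\<lambda>e' m'. Q (EBinOp op e1 e') m')"
    and "is_nf e1 \<Longrightarrow> is_nf e2 \<Longrightarrow> head_reduces \<Gamma> \<rho> (EBinOp op e1 e2) m Q"
  shows "reduces \<Gamma> \<rho> (EBinOp op e1 e2) m Q"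
proof (rule reducesI)
  show "head_reduces \<Gamma> \<rho> (EBinOp op e1 e2) m Q" if "is_redex (EBinOp op e1 e2)"
    using that assms(3) by cases auto
  show "reduces \<Gamma> \<rho> e' m (\<lambda>e'' m'. Q (ectx_item_fill i e'') m')"
    if "EBinOp op e1 e2 = ectx_item_fill i e'" for i e'
    using that assms(1,2) by (cases i) auto
qed

lemma reduces_EAssign:
  assumes "reduces \<Gamma> \<rho> e1 m (\<lambda>e' m'. Q (EAssign ass e' e2) m')"
    and "reduces \<Gamma> \<rho> e2 m (\<lambda>e' m'. Q (EAssign ass e1 e') m')"
    and "is_nf e1 \<Longrightarrow> is_nf e2 \<Longrightarrow> head_reduces \<Gamma> \<rho> (EAssign ass e1 e2) m Q"
  shows "reduces \<Gamma> \<rho> (EAssign ass e1 e2) m Q"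
proof (rule reducesI)
  show "head_reduces \<Gamma> \<rho> (EAssign ass e1 e2) m Q" if "is_redex (EAssign ass e1 e2)"
    using that assms(3) by cases auto
  show "reduces \<Gamma> \<rho> e' m (\<lambda>e'' m'. Q (ectx_item_fill i e'') m')"
    if "EAssign ass e1 e2 = ectx_item_fill i e'" for i e'
    using that assms(1,2) by (cases i) auto
qed

text \<open>With calls and undefined behaviour ruled out by \<open>reduces\<close>, only head steps
  remain. The \<open>CExpr\<close> item contributes no locals, so variables are resolved in
  \<open>locals k\<close>.\<close>

lemma cstep_exprE:
  assumes "cstep \<Gamma> \<delta> [] (State (CExpr e0 E0 # k) (Expr e) m) S"
    and "\<not> is_nf e" and "reduces \<Gamma> (locals k) e m P"
  obtains e' m' where "S = State (CExpr e0 E0 # k) (Expr e') m'" and "P e' m'"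
  using assms(1)
proof cases
  case (cstep_expr_head e1 e2 m2 E)
  then show ?thesis
    using assms(3) that ehstep_is_redex
    by (fastforce simp: reduces_def head_reduces_def)
next
  case (cstep_expr_call E \<Omega> f \<tau>s \<tau> \<Omega>vs)
  then show ?thesis
    using assms(3) is_redex_call_redex by (fastforce simp: reduces_def head_reduces_def)
next
  case (cstep_expr_undef e1 E)
  then show ?thesis
    using assms(3) ehsafe.intros(2) by (fastforce simp: reduces_def head_reduces_def)
qed (use assms(2) in \<open>auto simp: is_nf_iff\<close>)

text \<open>Undefined behaviour is itself a step, so a non-value can always move; it is the stuck
  \<open>Undef\<close> state reached afterwards that safety forbids.\<close>

lemma cstep_expr_progress:
  assumes "\<not> is_nf e"
  shows "\<exists>S. cstep \<Gamma> \<delta> \<rho> (State k (Expr e) m) S"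
proof -
  obtain E e' where e: "e = ectx_fill E e'" "is_redex e'"
    using has_redex_if_not_nf[OF assms] by (auto simp: has_redex_def)
  show ?thesis
  proof (cases "ehsafe \<Gamma> (locals k @ \<rho>) e' m")
    case True
    then show ?thesis
      using e by cases (auto intro: cstep_expr_call cstep_expr_head)
  next
    case False
    then show ?thesis
      using e by (auto intro: cstep_expr_undef)
  qed
qed

text \<open>An invariant closed under reduction suffices: the induction is on the index, so
  evaluation needs no termination measure.\<close>

lemma safe_expr:
  assumes "P e m" and "\<And>e m. P e m \<Longrightarrow> reduces \<Gamma> (locals k) e m P"
    and "\<And>\<Omega> \<nu> m. P (EVal \<Omega> \<nu>) m \<Longrightarrow> safe \<Gamma> \<delta> n (State (CExpr e0 E0 # k) (Expr (EVal \<Omega> \<nu>)) m)"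
  shows "safe \<Gamma> \<delta> n (State (CExpr e0 E0 # k) (Expr e) m)"
  using assms(1,3)
proof (induction n arbitrary: e m)
  case (Suc n)
  show ?case
  proof (cases "is_nf e")
    case True
    then show ?thesis
      using Suc.prems by (auto simp only: is_nf_iff)
  next
    case False
    have "safe \<Gamma> \<delta> n S" if "cstep \<Gamma> \<delta> [] (State (CExpr e0 E0 # k) (Expr e) m) S" for S
      using that False assms(2)[OF Suc.prems(1)]
      by (rule cstep_exprE) (use Suc.IH Suc.prems(2) safe_Suc_imp in blast)
    then show ?thesis
      using cstep_expr_progress[OF False] by simp
  qed
qed simp

lemma cstep_value:
  "cstep \<Gamma> \<delta> \<rho> (State (CExpr e CDoE # k) (Expr (EVal \<Omega> \<nu>)) m) S \<longleftrightarrow>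
    S = State k (Stmt Up (SDo e)) (mem_unlock \<Omega> m)"
  "cstep \<Gamma> \<delta> \<rho> (State (CExpr e CRetE # k) (Expr (EVal \<Omega> (Inr v))) m) S \<longleftrightarrow>
    S = State k (Stmt (Top v) (SRet e)) (mem_unlock \<Omega> m)"
  "cstep \<Gamma> \<delta> \<rho> (State (CExpr e (CIfE s1 s2) # k) (Expr (EVal \<Omega> (Inr (intV \<tau>i z)))) m) S \<longleftrightarrow>
    S = (if z = 0 then State (CStmt (CIfR e s1) # k) (Stmt Down s2) (mem_unlock \<Omega> m)
      else State (CStmt (CIfL e s2) # k) (Stmt Down s1) (mem_unlock \<Omega> m))"
  by (auto elim!: cstep.cases intro: cstep.intros)

section \<open>Stores in memory\<close>

lemma int_typed_sint: "int_typed z sintI \<longleftrightarrow> in_range z"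
  by (auto simp: int_typed_def int_lower_def int_upper_def in_range_def int_width_def char_bits_def)

lemma size_of_sint [simp]: "size_of \<Gamma> sintT = 4" "bit_size_of \<Gamma> sintT = 32"
  by (simp_all add: size_of_def size_align_of_def bit_size_of_def char_bits_def)

lemma int_width_sint [simp]: "int_width sintI = 32"
  by (simp add: int_width_def char_bits_def)

lemma length_int_to_bits [simp]: "length (int_to_bits \<tau>i z) = int_width \<tau>i"
  by (simp add: int_to_bits_def)

text \<open>Two's complement decoding subtracts \<open>2 ^ Suc n\<close> if the sign bit
  \<open>n\<close> is set. This is \<open>signed_take_bit n\<close>, the identity on the
  representable range.\<close>

lemma int_of_bits_to_bits_signed:
  assumes width: "int_width (IntType Signed r) = Suc n" and z: "- (2 ^ n) \<le> z" "z < 2 ^ n"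
  shows "int_of_bits (IntType Signed r) (int_to_bits (IntType Signed r) z) = z"
proof -
  have "int_of_bits (IntType Signed r) (int_to_bits (IntType Signed r) z) =
      take_bit (Suc n) z - 2 ^ Suc n * of_bool (bit z n)"
    unfolding int_of_bits_def int_to_bits_def width horner_sum_bit_eq_take_bit
    by (simp add: last_map)
  also have "\<dots> = signed_take_bit n z"
    by (simp add: signed_take_bit_eq_take_bit_minus)
  also have "\<dots> = z"
    using z by (simp add: signed_take_bit_int_eq_self_iff)
  finally show ?thesis .
qed

lemma int_of_bits_to_bits_sint:
  "in_range z \<Longrightarrow> int_of_bits sintI (int_to_bits sintI z) = z"
  by (rule int_of_bits_to_bits_signed[where n = 31]) (auto simp: in_range_def)

section \<open>Cells and the relation between stores and memories\<close>

fun cell_val :: "int option \<Rightarrow> base_val" where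
  "cell_val None = VIndet (TInt sintI)"
| "cell_val (Some z) = VInt sintI z"

text \<open>The permission is a parameter because an assignment leaves its object locked until the
  end of the full expression; all bits of the object share it.\<close>

definition sint_obj :: "env \<Rightarrow> perm \<Rightarrow> int option \<Rightarrow> mobj" where
  "sint_obj \<Gamma> \<gamma> v = Obj (MBase (TInt sintI) (map (PBit \<gamma>) (base_val_flatten \<Gamma> (cell_val v)))) False"

lemma length_flatten_cell_val [simp]: "length (base_val_flatten \<Gamma> (cell_val v)) = 32"
  by (cases v) simp_all

lemma base_val_unflatten_cell_val:
  assumes "in_range z"
  shows "base_val_unflatten \<Gamma> (TInt sintI) (base_val_flatten \<Gamma> (cell_val (Some z))) = VInt sintI z"
proof -
  have "those (map bit_to_bool (map BBit bs)) = Some bs" for bs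
    by (induction bs) auto
  then show ?thesis
    using int_of_bits_to_bits_sint[OF assms] by simp
qed

lemma map2_PBit_replicate:
  "length bs = n \<Longrightarrow> map2 PBit (replicate n \<gamma>) bs = map (PBit \<gamma>) bs"
  by (simp add: zip_replicate1 comp_def)

text \<open>Full permission means that no cell is locked, so the relation describes memories without
  pending assignments. Distinctness keeps a write or a free from affecting another variable.\<close>

definition store_rel :: "env \<Rightarrow> store \<Rightarrow> stack \<Rightarrow> mem \<Rightarrow> bool" where
  "store_rel \<Gamma> \<sigma> \<rho> m \<longleftrightarrow> distinct (map fst \<rho>) \<and>
    list_all2 (\<lambda>v (x, \<tau>). \<tau> = sintT \<and> (\<forall>z. v = Some z \<longrightarrow> in_range z) \<and>
      fmlookup m x = Some (sint_obj \<Gamma> perm_full v)) \<sigma> \<rho>"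

lemma store_rel_Nil: "store_rel \<Gamma> [] [] m"
  by (simp add: store_rel_def)

lemma store_rel_nth:
  assumes "store_rel \<Gamma> \<sigma> \<rho> m" and "i < length \<rho>" and "\<rho> ! i = (x, \<tau>)"
  shows "\<tau> = sintT" and "fmlookup m x = Some (sint_obj \<Gamma> perm_full (\<sigma> ! i))"
    and "\<And>z. \<sigma> ! i = Some z \<Longrightarrow> in_range z"
  using assms list_all2_nthD2[OF _ assms(2)] unfolding store_rel_def by fastforce+

lemma store_rel_length: "store_rel \<Gamma> \<sigma> \<rho> m \<Longrightarrow> length \<sigma> = length \<rho>"
  by (auto simp: store_rel_def list_all2_lengthD)

lemma store_rel_lookup:
  assumes "store_rel \<Gamma> \<sigma> \<rho> m" and "lookup \<sigma> i = Some v"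
  obtains x where "lookup \<rho> i = Some (x, sintT)"
    and "fmlookup m x = Some (sint_obj \<Gamma> perm_full v)" and "\<And>z. v = Some z \<Longrightarrow> in_range z"
proof -
  have i: "i < length \<rho>" "\<sigma> ! i = v"
    using assms store_rel_length by (auto simp: lookup_def split: if_splits)
  obtain x \<tau> where x: "\<rho> ! i = (x, \<tau>)"
    by fastforce
  show thesis
    using that[of x] store_rel_nth[OF assms(1) i(1) x] i x by (auto simp: lookup_def)
qed

text \<open>A frame rule: the relation depends on the memory only through the objects of the
  stack.\<close>

lemma store_rel_mem_cong:
  assumes "store_rel \<Gamma> \<sigma> \<rho> m"
    and "\<And>x v. x \<in> fst ` set \<rho> \<Longrightarrow> fmlookup m x = Some (sint_obj \<Gamma> perm_full v) \<Longrightarrow>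
      fmlookup m' x = fmlookup m x"
  shows "store_rel \<Gamma> \<sigma> \<rho> m'"
proof -
  have "list_all2 (\<lambda>v (x, \<tau>). \<tau> = sintT \<and> (\<forall>z. v = Some z \<longrightarrow> in_range z) \<and>
      fmlookup m' x = Some (sint_obj \<Gamma> perm_full v)) \<sigma> \<rho>"
  proof (rule list.rel_mono_strong)
    fix v p
    assume p: "p \<in> set \<rho>" and rel: "case p of (x, \<tau>) \<Rightarrow> \<tau> = sintT \<and> (\<forall>z. v = Some z \<longrightarrow> in_range z) \<and>
      fmlookup m x = Some (sint_obj \<Gamma> perm_full v)"
    have "fst p \<in> fst ` set \<rho>"
      using p by blast
    then show "case p of (x, \<tau>) \<Rightarrow> \<tau> = sintT \<and> (\<forall>z. v = Some z \<longrightarrow> in_range z) \<and>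
      fmlookup m' x = Some (sint_obj \<Gamma> perm_full v)"
      using rel assms(2)[of "fst p" v] by (simp add: case_prod_unfold)
  qed (use assms(1) in \<open>simp add: store_rel_def\<close>)
  then show ?thesis
    using assms(1) by (simp add: store_rel_def)
qed

lemma store_rel_alloc:
  assumes "store_rel \<Gamma> \<sigma> \<rho> m" and "x |\<notin>| fmdom m"
  shows "store_rel \<Gamma> (None # \<sigma>) ((x, sintT) # \<rho>)
    (mem_alloc \<Gamma> x False perm_full (val_new \<Gamma> sintT) m)" (is "store_rel _ _ _ ?m")
proof -
  \<comment> \<open>Stack objects lie in the domain of \<open>m\<close>, so a fresh \<open>x\<close>
    differs from all of them; this serves both the frame rule and distinctness.\<close>
  have dom: "y |\<in>| fmdom m" if y: "(y, \<tau>) \<in> set \<rho>" for y \<tau>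
  proof -
    obtain i where "i < length \<rho>" "\<rho> ! i = (y, \<tau>)"
      using y by (auto simp: in_set_conv_nth)
    then show ?thesis
      using store_rel_nth(2)[OF assms(1)] fmdomI by metis
  qed
  then have "store_rel \<Gamma> \<sigma> \<rho> ?m"
    using assms(2) by (intro store_rel_mem_cong[OF assms(1)]) (auto simp: mem_alloc_def)
  moreover have "fmlookup ?m x = Some (sint_obj \<Gamma> perm_full None)"
    by (simp add: mem_alloc_def val_new_def sint_obj_def map2_PBit_replicate del: replicate.simps)
  ultimately show ?thesis
    using dom assms(2) by (auto simp: store_rel_def)
qed

lemma mem_free_other: "y \<noteq> x \<Longrightarrow> fmlookup (mem_free x m) y = fmlookup m y"
  by (simp add: mem_free_def split: option.split mobj.split)

lemma store_rel_free:
  assumes "store_rel \<Gamma> (v # \<sigma>) ((x, \<tau>) # \<rho>) m"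
  shows "store_rel \<Gamma> \<sigma> \<rho> (mem_free x m)"
proof -
  have rel: "store_rel \<Gamma> \<sigma> \<rho> m" and "x \<notin> fst ` set \<rho>"
    using assms by (auto simp: store_rel_def)
  then show ?thesis
    by (intro store_rel_mem_cong[OF rel]) (metis mem_free_other)
qed

text \<open>\<open>mem_unlock\<close> rebuilds every object bit by bit, so untouched objects need an
  argument too. Signed int objects are locked as a whole: \<open>\<beta>\<close> tells whether all
  or none of the bits are in the lock set.\<close>

lemma mem_unlock_sint_obj:
  assumes "fmlookup m x = Some (sint_obj \<Gamma> \<gamma> v)" and "\<And>i. i < 32 \<Longrightarrow> (x, i) |\<in>| \<Omega> \<longleftrightarrow> \<beta>"
  shows "fmlookup (mem_unlock \<Omega> m) x = Some (sint_obj \<Gamma> (if \<beta> then perm_unlock \<gamma> else \<gamma>) v)"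
proof -
  let ?xbs = "map (PBit \<gamma>) (base_val_flatten \<Gamma> (cell_val v))"
  have "map (\<lambda>i. (x, i) |\<in>| \<Omega>) [0..<length ?xbs] = replicate (length ?xbs) \<beta>"
    by (rule nth_equalityI) (use assms(2) in \<open>simp_all del: upt_rec_numeral\<close>)
  then show ?thesis
    using assms(1) unfolding mem_unlock_def sint_obj_def
    by (simp add: zip_replicate2 pbit_unlock_if_def comp_def del: upt_rec_numeral)
qed

lemma store_rel_unlock_empty:
  assumes "store_rel \<Gamma> \<sigma> \<rho> m"
  shows "store_rel \<Gamma> \<sigma> \<rho> (mem_unlock {||} m)"
  by (rule store_rel_mem_cong[OF assms]) (simp add: mem_unlock_sint_obj[where \<beta> = False])

section \<open>Loads from and assignments to whole objects\<close>

lemma addr_top_simps [simp]: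
  "addr_index (addr_top x \<tau>) = x" "addr_ref \<Gamma> (addr_top x \<tau>) = []"
  "addr_is_obj (addr_top x \<tau>)" "addr_strict \<Gamma> (addr_top x sintT)"
  "addr_type (addr_top x \<tau>) = TType \<tau>" "addr_object_offset \<Gamma> (addr_top x \<tau>) = 0"
  by (simp_all add: addr_top_def addr_ref_def addr_is_obj_def addr_strict_def
    addr_object_offset_def ref_object_offset_def)

lemma perm_full_simps [simp]:
  "perm_readable perm_full" "perm_writable perm_full" "perm_unlock (perm_lock perm_full) = perm_full"
  by (simp_all add: perm_full_def perm_readable_def perm_writable_def)

lemma mem_lookup_sint_obj:
  assumes "fmlookup m x = Some (sint_obj \<Gamma> perm_full (Some z))" and "in_range z"
  shows "mem_lookup \<Gamma> (addr_top x sintT) m = Some (intV sintI z)"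
  using assms(1) base_val_unflatten_cell_val[OF assms(2), of \<Gamma>]
  by (auto simp: mem_lookup_def cmap_lookup_def sint_obj_def comp_def
    simp del: base_val_unflatten.simps cell_val.simps)

text \<open>A load applies \<open>mem_force\<close> to the memory. The address of a whole object has
  an empty reference, so no union is traversed and loading a variable has no side effect.\<close>

lemma mem_force_top: "mem_force \<Gamma> (addr_top x \<tau>) m = m"
  by (auto simp: mem_force_def mem_alter_obj_def intro!: fmap_ext split: option.split mobj.split)

lemma mem_writable_sint_obj:
  "fmlookup m x = Some (sint_obj \<Gamma> perm_full v) \<Longrightarrow> mem_writable \<Gamma> (addr_top x sintT) m"
  by (auto simp: mem_writable_def cmap_lookup_def sint_obj_def)

lemma mem_lock_insert_sint_obj:
  assumes "fmlookup m x = Some (sint_obj \<Gamma> perm_full v)"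
  shows "mem_lock \<Gamma> (addr_top x sintT) (mem_insert \<Gamma> (addr_top x sintT) (intV sintI z) m) =
    fmupd x (sint_obj \<Gamma> (perm_lock perm_full) (Some z)) m"
proof -
  \<comment> \<open>Insertion takes over the permissions of the old tree, which are all full; only
    then is the object locked.\<close>
  have "map pbit_perm (map (PBit perm_full) (base_val_flatten \<Gamma> (cell_val v))) = replicate 32 perm_full"
    by (simp add: comp_def map_replicate_const)
  moreover have "map pbit_lock (map (PBit \<gamma>) bs) = map (PBit (perm_lock \<gamma>)) bs" for \<gamma> bs
    by (simp add: pbit_lock_def)
  ultimately show ?thesis
    using assms length_flatten_cell_val[of \<Gamma> "Some z"]
    by (auto simp: mem_lock_def mem_insert_def cmap_alter_def mem_alter_obj_def sint_obj_def
      map2_PBit_replicate simp del: map_map length_flatten_cell_val)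
qed

lemma lock_singleton_sint: "(y, j) |\<in>| lock_singleton \<Gamma> (addr_top x sintT) \<longleftrightarrow> y = x \<and> j < 32"
  by (auto simp: lock_singleton_def fset_of_list_elem char_bits_def)

text \<open>Between the write and the unlocking the relation fails, because the cell is locked;
  unlocking exactly the assigned bits restores it with the new value.\<close>

lemma store_rel_assign:
  assumes rel: "store_rel \<Gamma> \<sigma> \<rho> m" and i: "lookup \<rho> i = Some (x, \<tau>)" and z: "in_range z"
  shows "store_rel \<Gamma> (\<sigma>[i := Some z]) \<rho> (mem_unlock (lock_singleton \<Gamma> (addr_top x sintT))
    (mem_lock \<Gamma> (addr_top x sintT) (mem_insert \<Gamma> (addr_top x sintT) (intV sintI z) m)))"
    (is "store_rel _ _ _ ?m")
proof -
  have len: "length \<sigma> = length \<rho>" and dist: "distinct (map fst \<rho>)"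
    using rel store_rel_length by (auto simp: store_rel_def)
  have i': "i < length \<rho>" "\<rho> ! i = (x, \<tau>)"
    using i by (auto simp: lookup_def split: if_splits)
  note x = store_rel_nth(2)[OF rel i']
  have new: "fmlookup ?m x = Some (sint_obj \<Gamma> perm_full (Some z))"
    by (subst mem_unlock_sint_obj[where \<beta> = True and v = "Some z" and \<gamma> = "perm_lock perm_full"])
      (simp_all add: mem_lock_insert_sint_obj[OF x] lock_singleton_sint del: perm_lock.simps)
  have old: "fmlookup ?m y = Some (sint_obj \<Gamma> perm_full v)"
    if "fmlookup m y = Some (sint_obj \<Gamma> perm_full v)" "y \<noteq> x" for y v
    using that by (subst mem_unlock_sint_obj[where \<beta> = False and v = v and \<gamma> = perm_full])
      (simp_all add: mem_lock_insert_sint_obj[OF x] lock_singleton_sint)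
  \<comment> \<open>Distinct variables have distinct objects, so only position \<open>i\<close> of
    the store changes.\<close>
  have other: "fst (\<rho> ! j) \<noteq> x" if "j < length \<rho>" "j \<noteq> i" for j
    using that nth_eq_iff_index_eq[OF dist, of j i] i' by auto
  show ?thesis
    unfolding store_rel_def list_all2_conv_all_nth
  proof (intro conjI allI impI)
    fix j
    assume j: "j < length (\<sigma>[i := Some z])"
    obtain y \<tau>' where y: "\<rho> ! j = (y, \<tau>')"
      by fastforce
    have "\<tau>' = sintT \<and> (\<forall>z. \<sigma> ! j = Some z \<longrightarrow> in_range z) \<and>
        fmlookup m y = Some (sint_obj \<Gamma> perm_full (\<sigma> ! j))"
      using store_rel_nth[OF rel _ y] j len by simp
    then show "case \<rho> ! j of (y, \<tau>') \<Rightarrow> \<tau>' = sintT \<and>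
        (\<forall>z'. \<sigma>[i := Some z] ! j = Some z' \<longrightarrow> in_range z') \<and>
        fmlookup ?m y = Some (sint_obj \<Gamma> perm_full (\<sigma>[i := Some z] ! j))"
      using new old other[of j] y i' j z len by (cases "j = i") auto
  qed (use dist len in auto)
qed

section \<open>Evaluation of expressions\<close>

inductive partial_lval :: "stack \<Rightarrow> nat \<Rightarrow> expr \<Rightarrow> bool" for \<rho> i where
  "partial_lval \<rho> i (EVar i)"
| "lookup \<rho> i = Some (x, sintT) \<Longrightarrow> partial_lval \<rho> i (EVal {||} (Inl (Ptr (addr_top x sintT))))"

text \<open>The forms an expression takes during evaluation. Beyond the source syntax of
  \<open>eval\<close>, it admits loads from addresses already computed and the casts to signed int
  found in assignments and returns. Lock sets stay empty, as nothing is assigned.\<close>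

inductive partial_eval :: "store \<Rightarrow> stack \<Rightarrow> expr \<Rightarrow> int \<Rightarrow> bool" for \<sigma> \<rho> where
  partial_val: "in_range z \<Longrightarrow> partial_eval \<sigma> \<rho> (EInt z) z"
| partial_load: "partial_lval \<rho> i l \<Longrightarrow> lookup \<sigma> i = Some (Some z) \<Longrightarrow> in_range z \<Longrightarrow>
    partial_eval \<sigma> \<rho> (ELoad l) z"
| partial_not: "partial_eval \<sigma> \<rho> e z \<Longrightarrow> partial_eval \<sigma> \<rho> (EUnOp NotOp e) (of_bool (z = 0))"
| partial_binop: "partial_eval \<sigma> \<rho> e1 z1 \<Longrightarrow> partial_eval \<sigma> \<rho> e2 z2 \<Longrightarrow>
    eval_binop op z1 z2 = Some r \<Longrightarrow> in_range r \<Longrightarrow> partial_eval \<sigma> \<rho> (EBinOp op e1 e2) r"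
| partial_cast: "partial_eval \<sigma> \<rho> e z \<Longrightarrow> partial_eval \<sigma> \<rho> (ECast sintT e) z"

lemma partial_eval_in_range: "partial_eval \<sigma> \<rho> e z \<Longrightarrow> in_range z"
  by (induction rule: partial_eval.induct) (auto simp: in_range_def)

text \<open>The range of loaded values, which \<open>eval\<close> does not record, comes from
  \<open>store_rel\<close>.\<close>

lemma eval_partial_eval:
  assumes "eval \<sigma> e z" and "store_rel \<Gamma> \<sigma> \<rho> m"
  shows "partial_eval \<sigma> \<rho> e z"
  using assms(1)
proof induction
  case (eval_load i z)
  then show ?case
    using store_rel_lookup[OF assms(2)]
    by (metis partial_load partial_lval.intros(1))
next
  case (eval_not e z)
  then show ?case
    using partial_not by (auto simp: of_bool_def)
qed (auto intro: partial_eval.intros)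

lemma partial_eval_nf: "partial_eval \<sigma> \<rho> e z \<Longrightarrow> is_nf e \<Longrightarrow> e = EInt z"
  by (auto simp: is_nf_iff elim: partial_eval.cases)

lemma partial_eval_EVal [simp]: "partial_eval \<sigma> \<rho> (EVal \<Omega> \<nu>) z \<longleftrightarrow>
    \<Omega> = {||} \<and> \<nu> = Inr (intV sintI z) \<and> in_range z"
  by (auto elim: partial_eval.cases intro: partial_val)

lemma reduces_partial_lval:
  assumes "partial_lval \<rho> i l" and "lookup \<rho> i = Some (x, sintT)"
  shows "reduces \<Gamma> \<rho> l m (\<lambda>l' m'. m' = m \<and> partial_lval \<rho> i l')"
  using assms by cases (auto intro: reduces_EVar partial_lval.intros)

lemma int_cast_sint [simp]: "int_cast sintI z = z"
  by (simp add: int_cast_def)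

lemma int_cast_ok_sint [simp]: "int_cast_ok sintI z \<longleftrightarrow> in_range z"
  by (simp add: int_cast_ok_def int_typed_sint)

lemma int_common_sint [simp]: "int_common sintI sintI = sintI"
  by (simp add: int_common_def int_promote_def rank_max_def)

text \<open>For arithmetic, the range condition on the result is the absence of signed overflow,
  including the smallest integer divided by -1. The common type of the operands is signed int
  itself, so conversions change nothing.\<close>

lemma eval_binop_sint:
  assumes "eval_binop op z1 z2 = Some r" and "in_range z1" "in_range z2" "in_range r"
  shows "val_binop_ok \<Gamma> m op (intV sintI z1) (intV sintI z2)"
    and "val_binop \<Gamma> op (intV sintI z1) (intV sintI z2) = intV sintI r"
  using assms
  by (induction op z1 z2 rule: eval_binop.induct;
    auto simp: val_binop_ok_def val_binop_def int_arithop_def split: if_splits)+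

text \<open>Every redex met here has a head step, and each such step keeps the memory and the
  eventual value; hence the order of reductions is irrelevant.\<close>

lemma reduces_partial_eval:
  assumes "partial_eval \<sigma> \<rho> e z" and "store_rel \<Gamma> \<sigma> \<rho> m"
  shows "reduces \<Gamma> \<rho> e m (\<lambda>e' m'. m' = m \<and> partial_eval \<sigma> \<rho> e' z)"
  using assms(1)
proof induction
  case (partial_load i l z)
  obtain x where x: "lookup \<rho> i = Some (x, sintT)"
      "fmlookup m x = Some (sint_obj \<Gamma> perm_full (Some z))" "in_range z"
    using store_rel_lookup[OF assms(2) partial_load(2)] by metis
  show ?case
  proof (rule reduces_ELoad)
    show "reduces \<Gamma> \<rho> l m (\<lambda>e' m'. m' = m \<and> partial_eval \<sigma> \<rho> (ELoad e') z)"
      using reduces_partial_lval[OF partial_load(1) x(1)]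
      by (rule reduces_mono) (use partial_load partial_eval.partial_load in blast)
    assume "is_nf l"
    \<comment> \<open>Lookup of \<open>i\<close> is single-valued, so the address reached is that of
      \<open>x\<close>.\<close>
    then have "l = EVal {||} (Inl (Ptr (addr_top x sintT)))"
      using partial_load(1) x(1) by (auto simp: is_nf_iff elim!: partial_lval.cases)
    then show "head_reduces \<Gamma> \<rho> (ELoad l) m (\<lambda>e' m'. m' = m \<and> partial_eval \<sigma> \<rho> e' z)"
      using mem_lookup_sint_obj[OF x(2,3)] x(3)
      by (auto simp: head_reduces_def call_redex_def mem_force_top elim!: ehstep.cases
        intro: estep_load)
  qed
next
  case (partial_not e z)
  show ?case
  proof (rule reduces_EUnOp)
    show "reduces \<Gamma> \<rho> e m (\<lambda>e' m'. m' = m \<and> partial_eval \<sigma> \<rho> (EUnOp NotOp e') (of_bool (z = 0)))"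
      using partial_not.IH by (rule reduces_mono) (use partial_eval.partial_not in blast)
    assume "is_nf e"
    then have "e = EInt z"
      using partial_not.hyps partial_eval_nf by blast
    then show "head_reduces \<Gamma> \<rho> (EUnOp NotOp e) m
        (\<lambda>e' m'. m' = m \<and> partial_eval \<sigma> \<rho> e' (of_bool (z = 0)))"
      by (auto simp: head_reduces_def call_redex_def in_range_def elim!: ehstep.cases
        intro!: exI estep_unop)
  qed
next
  case (partial_binop e1 z1 e2 z2 op r)
  show ?case
  proof (rule reduces_EBinOp)
    show "reduces \<Gamma> \<rho> e1 m (\<lambda>e' m'. m' = m \<and> partial_eval \<sigma> \<rho> (EBinOp op e' e2) r)"
      using partial_binop.IH(1)
      by (rule reduces_mono) (use partial_binop.hyps partial_eval.partial_binop in blast)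
    show "reduces \<Gamma> \<rho> e2 m (\<lambda>e' m'. m' = m \<and> partial_eval \<sigma> \<rho> (EBinOp op e1 e') r)"
      using partial_binop.IH(2)
      by (rule reduces_mono) (use partial_binop.hyps partial_eval.partial_binop in blast)
    assume "is_nf e1" "is_nf e2"
    then have e: "e1 = EInt z1" "e2 = EInt z2" and z: "in_range z1" "in_range z2"
      using partial_binop.hyps partial_eval_nf partial_eval_in_range by blast+
    show "head_reduces \<Gamma> \<rho> (EBinOp op e1 e2) m (\<lambda>e' m'. m' = m \<and> partial_eval \<sigma> \<rho> e' r)"
      using eval_binop_sint[OF partial_binop.hyps(3) z partial_binop.hyps(4)] partial_binop.hyps(4)
      by (auto simp: e head_reduces_def call_redex_def elim!: ehstep.cases
        intro!: exI estep_binop)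
  qed
next
  case (partial_cast e z)
  show ?case
  proof (rule reduces_ECast)
    show "reduces \<Gamma> \<rho> e m (\<lambda>e' m'. m' = m \<and> partial_eval \<sigma> \<rho> (ECast sintT e') z)"
      using partial_cast.IH by (rule reduces_mono) (use partial_eval.partial_cast in blast)
    assume "is_nf e"
    then have "e = EInt z" "in_range z"
      using partial_cast.hyps partial_eval_nf partial_eval_in_range by blast+
    then show "head_reduces \<Gamma> \<rho> (ECast sintT e) m (\<lambda>e' m'. m' = m \<and> partial_eval \<sigma> \<rho> e' z)"
      by (auto simp: head_reduces_def call_redex_def elim!: ehstep.cases intro!: exI estep_cast)
  qed
qed simp

lemma safe_partial_eval:
  assumes "partial_eval \<sigma> (locals k) e z" and "store_rel \<Gamma> \<sigma> (locals k) m"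
    and "safe \<Gamma> \<delta> n (State (CExpr e0 E0 # k) (Expr (EInt z)) m)"
  shows "safe \<Gamma> \<delta> n (State (CExpr e0 E0 # k) (Expr e) m)"
  by (rule safe_expr[where P = "\<lambda>e' m'. m' = m \<and> partial_eval \<sigma> (locals k) e' z"])
    (use assms reduces_partial_eval in auto)

text \<open>Reductions of the two operands of an assignment may interleave, so the states of an
  evaluation are captured by an invariant instead of a sequence of steps.\<close>

inductive partial_assign :: "env \<Rightarrow> store \<Rightarrow> stack \<Rightarrow> nat \<Rightarrow> int \<Rightarrow> expr \<Rightarrow> mem \<Rightarrow> bool"
  for \<Gamma> \<sigma> \<rho> i z where
  assign_pending: "store_rel \<Gamma> \<sigma> \<rho> m \<Longrightarrow> partial_lval \<rho> i l \<Longrightarrow> partial_eval \<sigma> \<rho> r z \<Longrightarrow>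
    partial_assign \<Gamma> \<sigma> \<rho> i z (EAssign Assign l r) m"
| assign_done: "store_rel \<Gamma> (\<sigma>[i := Some z]) \<rho> (mem_unlock \<Omega> m) \<Longrightarrow>
    partial_assign \<Gamma> \<sigma> \<rho> i z (EVal \<Omega> (Inr v)) m"
| assign_void: "partial_assign \<Gamma> \<sigma> \<rho> i z e m \<Longrightarrow> partial_assign \<Gamma> \<sigma> \<rho> i z (ECast voidT e) m"

lemma val_cast_void [simp]: "val_cast_ok \<Gamma> m (TType voidT) v"
  by (cases v) auto

text \<open>While operands are evaluated the memory is still related to \<open>\<sigma>\<close>.
  After the write the cell is locked, so the updated store is related to the memory with the pending
  locks removed; a cast to void preserves the lock set.\<close>

lemma reduces_partial_assign:
  assumes "partial_assign \<Gamma> \<sigma> \<rho> i z e m" and "i < length \<sigma>"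
  shows "reduces \<Gamma> \<rho> e m (partial_assign \<Gamma> \<sigma> \<rho> i z)"
  using assms(1)
proof induction
  case (assign_pending m l r)
  have "lookup \<sigma> i = Some (\<sigma> ! i)"
    using assms(2) by (simp add: lookup_def)
  then obtain x where x: "lookup \<rho> i = Some (x, sintT)"
      "fmlookup m x = Some (sint_obj \<Gamma> perm_full (\<sigma> ! i))"
    using store_rel_lookup[OF assign_pending(1)] by metis
  show ?case
  proof (rule reduces_EAssign)
    show "reduces \<Gamma> \<rho> l m (\<lambda>e' m'. partial_assign \<Gamma> \<sigma> \<rho> i z (EAssign Assign e' r) m')"
      using reduces_partial_lval[OF assign_pending(2) x(1)]
      by (rule reduces_mono) (use assign_pending partial_assign.assign_pending in blast)
    show "reduces \<Gamma> \<rho> r m (\<lambda>e' m'. partial_assign \<Gamma> \<sigma> \<rho> i z (EAssign Assign l e') m')"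
      using reduces_partial_eval[OF assign_pending(3,1)]
      by (rule reduces_mono) (use assign_pending partial_assign.assign_pending in blast)
    assume "is_nf l" "is_nf r"
    then have l: "l = EVal {||} (Inl (Ptr (addr_top x sintT)))" and r: "r = EInt z" "in_range z"
      using assign_pending x(1) partial_eval_nf partial_eval_in_range
      by (auto simp: is_nf_iff elim!: partial_lval.cases)
    \<comment> \<open>The target has type signed int, so converting \<open>z\<close> is defined by
      its range and is the identity.\<close>
    have "assign_sem \<Gamma> m (addr_top x sintT) (intV sintI z) Assign v v' \<longleftrightarrow>
        v = intV sintI z \<and> v' = intV sintI z" for v v'
      using r(2) by (auto simp: assign_sem.simps)
    \<comment> \<open>Both operands carry empty lock sets, so the resulting lock set is just
      \<open>lock_singleton\<close>.\<close>
    then show "head_reduces \<Gamma> \<rho> (EAssign Assign l r) m (partial_assign \<Gamma> \<sigma> \<rho> i z)"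
      using mem_writable_sint_obj[OF x(2)] store_rel_assign[OF assign_pending(1) x(1) r(2)]
      by (auto simp: head_reduces_def call_redex_def l r elim!: ehstep.cases
        intro!: exI estep_assign assign_done)
  qed
next
  case (assign_void e m)
  show ?case
  proof (rule reduces_ECast)
    show "reduces \<Gamma> \<rho> e m (\<lambda>e' m'. partial_assign \<Gamma> \<sigma> \<rho> i z (ECast voidT e') m')"
      using assign_void.IH by (rule reduces_mono) (rule partial_assign.assign_void)
    assume "is_nf e"
    then obtain \<Omega> v where "e = EVal \<Omega> (Inr v)"
        "store_rel \<Gamma> (\<sigma>[i := Some z]) \<rho> (mem_unlock \<Omega> m)"
      using assign_void.hyps by (auto simp: is_nf_iff elim!: partial_assign.cases)
    then show "head_reduces \<Gamma> \<rho> (ECast voidT e) m (partial_assign \<Gamma> \<sigma> \<rho> i z)"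
      by (auto simp: head_reduces_def call_redex_def elim!: ehstep.cases
        intro!: exI estep_cast assign_done)
  qed
qed simp

lemma safe_partial_assign:
  assumes "partial_assign \<Gamma> \<sigma> (locals k) i z e m" and "i < length \<sigma>"
    and "\<And>m'. store_rel \<Gamma> (\<sigma>[i := Some z]) (locals k) m' \<Longrightarrow>
      safe \<Gamma> \<delta> n (State k (Stmt Up (SDo e0)) m')"
  shows "safe \<Gamma> \<delta> n (State (CExpr e0 CDoE # k) (Expr e) m)"
proof (rule safe_expr[where P = "partial_assign \<Gamma> \<sigma> (locals k) i z"])
  show "safe \<Gamma> \<delta> n (State (CExpr e0 CDoE # k) (Expr (EVal \<Omega> \<nu>)) m)"
    if "partial_assign \<Gamma> \<sigma> (locals k) i z (EVal \<Omega> \<nu>) m" for \<Omega> \<nu> m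
    using that assms(3) by cases (auto intro: safe_step[OF cstep_value(1)])
qed (use assms reduces_partial_assign in auto)

section \<open>Statements\<close>

fun outcome_dir :: "outcome \<Rightarrow> direction" where
  "outcome_dir (ONormal \<sigma>) = Up"
| "outcome_dir (OReturn z) = Top (intV sintI z)"
| "outcome_dir (OThrow n \<sigma>) = Throw n"

text \<open>A throw may be caught and execution resumed, so its store must be tracked. A return only
  unwinds, and its steps are enabled in every memory.\<close>

fun outcome_rel :: "env \<Rightarrow> outcome \<Rightarrow> stack \<Rightarrow> mem \<Rightarrow> bool" where
  "outcome_rel \<Gamma> (ONormal \<sigma>) \<rho> m \<longleftrightarrow> store_rel \<Gamma> \<sigma> \<rho> m"
| "outcome_rel \<Gamma> (OReturn z) \<rho> m \<longleftrightarrow> True"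
| "outcome_rel \<Gamma> (OThrow n \<sigma>) \<rho> m \<longleftrightarrow> store_rel \<Gamma> \<sigma> \<rho> m"

lemma safe_local_Suc:
  assumes "\<And>x. x |\<notin>| fmdom m \<Longrightarrow> safe \<Gamma> \<delta> n (State (CLocal x \<tau> # k) (Stmt Down s)
    (mem_alloc \<Gamma> x False perm_full (val_new \<Gamma> \<tau>) m))"
  shows "safe \<Gamma> \<delta> (Suc n) (State k (Stmt Down (SLocal \<tau> s)) m)"
proof -
  \<comment> \<open>Progress needs one fresh identifier, which exists since the domain is finite;
    preservation covers every choice.\<close>
  obtain x where "x |\<notin>| fmdom m"
    using ex_new_if_finite[OF infinite_UNIV_nat finite_fset] by blast
  then show ?thesis
    using assms by (auto simp: cstep_down)
qed

text \<open>The item \<open>E\<close> abstracts from the branch taken, so one argument handles both.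
  Entering the condition is counted as a step, which divergence will need.\<close>

lemma safe_if:
  assumes "eval \<sigma> e z" and "store_rel \<Gamma> \<sigma> (locals k) m"
    and "\<And>E m'. E \<in> {CIfL e s2, CIfR e s1} \<Longrightarrow>
      sctx_item_fill E (if z = 0 then s2 else s1) = SIf e s1 s2 \<Longrightarrow>
      store_rel \<Gamma> \<sigma> (locals k) m' \<Longrightarrow>
      safe \<Gamma> \<delta> n (State (CStmt E # k) (Stmt Down (if z = 0 then s2 else s1)) m')"
  shows "safe \<Gamma> \<delta> (Suc n) (State k (Stmt Down (SIf e s1 s2)) m)"
proof (rule safe_step_Suc[OF cstep_down(5)], rule safe_partial_eval[OF eval_partial_eval])
  show "safe \<Gamma> \<delta> n (State (CExpr e (CIfE s1 s2) # k) (Expr (EInt z)) m)"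
    by (rule safe_step[OF cstep_value(3)])
      (use assms(3)[of "CIfL e s2" "mem_unlock {||} m"] assms(3)[of "CIfR e s1" "mem_unlock {||} m"]
        store_rel_unlock_empty[OF assms(2)] in auto)
qed (use assms in auto)

lemma safe_unwind:
  assumes "abnormal ou" and "nothrown ou \<or> E \<noteq> CCatch"
    and "safe \<Gamma> \<delta> n (State k (Stmt (outcome_dir ou) (sctx_item_fill E s)) m)"
  shows "safe \<Gamma> \<delta> n (State (CStmt E # k) (Stmt (outcome_dir ou) s) m)"
  using assms
  by (cases ou) (auto simp: abnormal_def nothrown_def
    intro: safe_step[OF cstep_unwind(3)] safe_step[OF cstep_unwind(4)])

text \<open>The last premise is the continuation. It is used at the same index \<open>n\<close>,
  because \<open>safe_step\<close> does not count steps, while \<open>k\<close> and \<open>m\<close>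
  vary as subderivations are entered.\<close>

lemma safe_exec:
  assumes "exec \<sigma> s ou" and "store_rel \<Gamma> \<sigma> (locals k) m"
    and "\<And>m'. outcome_rel \<Gamma> ou (locals k) m' \<Longrightarrow>
      safe \<Gamma> \<delta> n (State k (Stmt (outcome_dir ou) s) m')"
  shows "safe \<Gamma> \<delta> n (State k (Stmt Down s) m)"
  using assms
proof (induction arbitrary: k m)
  case (exec_skip \<sigma>)
  then show ?case
    by (auto intro: safe_step[OF cstep_down(1)])
next
  case (exec_comp \<sigma> s1 \<sigma>' s2 ou)
  show ?case
  proof (rule safe_step[OF cstep_down(6)], rule exec_comp.IH(1))
    \<comment> \<open>The continuation of \<open>s1\<close> is to enter \<open>s2\<close>, whose own
      continuation is to leave the sequence with outcome \<open>ou\<close>.\<close>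
    fix m1
    assume "outcome_rel \<Gamma> (ONormal \<sigma>') (locals (CStmt (CCompL s2) # k)) m1"
    then have "safe \<Gamma> \<delta> n (State (CStmt (CCompR s1) # k) (Stmt Down s2) m1)"
    proof (intro exec_comp.IH(2))
      fix m2
      assume "outcome_rel \<Gamma> ou (locals (CStmt (CCompR s1) # k)) m2"
      then have "safe \<Gamma> \<delta> n (State k (Stmt (outcome_dir ou) (SComp s1 s2)) m2)"
        using exec_comp.prems(2) by simp
      then show "safe \<Gamma> \<delta> n (State (CStmt (CCompR s1) # k) (Stmt (outcome_dir ou) s2) m2)"
        by (cases ou) (auto intro: safe_step[OF cstep_up(2)]
          safe_step[OF cstep_unwind(3)] safe_step[OF cstep_unwind(4)])
    qed simp
    then show "safe \<Gamma> \<delta> n (State (CStmt (CCompL s2) # k) (Stmt (outcome_dir (ONormal \<sigma>')) s1) m1)"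
      by (auto intro: safe_step[OF cstep_up(1)])
  qed (use exec_comp.prems in simp)
next
  case (exec_comp_abnormal ou \<sigma> s1 s2)
  show ?case
    by (rule safe_step[OF cstep_down(6)], rule exec_comp_abnormal.IH, use exec_comp_abnormal.prems in simp,
      rule safe_unwind) (use exec_comp_abnormal in auto)
next
  case (exec_local_normal \<sigma> s mv \<sigma>')
  \<comment> \<open>In the body the new object heads the locals and matches \<open>None\<close>; on
    leaving, its final cell \<open>mv\<close> is dropped and the object freed.\<close>
  show ?case
    by (rule safe_Suc_imp, rule safe_local_Suc, rule exec_local_normal.IH)
      (use exec_local_normal.prems in \<open>auto simp: cstep_out_local
        intro!: safe_step[OF cstep_out_local] dest: store_rel_alloc store_rel_free\<close>)
next
  case (exec_local_return \<sigma> s z)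
  show ?case
    by (rule safe_Suc_imp, rule safe_local_Suc, rule exec_local_return.IH)
      (use exec_local_return.prems in \<open>auto
        intro!: safe_step[OF cstep_out_local] dest: store_rel_alloc\<close>)
next
  case (exec_local_throw \<sigma> s n' mv \<sigma>')
  show ?case
    by (rule safe_Suc_imp, rule safe_local_Suc, rule exec_local_throw.IH)
      (use exec_local_throw.prems in \<open>auto
        intro!: safe_step[OF cstep_out_local] dest: store_rel_alloc store_rel_free\<close>)
next
  case (exec_assign i \<sigma> e z)
  then show ?case
    by (intro safe_step[OF cstep_down(3)] safe_partial_assign[where z = z])
      (auto intro!: assign_pending partial_lval.intros partial_cast eval_partial_eval)
next
  case (exec_assign_void i \<sigma> e z)
  then show ?case
    by (intro safe_step[OF cstep_down(3)] safe_partial_assign[where z = z])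
      (auto intro!: assign_void assign_pending partial_lval.intros eval_partial_eval)
next
  case (exec_if \<sigma> e z s2 s1 ou)
  show ?case
  proof (rule safe_Suc_imp, rule safe_if[OF exec_if.hyps(1) exec_if.prems(1)], rule exec_if.IH)
    fix E m1 m2
    assume E: "E \<in> {CIfL e s2, CIfR e s1}" "sctx_item_fill E (if z = 0 then s2 else s1) = SIf e s1 s2"
      and "outcome_rel \<Gamma> ou (locals (CStmt E # k)) m2"
    then have "safe \<Gamma> \<delta> n (State k (Stmt (outcome_dir ou) (SIf e s1 s2)) m2)"
      using exec_if.prems(2) by simp
    then show "safe \<Gamma> \<delta> n
        (State (CStmt E # k) (Stmt (outcome_dir ou) (if z = 0 then s2 else s1)) m2)"
      using E by (cases ou) (auto intro: safe_step[OF cstep_up(5)] safe_step[OF cstep_up(6)]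
        safe_step[OF cstep_unwind(3)] safe_step[OF cstep_unwind(4)])
  qed simp
next
  case (exec_throw \<sigma> n')
  then show ?case
    by (auto intro: safe_step[OF cstep_down(2)])
next
  case (exec_catch_here \<sigma> s \<sigma>')
  show ?case
    by (rule safe_step[OF cstep_down(7)], rule exec_catch_here.IH)
      (use exec_catch_here.prems in \<open>auto intro: safe_step[OF cstep_unwind(1)]\<close>)
next
  case (exec_catch_further \<sigma> s n' \<sigma>')
  show ?case
    by (rule safe_step[OF cstep_down(7)], rule exec_catch_further.IH)
      (use exec_catch_further.prems in \<open>auto intro: safe_step[OF cstep_unwind(2)]\<close>)
next
  case (exec_catch_nothrown ou \<sigma> s)
  show ?case
  proof (rule safe_step[OF cstep_down(7)], rule exec_catch_nothrown.IH)
    fix m'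
    assume "outcome_rel \<Gamma> ou (locals (CStmt CCatch # k)) m'"
    then have "safe \<Gamma> \<delta> n (State k (Stmt (outcome_dir ou) (SCatch s)) m')"
      using exec_catch_nothrown.prems(2) by simp
    then show "safe \<Gamma> \<delta> n (State (CStmt CCatch # k) (Stmt (outcome_dir ou) s) m')"
      using exec_catch_nothrown.hyps(1)
      by (cases ou) (auto simp: nothrown_def intro: safe_step[OF cstep_up(3)] safe_step[OF cstep_unwind(4)])
  qed (use exec_catch_nothrown.prems in simp)
next
  case (exec_loop_abnormal ou \<sigma> s)
  show ?case
    by (rule safe_step[OF cstep_down(8)], rule exec_loop_abnormal.IH, use exec_loop_abnormal.prems in simp,
      rule safe_unwind) (use exec_loop_abnormal in auto)
next
  case (exec_loop ou \<sigma> s \<sigma>')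
  \<comment> \<open>After a normal iteration the focus enters the loop again in the same context
    \<open>k\<close>, where the hypothesis for the remaining iterations applies.\<close>
  show ?case
    by (rule safe_step[OF cstep_down(8)], rule exec_loop.IH(1))
      (use exec_loop.prems exec_loop.IH(2) in \<open>auto intro!: safe_step[OF cstep_up(4)]\<close>)
next
  case (exec_ret \<sigma> e z)
  show ?case
    by (rule safe_step[OF cstep_down(4)], rule safe_partial_eval[OF partial_cast[OF eval_partial_eval]])
      (use exec_ret in \<open>auto intro!: safe_step[OF cstep_value(2)]\<close>)
qed

text \<open>Each rule of \<open>execinf\<close> corresponds to a first small step that lowers the
  index, so plain case analysis on the coinductive predicate suffices at every stage.\<close>

lemma safe_execinf:
  assumes "execinf \<sigma> s" and "store_rel \<Gamma> \<sigma> (locals k) m"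
  shows "safe \<Gamma> \<delta> n (State k (Stmt Down s) m)"
  using assms
proof (induction n arbitrary: \<sigma> s k m)
  case (Suc n)
  from Suc.prems(1) show ?case
  proof cases
    case (execinf_comp1 s1 s2)
    show ?thesis
      unfolding execinf_comp1(1)
      by (rule safe_step_Suc[OF cstep_down(6)], rule Suc.IH[OF execinf_comp1(2)])
        (use Suc.prems(2) in simp)
  next
    case (execinf_comp2 s1 \<sigma>' s2)
    \<comment> \<open>The terminating prefix is crossed by \<open>safe_exec\<close> at index
      \<open>n\<close>, with the divergence of \<open>s2\<close> at that index as its
      continuation.\<close>
    have "safe \<Gamma> \<delta> n (State (CStmt (CCompL s2) # k) (Stmt Down s1) m)"
      by (rule safe_exec[OF execinf_comp2(2)])
        (use Suc.prems(2) execinf_comp2(3) Suc.IH in \<open>auto intro!: safe_step[OF cstep_up(1)]\<close>)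
    then show ?thesis
      unfolding execinf_comp2(1) by (rule safe_step_Suc[OF cstep_down(6)])
  next
    case (execinf_local s')
    show ?thesis
      unfolding execinf_local(1)
      by (rule safe_local_Suc, rule Suc.IH[OF execinf_local(2)])
        (use store_rel_alloc[OF Suc.prems(2)] in simp)
  next
    case (execinf_if e z s2 s1)
    show ?thesis
      unfolding execinf_if(1)
      by (rule safe_if[OF execinf_if(2) Suc.prems(2)], rule Suc.IH[OF execinf_if(3)]) simp
  next
    case (execinf_catch s')
    show ?thesis
      unfolding execinf_catch(1)
      by (rule safe_step_Suc[OF cstep_down(7)], rule Suc.IH[OF execinf_catch(2)])
        (use Suc.prems(2) in simp)
  next
    case (execinf_loop1 s')
    show ?thesis
      unfolding execinf_loop1(1)
      by (rule safe_step_Suc[OF cstep_down(8)], rule Suc.IH[OF execinf_loop1(2)])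
        (use Suc.prems(2) in simp)
  next
    case (execinf_loop2 s' \<sigma>')
    have "safe \<Gamma> \<delta> n (State (CStmt CLoop # k) (Stmt Down s') m)"
      by (rule safe_exec[OF execinf_loop2(2)])
        (use Suc.prems(2) execinf_loop2(3) Suc.IH in \<open>auto intro!: safe_step[OF cstep_up(4)]\<close>)
    then show ?thesis
      unfolding execinf_loop2(1) by (rule safe_step_Suc[OF cstep_down(8)])
  qed
qed simp

lemma safe_return_main: "safe \<Gamma> \<delta> n (State [] (Return ''main'' (intV sintI z)) m)"
  by (cases n) (auto simp: final_def cstep_return_main)

theorem theorem4p16:
  fixes \<Gamma> :: env and \<delta> :: funenv and s\<^sub>h :: stmt
  assumes "CHcorrect 0 s\<^sub>h []"
  shows "\<forall>S :: state.
    env_valid \<Gamma> \<longrightarrow>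
    funenv_valid \<Gamma> fmempty \<delta> \<longrightarrow>
    stmt_typed \<Gamma> fmempty [] s\<^sub>h (True, Some sintT) \<longrightarrow>
    (cstep \<Gamma> \<delta> [])\<^sup>*\<^sup>* (State [CParams ''main'' []] (Stmt Down s\<^sub>h) fmempty) S \<longrightarrow>
    (\<exists>S'. cstep \<Gamma> \<delta> [] S S') \<or>
    (\<exists>m z. S = State [] (Return ''main'' (intV sintI z)) m)"
proof -
  let ?k = "[CParams ''main'' []]"
  have rel: "store_rel \<Gamma> [] (locals ?k) fmempty"
    by (simp add: store_rel_Nil)
  have "safe \<Gamma> \<delta> n (State ?k (Stmt Down s\<^sub>h) fmempty)" for n
  proof -
    consider z where "exec [] s\<^sub>h (OReturn z)" | "execinf [] s\<^sub>h"
      using assms by (auto simp: CHcorrect_def)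
    then show ?thesis
    proof cases
      case 1
      then show ?thesis
        \<comment> \<open>The continuation is the return from the parameter item: its only step
          reaches the final state, as the remaining context is empty.\<close>
        using rel by (rule safe_exec)
          (auto intro!: safe_step[OF cstep_unwind(5)] safe_return_main)
    next
      case 2
      then show ?thesis
        using rel by (rule safe_execinf)
    qed
  qed
  then show ?thesis
    using safe_rtranclp[of \<Gamma> \<delta>] unfolding final_def by blast
qed

end
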